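(* Let $r\ge1$, $d\in\mathbb N$ and $N\in\mathbb N$ with $N\ge r$, and let $\Delta=\Delta(B_r)$ as in the context. Then \begin{align*} \sum_{\substack{a_1,\ldots,a_r\in\mathbb N\\ a_1+\cdots+a_r=N}}\zeta_r^\sharp(2da_1,\ldots,2da_r) &=\frac{(-1)^r}{2^r}\sum_{J=(j_1,\ldots,j_\nu)\in P_r}\frac{1}{j_1!\cdots j_\nu!}\sum_{(2dk_1,\ldots,2dk_r)\in\mathcal A_r(d,N,J)}\mathcal P_{\Delta_{s+}}\bigl((2dk_1,\ldots,2dk_r),\mathbf 0;\Delta\bigr)\prod_{\rho=1}^r\frac{(2\pi i)^{2dk_\rho}}{(2dk_\rho)!} \end{align*} and this value lies in $\mathbb Q\cdot\pi^{2dN}$.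
   Context: $\zeta_r^\sharp(s_1,\ldots,s_r)=\sum_{m_1,\ldots,m_r=1}^\infty\prod_{i=1}^r\bigl(2\sum_{j=r-i+1}^{r-1}m_j+m_r\bigr)^{-s_i}$. $I_r(d,N)=\{(2da_1,\ldots,2da_r)\in(2d\mathbb N)^r:a_1+\cdots+a_r=N\}$; $P_r=\bigcup_{\nu=1}^r\{(j_1,\ldots,j_\nu)\in\mathbb N^\nu:j_1+\cdots+j_\nu=r\}$; for $J=(j_1,\ldots,j_\nu)\in P_r$, $\mathcal A_r(d,N,J)=\{((2dh_1)^{[j_1]},\ldots,(2dh_\nu)^{[j_\nu]})\in I_r(d,N):h_1<\cdots<h_\nu\}$, where $x^{[j]}$ denotes $j$ consecutive copies of $x$. Type $B_r$: $V=\mathbb R^r$, standard basis $e_i$; $\Delta=\{\pm e_i\pm e_j:i<j\}\cup\{\pm e_i\}$, simple roots $\alpha_i=e_i-e_{i+1}$ ($i<r$), $\alpha_r=e_r$, $\Delta_+=\{e_i\pm e_j\ (i<j)\}\cup\{e_i\}$, $\alpha^\vee=2\alpha/\langle\alpha,\alpha\rangle$, $Q^\vee=\bigoplus\mathbb Z\alpha_i^\vee$. $\Delta_{s+}=\{\gamma_1,\ldots,\gamma_r\}$ with $\gamma_i=e_{r-i+1}$; a tuple $(x_1,\ldots,x_r)$ indexed by $\Delta_{s+}$ attaches $x_i$ to $\gamma_i$. Coefficients $\mathcal P_{\Delta^*}$ for $\Delta^*\subset\Delta_+$: $\mathscr V$ = subsets $\mathbf V\subset\Delta_+$ forming bases of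 $V$; $\{\mu^{\mathbf V}_\beta\}$ dual to $\{\beta^\vee\}_{\beta\in\mathbf V}$; $L(\mathbf V^\vee)=\bigoplus_{\beta\in\mathbf V}\mathbb Z\beta^\vee$; fixed $\phi\in V$ with all $\langle\phi,\mu^{\mathbf V}_\beta\rangle\ne0$; $\{\mathbf y\}_{\mathbf V,\beta}=\{\langle\mathbf y,\mu^{\mathbf V}_\beta\rangle\}$ if $\langle\phi,\mu^{\mathbf V}_\beta\rangle>0$, $=1-\{-\langle\mathbf y,\mu^{\mathbf V}_\beta\rangle\}$ otherwise. With $A=\Delta_+\setminus\Delta^*=\{\nu_1,\ldots,\nu_N\}$, $A_j=\{\nu_1,\ldots,\nu_j\}$, $A_0=\emptyset$, $\mathscr V_A=\{\mathbf V\in\mathscr V:\nu_{j+1}\notin\mathrm{L.h.}[\mathbf V\cap A_j],\ 0\le j\le N-1\}$, $$F_{\Delta^*}(\mathbf t_{\Delta^*},\mathbf y;\Delta)=\sum_{\mathbf V\in\mathscr V_A}(-1)^{|A\setminus\mathbf V|}\Bigl(\prod_{\gamma\in\Delta_+\setminus(\mathbf V\cup A)}\frac{t_\gamma}{t_\gamma-\sum_{\beta\in\mathbf V\setminus A}t_\beta\langle\gamma^\vee,\mu^{\mathbf V}_\beta\rangle}\Bigr)\frac{1}{|Q^\vee/L(\mathbf V^\vee)|}\sum_{q\in Q^\vee/L(\mathbf V^\vee)}\prod_{\beta\in\mathbf V\setminus A}\frac{t_\beta e^{t_\beta\{\mathbf y+q\}_{\mathbf V,\beta}}}{e^{t_\beta}-1}=\sum_{\mathbf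 k}\mathcal P_{\Delta^*}(\mathbf k,\mathbf y;\Delta)\prod_{\alpha\in\Delta^*}\frac{t_\alpha^{k_\alpha}}{k_\alpha!}.$$ *)

theory Defs
  imports "HOL-Complex_Analysis.Complex_Analysis"
begin

text \<open>Vectors of V = R^r are functions nat => real supported on {0..<r};
  coordinate k (0-based) corresponds to e_(k+1) of the paper.\<close>

definition unitv :: "nat \<Rightarrow> nat \<Rightarrow> real" where
  "unitv i = (\<lambda>k. if k = i then 1 else 0)"

definition inV :: "nat \<Rightarrow> (nat \<Rightarrow> real) \<Rightarrow> bool" where
  "inV r x \<longleftrightarrow> (\<forall>k\<ge>r. x k = 0)"

definition ip :: "nat \<Rightarrow> (nat \<Rightarrow> real) \<Rightarrow> (nat \<Rightarrow> real) \<Rightarrow> real" where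
  "ip r x y = (\<Sum>k<r. x k * y k)"

definition posroots_B :: "nat \<Rightarrow> (nat \<Rightarrow> real) set" where
  "posroots_B r =
     {(\<lambda>k. unitv i k - unitv j k) | i j. i < j \<and> j < r}
   \<union> {(\<lambda>k. unitv i k + unitv j k) | i j. i < j \<and> j < r}
   \<union> {unitv i | i. i < r}"

text \<open>Short positive roots Delta_{s+} = {gamma_1,...,gamma_r}, gamma_i = e_{r-i+1}
  (0-based coordinate r-i).\<close>
definition gammaB :: "nat \<Rightarrow> nat \<Rightarrow> (nat \<Rightarrow> real)" where
  "gammaB r i = unitv (r - i)"

definition short_posroots_B :: "nat \<Rightarrow> (nat \<Rightarrow> real) set" where
  "short_posroots_B r = {gammaB r i | i. 1 \<le> i \<and> i \<le> r}"

definition coroot :: "nat \<Rightarrow> (nat \<Rightarrow> real) \<Rightarrow> (nat \<Rightarrow> real)" where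
  "coroot r \<alpha> = (\<lambda>k. 2 / ip r \<alpha> \<alpha> * \<alpha> k)"

definition simple_root :: "nat \<Rightarrow> nat \<Rightarrow> (nat \<Rightarrow> real)" where
  "simple_root r i = (if i < r then (\<lambda>k. unitv (i - 1) k - unitv i k) else unitv (r - 1))"

definition coroot_lattice :: "nat \<Rightarrow> (nat \<Rightarrow> real) set" where
  "coroot_lattice r =
     {(\<lambda>k. \<Sum>i\<in>{1..r}. of_int (c i) * coroot r (simple_root r i) k) | c :: nat \<Rightarrow> int. True}"

definition Lcoroots :: "nat \<Rightarrow> (nat \<Rightarrow> real) set \<Rightarrow> (nat \<Rightarrow> real) set" where
  "Lcoroots r V = {(\<lambda>k. \<Sum>\<beta>\<in>V. of_int (c \<beta>) * coroot r \<beta> k) | c :: (nat \<Rightarrow> real) \<Rightarrow> int. True}"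

definition lin_hull :: "(nat \<Rightarrow> real) set \<Rightarrow> (nat \<Rightarrow> real) set" where
  "lin_hull S = {(\<lambda>k. \<Sum>\<beta>\<in>S. c \<beta> * \<beta> k) | c :: (nat \<Rightarrow> real) \<Rightarrow> real. True}"

definition lin_indep :: "(nat \<Rightarrow> real) set \<Rightarrow> bool" where
  "lin_indep S \<longleftrightarrow> finite S \<and>
     (\<forall>c :: (nat \<Rightarrow> real) \<Rightarrow> real. (\<forall>k. (\<Sum>\<beta>\<in>S. c \<beta> * \<beta> k) = 0) \<longrightarrow> (\<forall>\<beta>\<in>S. c \<beta> = 0))"

definition bases_B :: "nat \<Rightarrow> (nat \<Rightarrow> real) set set" where
  "bases_B r = {Vb. Vb \<subseteq> posroots_B r \<and> lin_indep Vb \<and> (\<forall>x. inV r x \<longrightarrow> x \<in> lin_hull Vb)}"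

definition mu :: "nat \<Rightarrow> (nat \<Rightarrow> real) set \<Rightarrow> (nat \<Rightarrow> real) \<Rightarrow> (nat \<Rightarrow> real)" where
  "mu r Vb \<beta> = (THE m. inV r m \<and> (\<forall>\<gamma>\<in>Vb. ip r (coroot r \<gamma>) m = (if \<gamma> = \<beta> then 1 else 0)))"

definition brace :: "nat \<Rightarrow> (nat \<Rightarrow> real) \<Rightarrow> (nat \<Rightarrow> real) set \<Rightarrow> (nat \<Rightarrow> real) \<Rightarrow> (nat \<Rightarrow> real) \<Rightarrow> real" where
  "brace r \<phi> Vb y \<beta> =
     (if ip r \<phi> (mu r Vb \<beta>) > 0 then frac (ip r y (mu r Vb \<beta>))
      else 1 - frac (- ip r y (mu r Vb \<beta>)))"

definition Qclasses :: "nat \<Rightarrow> (nat \<Rightarrow> real) set \<Rightarrow> (nat \<Rightarrow> real) set set" where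
  "Qclasses r Vb = coroot_lattice r //
     {(p, q). p \<in> coroot_lattice r \<and> q \<in> coroot_lattice r \<and> (\<lambda>k. p k - q k) \<in> Lcoroots r Vb}"

text \<open>script-V_A, where the list nus = [nu_1,...,nu_N] enumerates A = Delta_+ - Delta*;
  A_j = set (take j nus).\<close>
definition VA :: "nat \<Rightarrow> (nat \<Rightarrow> real) list \<Rightarrow> (nat \<Rightarrow> real) set set" where
  "VA r nus = {Vb \<in> bases_B r. \<forall>j < length nus. nus ! j \<notin> lin_hull (Vb \<inter> set (take j nus))}"

definition Fgen :: "nat \<Rightarrow> (nat \<Rightarrow> real) set \<Rightarrow> (nat \<Rightarrow> real) list \<Rightarrow> (nat \<Rightarrow> real)
    \<Rightarrow> (nat \<Rightarrow> real) \<Rightarrow> ((nat \<Rightarrow> real) \<Rightarrow> complex) \<Rightarrow> complex" where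
  "Fgen r Dstar nus \<phi> y t =
    (let A = posroots_B r - Dstar in
     \<Sum>Vb\<in>VA r nus.
       (-1) ^ card (A - Vb) *
       (\<Prod>\<gamma>\<in>posroots_B r - (Vb \<union> A).
          t \<gamma> / (t \<gamma> - (\<Sum>\<beta>\<in>Vb - A. t \<beta> * of_real (ip r (coroot r \<gamma>) (mu r Vb \<beta>))))) *
       (1 / of_nat (card (Qclasses r Vb))) *
       (\<Sum>X\<in>Qclasses r Vb.
          \<Prod>\<beta>\<in>Vb - A.
            t \<beta> * exp (t \<beta> * of_real (brace r \<phi> Vb (\<lambda>k. y k + (SOME q. q \<in> X) k) \<beta>))
              / (exp (t \<beta>) - 1)))"

definition Fdefined :: "nat \<Rightarrow> (nat \<Rightarrow> real) set \<Rightarrow> (nat \<Rightarrow> real) list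
    \<Rightarrow> ((nat \<Rightarrow> real) \<Rightarrow> complex) \<Rightarrow> bool" where
  "Fdefined r Dstar nus t \<longleftrightarrow>
    (let A = posroots_B r - Dstar in
     \<forall>Vb\<in>VA r nus.
       (\<forall>\<beta>\<in>Vb - A. exp (t \<beta>) \<noteq> 1) \<and>
       (\<forall>\<gamma>\<in>posroots_B r - (Vb \<union> A).
          t \<gamma> - (\<Sum>\<beta>\<in>Vb - A. t \<beta> * of_real (ip r (coroot r \<gamma>) (mu r Vb \<beta>))) \<noteq> 0))"

definition multi_indices :: "(nat \<Rightarrow> real) set \<Rightarrow> ((nat \<Rightarrow> real) \<Rightarrow> nat) set" where
  "multi_indices Dstar = {k. \<forall>\<alpha>. \<alpha> \<notin> Dstar \<longrightarrow> k \<alpha> = 0}"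

text \<open>Coefficients P_{Delta*}(k, y; Delta): Taylor coefficients of Fgen at t = 0,
  i.e. the (unique) coefficients of a power series in (t_alpha)_{alpha in Delta*}
  representing Fgen on a polydisc around 0 (off the removable singular set).\<close>
definition Pcoef :: "nat \<Rightarrow> (nat \<Rightarrow> real) set \<Rightarrow> (nat \<Rightarrow> real) list \<Rightarrow> (nat \<Rightarrow> real)
    \<Rightarrow> (nat \<Rightarrow> real) \<Rightarrow> ((nat \<Rightarrow> real) \<Rightarrow> nat) \<Rightarrow> complex" where
  "Pcoef r Dstar nus \<phi> y =
    (THE P. (\<forall>k. k \<notin> multi_indices Dstar \<longrightarrow> P k = 0) \<and>
      (\<exists>\<epsilon>>0. \<forall>t. (\<forall>\<alpha>\<in>Dstar. norm (t \<alpha>) < \<epsilon>) \<and> Fdefined r Dstar nus t \<longrightarrow>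
         ((\<lambda>k. P k * (\<Prod>\<alpha>\<in>Dstar. t \<alpha> ^ k \<alpha> / fact (k \<alpha>)))
            has_sum Fgen r Dstar nus \<phi> y t) (multi_indices Dstar)))"

definition zeta_sharp :: "nat \<Rightarrow> (nat \<Rightarrow> complex) \<Rightarrow> complex" where
  "zeta_sharp r s =
    infsum (\<lambda>m. \<Prod>i\<in>{1..r}.
        (of_nat (2 * (\<Sum>j\<in>{r - i + 1..r - 1}. m j) + m r) :: complex) powr (- s i))
      {m :: nat \<Rightarrow> nat. (\<forall>i\<in>{1..r}. 1 \<le> m i) \<and> (\<forall>i. i \<notin> {1..r} \<longrightarrow> m i = 0)}"

definition compositions :: "nat \<Rightarrow> nat list set" where
  "compositions r = {J. sum_list J = r \<and> (\<forall>j\<in>set J. 0 < j)}"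

text \<open>A_r(d,N,J), recorded by the lists (k_1,...,k_r) with (2dk_1,...,2dk_r) in A_r(d,N,J).\<close>
definition Aset :: "nat \<Rightarrow> nat list \<Rightarrow> nat list set" where
  "Aset N J = {concat (map (\<lambda>(h, j). replicate j h) (zip hs J)) | hs.
      length hs = length J \<and> sorted_wrt (<) hs \<and> (\<forall>h\<in>set hs. 1 \<le> h) \<and>
      sum_list (concat (map (\<lambda>(h, j). replicate j h) (zip hs J))) = N}"

definition attach :: "nat \<Rightarrow> nat list \<Rightarrow> ((nat \<Rightarrow> real) \<Rightarrow> nat)" where
  "attach r xs = (\<lambda>\<alpha>. \<Sum>i\<in>{1..r}. if \<alpha> = gammaB r i then xs ! (i - 1) else 0)"

end

theory Submission
  imports Defs "HOL-Combinatorics.Multiset_Permutations"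
begin


text \<open>
  Grouping the bases in \<open>V_A\<close> by their set \<open>S\<close> of long roots turns \<open>F\<close> into an alternating sum over the
  no-broken-circuit sets \<open>S\<close>. On the orthogonal complement of \<open>S\<close> the coordinates fall into classes on
  which they agree up to sign (or vanish identically); a basis containing \<open>S\<close> picks one short root in each
  class, so the inner sum is a product over the classes. Averaging over the coroot lattice only sees the
  parities of the class sums, and leaves two product terms, built from \<open>b(z/2)\<close> and \<open>b(z) - b(z/2)\<close> with
  \<open>b(z) = z/(e^z - 1)\<close>; the second one is present only if no coordinate vanishes identically.
  By Lagrange interpolation every factor is a power series, so the coefficients of \<open>F\<close> are explicit.

  For even exponents the Taylor coefficients of \<open>b\<close> are sums of \<open>(2 pi i n)^-k\<close>. Hence each \<open>S\<close> contributes
  a sum over the integer points orthogonal to \<open>S\<close> with nonzero coordinates of equal parity, and the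
  alternating sum over \<open>S\<close> keeps exactly the points orthogonal to no root. Up to signs and permutations of
  the coordinates these points are the summation points of \<open>zeta^sharp\<close>, and grouping the exponents by
  their multiset gives the sum over \<open>J\<close>.
\<close>

section \<open>Bernoulli coefficients\<close>

text \<open>Single terms of \<open>F\<close> have poles along t_g = t_b and t_g = -t_b, so
  coefficients cannot be read off term by term; and \<open>Pcoef\<close> is a definite description,
  so uniqueness of the expansion has to be proved from values of \<open>F\<close> off its singular
  set. The poles already cancel for fixed S inside one class, because Lagrange weights turn powers
  into polynomials. The parity condition comes from the coroot lattice: its vectors are integral
  with even coordinate sum, and the duals of short roots are halves of integral vectors. Signs: the
  number of long roots is even, so a basis enters with (-1)^|S|; the classes K contribute
  (-1)^(|K|-1) each, in total again (-1)^|S|; the minus sign in the coefficient formula, one for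
  each class, gives (-1)^(r-|S|). So a point is counted (-1)^r times the alternating number of sets
  S orthogonal to it, which is Moebius inversion over the flats of the arrangement of long roots.
  The group of signed permutations has order 2^r r!; the r! is absorbed because a multiset of
  exponents has r!/(j_1! ... j_nu!) orderings.\<close>

lemma has_sum_Times_mult:
  fixes f :: "'a \<Rightarrow> complex" and g :: "'b \<Rightarrow> complex"
  assumes f: "(f has_sum a) A" and g: "(g has_sum b) B"
  shows "((\<lambda>(x, y). f x * g y) has_sum (a * b)) (A \<times> B)"
proof (rule has_sum_SigmaI)
  show "((\<lambda>y. case (x, y) of (x, y) \<Rightarrow> f x * g y) has_sum (f x * b)) B" if "x \<in> A" for x
    using has_sum_cmult_right[OF g, of "f x"] by simp
  show "((\<lambda>x. f x * b) has_sum (a * b)) A"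
    using has_sum_cmult_left[OF f, of b] by simp
  have "(\<lambda>x. norm (f x)) summable_on A" "(\<lambda>x. norm (g x)) summable_on B"
    using f g has_sum_imp_summable summable_on_iff_abs_summable_on_complex by blast+
  then have "(\<lambda>p. norm (case p of (x, y) \<Rightarrow> f x * g y)) summable_on (A \<times> B)"
    by (intro iffD2[OF Infinite_Sum.abs_summable_on_Sigma_iff])
       (auto simp: norm_mult infsum_cmult_right' abs_mult infsum_nonneg intro!: summable_on_cmult_right summable_on_cmult_left)
  then show "(\<lambda>(x, y). f x * g y) summable_on A \<times> B"
    using summable_on_iff_abs_summable_on_complex by blast
qed

text \<open>Logarithmic derivative of Euler's reflection formula. It writes the cotangent as a
  difference of two \<open>Digamma\<close> values, each of which has a limit representation.\<close>

lemma Digamma_reflection_complex: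
  fixes z :: complex
  assumes "z \<notin> \<int>"
  shows "Digamma (1 - z) - Digamma z = of_real pi * cot (of_real pi * z)"
proof -
  have z1: "z \<notin> \<int>\<^sub>\<le>\<^sub>0" "1 - z \<notin> \<int>\<^sub>\<le>\<^sub>0"
  proof -
    show "z \<notin> \<int>\<^sub>\<le>\<^sub>0" using assms nonpos_Ints_Int by blast
    show "1 - z \<notin> \<int>\<^sub>\<le>\<^sub>0"
    proof
      assume "1 - z \<in> \<int>\<^sub>\<le>\<^sub>0"
      then have "1 - (1 - z) \<in> \<int>" using nonpos_Ints_Int Ints_diff Ints_1 by blast
      then show False using assms by simp
    qed
  qed
  have s: "sin (of_real pi * z) \<noteq> 0"
    using assms by (auto simp: sin_eq_0 mult.commute)
  have d1: "((\<lambda>z. Gamma z * Gamma (1 - z)) has_field_derivative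
        (Gamma z * Gamma (1 - z) * (Digamma z - Digamma (1 - z)))) (at z)"
    by (rule derivative_eq_intros refl z1 | simp add: algebra_simps z1)+
  have d2: "((\<lambda>z. of_real pi / sin (of_real pi * z)) has_field_derivative
        (- (of_real pi * (of_real pi * cos (of_real pi * z))) / (sin (of_real pi * z))\<^sup>2)) (at z)"
    by (rule derivative_eq_intros refl | simp add: s power2_eq_square)+
  have "Gamma z * Gamma (1 - z) * (Digamma z - Digamma (1 - z)) =
     - (of_real pi * (of_real pi * cos (of_real pi * z))) / (sin (of_real pi * z))\<^sup>2"
    using d1 d2 unfolding Gamma_reflection_complex by (rule DERIV_unique)
  then have "of_real pi / sin (of_real pi * z) * (Digamma z - Digamma (1 - z)) * (sin (of_real pi * z) / of_real pi) =
     - (of_real pi * (of_real pi * cos (of_real pi * z))) / (sin (of_real pi * z))\<^sup>2 * (sin (of_real pi * z) / of_real pi)"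
    unfolding Gamma_reflection_complex by simp
  then show ?thesis
    using s unfolding cot_def by (simp add: power2_eq_square) (metis add.inverse_inverse minus_diff_eq)
qed

text \<open>Euler's expansion of pi z cot (pi z). The limits for \<open>Digamma z\<close> and
  \<open>Digamma (1 - z)\<close> carry the same logarithm, which cancels in the difference and
  leaves partial sums over the poles n and -n.\<close>

lemma cot_partial_fractions:
  fixes z :: complex
  assumes "z \<notin> \<int>"
  shows "(\<lambda>n. - 2 * z\<^sup>2 / ((of_nat (Suc n))\<^sup>2 - z\<^sup>2)) sums (z * (of_real pi * cot (of_real pi * z)) - 1)"
proof -
  have z0: "z \<noteq> 0" "1 - z \<noteq> 0" using assms by auto
  have nz: "z + of_nat n \<noteq> 0" "of_nat n - z \<noteq> 0" for n
  proof -
    show "of_nat n - z \<noteq> 0" using assms by auto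
    show "z + of_nat n \<noteq> 0" using assms
      by (metis Ints_minus Ints_of_nat add_eq_0_iff2)
  qed
  define S where "S m = (\<Sum>n<m. inverse (z + of_nat n)) - (\<Sum>n<m. inverse (1 - z + of_nat n))" for m
  have "(\<lambda>m. (of_real (ln (real m)) - (\<Sum>n<m. inverse (1 - z + of_nat n))) -
             (of_real (ln (real m)) - (\<Sum>n<m. inverse (z + of_nat n))))
       \<longlonglongrightarrow> Digamma (1 - z) - Digamma z"
    by (intro tendsto_diff Digamma_LIMSEQ z0)
  then have S: "S \<longlonglongrightarrow> of_real pi * cot (of_real pi * z)"
    unfolding S_def Digamma_reflection_complex[OF assms] by simp
  \<comment> \<open>Since n - z = 1 - z + (n - 1), pairing the poles n and -n shifts one index by
    one. Besides the pole at 0, which gives the 1, an unpaired boundary term remains; it tends to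
    0.\<close>
  have eq: "(\<Sum>n<m. - 2 * z\<^sup>2 / ((of_nat (Suc n))\<^sup>2 - z\<^sup>2)) = z * S (Suc m) - 1 + z * inverse (1 - z + of_nat m)" for m
  proof (induction m)
    case 0 show ?case using z0 by (simp add: S_def field_simps)
  next
    case (Suc m)
    have a: "(of_nat (Suc m))\<^sup>2 - z\<^sup>2 = (z + of_nat (Suc m)) * (of_nat (Suc m) - z)"
      by (simp add: algebra_simps power2_eq_square)
    have "- 2 * z\<^sup>2 / ((of_nat (Suc m))\<^sup>2 - z\<^sup>2) = z * inverse (z + of_nat (Suc m)) - z * inverse (of_nat (Suc m) - z)"
      unfolding a using nz[of "Suc m"] by (simp add: divide_simps power2_eq_square del: of_nat_Suc) (simp add: algebra_simps)
    moreover have "S (Suc (Suc m)) = S (Suc m) + inverse (z + of_nat (Suc m)) - inverse (1 - z + of_nat (Suc m))"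
      by (simp add: S_def)
    moreover have "1 - z + of_nat m = of_nat (Suc m) - z" by simp
    ultimately have "z * S (Suc m) - 1 + z * inverse (1 - z + of_nat m) + - 2 * z\<^sup>2 / ((of_nat (Suc m))\<^sup>2 - z\<^sup>2)
        = z * S (Suc (Suc m)) - 1 + z * inverse (1 - z + of_nat (Suc m))"
      by (simp only: distrib_left right_diff_distrib) simp
    then show ?case unfolding sum.lessThan_Suc Suc .
  qed
  have "(\<lambda>m. inverse (1 - z + of_nat m)) \<longlonglongrightarrow> 0"
    by (rule filterlim_compose[OF tendsto_inverse_0 tendsto_add_filterlim_at_infinity[OF tendsto_const tendsto_of_nat]])
  then have "(\<lambda>m. z * S (Suc m) - 1 + z * inverse (1 - z + of_nat m)) \<longlonglongrightarrow>
      z * (of_real pi * cot (of_real pi * z)) - 1 + z * 0"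
    by (intro tendsto_intros LIMSEQ_Suc[OF S])
  then show ?thesis unfolding sums_def eq by simp
qed

definition recip2pii :: "nat \<Rightarrow> complex" where
  "recip2pii n = 1 / (2 * of_real pi * \<i> * of_nat n)"

text \<open>Taylor coefficients of \<open>z/(e^z - 1)\<close>, defined by their partial-fraction form.\<close>

definition bern_coeff :: "nat \<Rightarrow> complex" where
  "bern_coeff m = (if m = 0 then 1 else if m = 1 then - 1 / 2 else if odd m then 0
     else - 2 * (\<Sum>\<^sub>\<infinity>n. recip2pii (Suc n) ^ m))"

lemma norm_recip2pii_le: "norm (recip2pii (Suc n)) \<le> 1 / (2 * real (Suc n))"
proof -
  have "norm (recip2pii (Suc n)) = 1 / (2 * pi * real (Suc n))"
    unfolding recip2pii_def by (simp add: norm_divide norm_mult del: of_nat_Suc)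
  also have "\<dots> \<le> 1 / (2 * real (Suc n))"
    using pi_gt3 by (intro frac_le mult_right_mono) auto
  finally show ?thesis .
qed

lemma summable_on_recip_square: "(\<lambda>n. 1 / (real (Suc n))\<^sup>2) summable_on UNIV"
proof -
  have "summable (\<lambda>n. 1 / (real (Suc n))\<^sup>2)"
    using inverse_power_summable[of 2, where 'a = real]
    by (subst summable_Suc_iff) (simp add: divide_inverse)
  then show ?thesis by (subst summable_on_UNIV_nonneg_real_iff) auto
qed

text \<open>Two factors provide the summable majorant in \<open>n\<close>, the others are at most
  1/2 each.\<close>

lemma norm_recip2pii_power_le:
  assumes "2 \<le> m"
  shows "norm (recip2pii (Suc n) ^ m) \<le> 1 / (real (Suc n))\<^sup>2 * (1 / 2) ^ (m - 2)"
proof -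
  obtain j where m: "m = 2 + j" using assms nat_le_iff_add by auto
  have "norm (recip2pii (Suc n)) ^ 2 \<le> (1 / real (Suc n)) ^ 2"
    by (rule power_mono[OF order_trans[OF norm_recip2pii_le]]) (auto simp: field_simps)
  moreover have "norm (recip2pii (Suc n)) ^ j \<le> (1 / 2) ^ j"
    by (rule power_mono[OF order_trans[OF norm_recip2pii_le]]) (auto simp: field_simps)
  ultimately have "norm (recip2pii (Suc n)) ^ 2 * norm (recip2pii (Suc n)) ^ j \<le> (1 / real (Suc n)) ^ 2 * (1 / 2) ^ j"
    by (intro mult_mono) auto
  then show ?thesis unfolding m by (simp add: norm_power norm_mult power_add power_divide power2_eq_square)
qed

lemma recip2pii_power_summable:
  assumes "2 \<le> m"
  shows "(\<lambda>n. recip2pii (Suc n) ^ m) summable_on UNIV"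
proof -
  have "(\<lambda>n. norm (recip2pii (Suc n) ^ m)) summable_on UNIV"
    by (rule Infinite_Sum.abs_summable_on_comparison_test'[where g = "\<lambda>n. 1 / (real (Suc n))\<^sup>2 * (1 / 2) ^ (m - 2)"])
       (intro summable_on_cmult_left summable_on_recip_square norm_recip2pii_power_le[OF assms])+
  then show ?thesis by (simp add: summable_on_iff_abs_summable_on_complex)
qed

text \<open>Boundedness is all that convergence will ask for: the later expansions are at variables
  of norm less than 1, where bounded coefficients are majorised by a product of geometric
  series.\<close>

lemma norm_bern_coeff_le: "\<exists>C. \<forall>m. norm (bern_coeff m) \<le> C"
proof -
  define B where "B = (\<Sum>\<^sub>\<infinity>n. 1 / (real (Suc n))\<^sup>2)"
  have B0: "0 \<le> B" unfolding B_def by (rule infsum_nonneg) auto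
  have "norm (bern_coeff m) \<le> 1 + 2 * B" for m
  proof (cases "m = 0 \<or> odd m")
    case True then show ?thesis using B0 by (auto simp: bern_coeff_def)
  next
    case False
    then have m: "2 \<le> m" by (metis One_nat_def even_Suc_Suc_iff less_2_cases_iff not_le odd_one)
    have le: "1 / (real (Suc n))\<^sup>2 * (1 / 2) ^ (m - 2) \<le> 1 / (real (Suc n))\<^sup>2" for n
      by (rule mult_right_le_one_le) (auto simp: power_le_one)
    have "norm (\<Sum>\<^sub>\<infinity>n. recip2pii (Suc n) ^ m) \<le> B"
      unfolding B_def
      by (rule norm_infsum_le[OF has_sum_infsum has_sum_infsum])
         (auto intro!: recip2pii_power_summable m summable_on_recip_square order_trans[OF norm_recip2pii_power_le[OF m] le] simp del: of_nat_Suc)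
    then show ?thesis using False m B0 by (auto simp: bern_coeff_def norm_mult)
  qed
  then show ?thesis by blast
qed

text \<open>The substitution w = 2 pi i z turns w/(e^w - 1) + w/2 into pi z cot (pi z). Each partial
  fraction of the cotangent is expanded as a geometric series in (z/n)^2, and interchanging the two
  summations collects the coefficients. The disc of radius 1 lies well inside the full disc of
  radius 2 pi, so crude estimates suffice.\<close>

lemma bern_coeff_has_sum:
  fixes w :: complex
  assumes "w \<noteq> 0" "norm w < 1"
  shows "((\<lambda>m. bern_coeff m * w ^ m) has_sum (w / (exp w - 1))) UNIV"
proof -
  define z where "z = w / (2 * of_real pi * \<i>)"
  have w: "w = 2 * of_real pi * \<i> * z" by (simp add: z_def)
  have z0: "z \<noteq> 0" using assms by (simp add: z_def)
  have nz: "norm z < 1 / 2"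
  proof -
    have "norm z = norm w / (2 * pi)" by (simp add: z_def norm_divide norm_mult)
    also have "\<dots> < 1 / (2 * pi)" using assms by (intro divide_strict_right_mono) auto
    also have "\<dots> \<le> 1 / 2" using pi_gt3 by (auto simp: field_simps)
    finally show ?thesis .
  qed
  have zi: "z \<notin> \<int>"
  proof
    assume "z \<in> \<int>"
    then obtain k where k: "z = of_int k" by (rule Ints_cases)
    then have "k \<noteq> 0" using z0 by auto
    then have "1 \<le> norm z" unfolding k by simp
    then show False using nz by simp
  qed
  have e1: "exp w \<noteq> 1"
  proof
    assume "exp w = 1"
    then obtain n where "Re w = 0" "Im w = of_int (2 * n) * pi" by (auto simp: exp_eq_1)
    then have "w = 2 * of_real pi * \<i> * of_int n" by (simp add: complex_eq_iff)
    then have "z = of_int n" using w by simp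
    then show False using zi by simp
  qed
  define V where "V = w / (exp w - 1) + w / 2 - 1"
  have cot: "z * (of_real pi * cot (of_real pi * z)) = w / (exp w - 1) + w / 2"
  proof -
    define E where "E = exp (\<i> * (of_real pi * z))"
    have E0: "E \<noteq> 0" by (simp add: E_def)
    have Ew: "exp w = E * E" by (simp add: E_def w exp_add[symmetric] algebra_simps)
    have m: "exp (- (\<i> * (of_real pi * z))) = 1 / E" by (simp add: E_def exp_minus field_simps)
    have nz: "E * E - 1 \<noteq> 0" using e1 Ew by simp
    have c: "cos (of_real pi * z) = (E * E + 1) / (2 * E)"
      unfolding cos_exp_eq m E_def[symmetric] using E0 by (simp add: field_simps)
    have s: "sin (of_real pi * z) = (E * E - 1) / (2 * \<i> * E)"
      unfolding sin_exp_eq m E_def[symmetric] using E0 by (simp add: field_simps)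
    have "cot (of_real pi * z) = \<i> * (E * E + 1) / (E * E - 1)"
      unfolding cot_def c s using E0 nz by (simp add: field_simps)
    then have "z * (of_real pi * cot (of_real pi * z)) = (w / 2) * ((E * E + 1) / (E * E - 1))"
      by (simp add: w)
    also have "\<dots> = w / (exp w - 1) + w / 2" unfolding Ew using nz
      by (simp add: divide_simps) (simp add: algebra_simps)
    finally show ?thesis .
  qed
  have sV: "(\<lambda>n. - 2 * z\<^sup>2 / ((of_nat (Suc n))\<^sup>2 - z\<^sup>2)) sums V"
    using cot_partial_fractions[OF zi] unfolding cot V_def .
  \<comment> \<open>\<open>n\<close> counts the pole, \<open>k\<close> the term of its geometric
    series. Summing over \<open>k\<close> first gives the partial fractions, over \<open>n\<close>
    first the coefficients.\<close>
  define f where "f = (\<lambda>(n, k). - 2 * (w * recip2pii (Suc n)) ^ (2 * k + 2))"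
  have wr: "w * recip2pii (Suc n) = z / of_nat (Suc n)" for n
    by (simp add: recip2pii_def w del: of_nat_Suc)
  have rle: "norm (w * recip2pii (Suc n)) \<le> 1 / (2 * real (Suc n))" for n
  proof -
    have "norm (w * recip2pii (Suc n)) \<le> 1 * norm (recip2pii (Suc n))"
      unfolding norm_mult using assms by (intro mult_right_mono) auto
    then show ?thesis using norm_recip2pii_le[of n] by simp
  qed
  have fn: "((\<lambda>k. f (n, k)) has_sum (- 2 * z\<^sup>2 / ((of_nat (Suc n))\<^sup>2 - z\<^sup>2))) UNIV" for n
  proof -
    define u where "u = w * recip2pii (Suc n)"
    have "norm u \<le> 1 / 2" unfolding u_def by (rule order_trans[OF rle]) (auto simp: field_simps)
    then have "norm u ^ 2 \<le> (1 / 2) ^ 2" by (rule power_mono) simp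
    then have u1: "norm (u\<^sup>2) < 1" by (simp add: norm_power norm_mult power2_eq_square)
    have "(\<lambda>k. (u\<^sup>2) ^ k) sums (1 / (1 - u\<^sup>2))" by (rule geometric_sums[OF u1])
    moreover have "summable (\<lambda>k. norm ((u\<^sup>2) ^ k))"
      unfolding norm_power using u1 by (intro summable_geometric) (simp add: norm_power)
    ultimately have "((\<lambda>k. (u\<^sup>2) ^ k) has_sum (1 / (1 - u\<^sup>2))) UNIV"
      by (rule norm_summable_imp_has_sum[rotated])
    then have "((\<lambda>k. - 2 * u\<^sup>2 * (u\<^sup>2) ^ k) has_sum (- 2 * u\<^sup>2 * (1 / (1 - u\<^sup>2)))) UNIV"
      by (rule has_sum_cmult_right)
    moreover have "- 2 * u\<^sup>2 * (u\<^sup>2) ^ k = f (n, k)" for k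
      by (simp only: f_def u_def[symmetric] prod.case power_add power_mult[of _ 2 k]) (simp only: mult_ac)
    moreover have "- 2 * u\<^sup>2 * (1 / (1 - u\<^sup>2)) = - 2 * z\<^sup>2 / ((of_nat (Suc n))\<^sup>2 - z\<^sup>2)"
    proof -
      have u2: "u\<^sup>2 = z\<^sup>2 / (of_nat (Suc n))\<^sup>2" unfolding u_def wr by (simp add: power_divide)
      then have "1 - u\<^sup>2 = ((of_nat (Suc n))\<^sup>2 - z\<^sup>2) / (of_nat (Suc n))\<^sup>2"
        by (simp add: diff_divide_distrib del: of_nat_Suc)
      then show ?thesis by (simp add: u2 del: of_nat_Suc)
    qed
    ultimately show ?thesis by simp
  qed
  have fs: "f summable_on UNIV \<times> UNIV"
  proof -
    \<comment> \<open>A product majorant: two of the 2k + 2 factors of \<open>f\<close> give the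
      inverse square, the remaining 2k are at most 1/2.\<close>
    define g where "g = (\<lambda>(n, k). complex_of_real (2 * (1 / (real (Suc n))\<^sup>2)) * of_real ((1 / 4) ^ k))"
    have s1: "(\<lambda>n. complex_of_real (2 * (1 / (real (Suc n))\<^sup>2))) summable_on UNIV"
      by (intro summable_on_of_real summable_on_cmult_right summable_on_recip_square)
    have "(\<lambda>k. (1 / 4 :: real) ^ k) summable_on UNIV"
      by (subst summable_on_UNIV_nonneg_real_iff) (auto intro!: summable_geometric)
    then have s2: "(\<lambda>k. complex_of_real ((1 / 4) ^ k)) summable_on UNIV"
      by (rule summable_on_of_real)
    have "g summable_on UNIV \<times> UNIV"
      unfolding g_def using has_sum_imp_summable[OF has_sum_Times_mult[OF has_sum_infsum[OF s1] has_sum_infsum[OF s2]]] .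
    then have "(\<lambda>p. norm (g p)) summable_on UNIV \<times> UNIV"
      using summable_on_iff_abs_summable_on_complex by blast
    then have "(\<lambda>p. norm (f p)) summable_on UNIV \<times> UNIV"
    proof (rule Infinite_Sum.abs_summable_on_comparison_test)
      fix p :: "nat \<times> nat" obtain n k where p: "p = (n, k)" by (cases p)
      have "norm (w * recip2pii (Suc n)) ^ (2 * k + 2) \<le> (1 / (2 * real (Suc n))) ^ (2 * k + 2)"
        by (rule power_mono[OF rle]) auto
      also have "\<dots> = (1 / (2 * real (Suc n)))\<^sup>2 * (1 / (2 * real (Suc n))) ^ (2 * k)"
        by (simp add: power_add power2_eq_square)
      also have "\<dots> \<le> (1 / real (Suc n))\<^sup>2 * (1 / 2) ^ (2 * k)"
        by (intro mult_mono power_mono) (auto simp: field_simps)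
      finally show "norm (f p) \<le> norm (g p)"
        by (simp add: p f_def g_def norm_mult norm_power norm_divide power_mult power_divide power2_eq_square del: of_nat_Suc)
    qed
    then show ?thesis using summable_on_iff_abs_summable_on_complex by blast
  qed
  have tot: "(f has_sum V) (UNIV \<times> UNIV)"
  proof -
    have "((\<lambda>n. - 2 * z\<^sup>2 / ((of_nat (Suc n))\<^sup>2 - z\<^sup>2)) has_sum (infsum f (UNIV \<times> UNIV))) UNIV"
      by (rule has_sum_Sigma'[OF has_sum_infsum[OF fs] fn])
    then have "infsum f (UNIV \<times> UNIV) = V"
      using has_sum_imp_sums sV sums_unique2 by blast
    then show ?thesis using has_sum_infsum[OF fs] by simp
  qed
  have fk: "((\<lambda>n. f (n, k)) has_sum (bern_coeff (2 * k + 2) * w ^ (2 * k + 2))) UNIV" for k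
  proof -
    have "((\<lambda>n. - 2 * w ^ (2 * k + 2) * recip2pii (Suc n) ^ (2 * k + 2)) has_sum
        (- 2 * w ^ (2 * k + 2) * (\<Sum>\<^sub>\<infinity>n. recip2pii (Suc n) ^ (2 * k + 2)))) UNIV"
      by (intro has_sum_cmult_right has_sum_infsum recip2pii_power_summable) auto
    then show ?thesis by (simp add: f_def bern_coeff_def power_mult_distrib mult_ac)
  qed
  have "((\<lambda>k. bern_coeff (2 * k + 2) * w ^ (2 * k + 2)) has_sum V) UNIV"
    using tot unfolding has_sum_swap[of f]
    by (rule has_sum_Sigma') (use fk in simp)
  then have ev: "((\<lambda>m. bern_coeff m * w ^ m) has_sum V) (range (\<lambda>k. 2 * k + 2))"
    by (subst has_sum_reindex) (auto simp: inj_on_def o_def)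
  have "((\<lambda>m. bern_coeff m * w ^ m) has_sum V) (UNIV - {0, 1})"
  proof (rule iffD1[OF has_sum_cong_neutral ev])
    fix m assume m: "m \<in> UNIV - {0, 1} - range (\<lambda>k. 2 * k + 2 :: nat)"
    have "odd m"
    proof
      assume "even m"
      then obtain k where "m = 2 * k" by (auto elim: evenE)
      then have "m = 2 * (k - 1) + 2" using m by (cases k) auto
      then show False using m by blast
    qed
    then show "bern_coeff m * w ^ m = 0" using m by (simp add: bern_coeff_def)
  qed auto
  \<comment> \<open>The indices 0 and 1 are not seen by the cotangent. They contribute 1 - w/2, the
    difference between w/(e^w - 1) and \<open>V\<close>.\<close>
  then have "((\<lambda>m. bern_coeff m * w ^ m) has_sum
      (bern_coeff 1 * w ^ 1 + (bern_coeff 0 * w ^ 0 + V))) (insert 1 (insert 0 (UNIV - {0, 1})))"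
    by (intro has_sum_insert) auto
  moreover have "insert 1 (insert 0 (UNIV - {0, 1 :: nat})) = UNIV" by auto
  moreover have "bern_coeff 1 * w ^ 1 + (bern_coeff 0 * w ^ 0 + V) = w / (exp w - 1)"
    by (simp add: bern_coeff_def[of 0] bern_coeff_def[of "Suc 0"] V_def)
  ultimately show ?thesis by simp
qed

lemma bern_coeff_rational: "bern_coeff m \<in> \<rat>"
proof -
  txt \<open>The recursion obtained from \<open>(z/(e^z - 1)) * ((e^z - 1)/z) = 1\<close>.\<close>
  define B where "B = Abs_fps bern_coeff"
  define E :: "complex fps" where "E = Abs_fps (\<lambda>k. 1 / fact (Suc k))"
  have sB: "summable (\<lambda>n. bern_coeff n * w ^ n)" if "norm w < 1" for w
  proof (cases "w = 0")
    case True then show ?thesis by (simp add: summable_0_powser)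
  next
    case False
    then show ?thesis using bern_coeff_has_sum[OF False that]
      using has_sum_imp_sums sums_summable by blast
  qed
  have rB: "fps_conv_radius B \<ge> 1"
    unfolding fps_conv_radius_def B_def fps_nth_Abs_fps
  proof (rule conv_radius_geI_ex)
    fix r :: real assume "0 < r" "ereal r < 1"
    then show "\<exists>z. norm z = r \<and> summable (\<lambda>n. bern_coeff n * z ^ n)"
      by (intro exI[of _ "of_real r"]) (auto intro!: sB)
  qed
  have sE: "(\<lambda>n. w ^ n / fact (Suc n)) sums ((exp w - 1) / w)" if "w \<noteq> 0" for w :: complex
  proof -
    have "(\<lambda>n. w ^ Suc n / fact (Suc n)) sums (exp w - 1)"
      using exp_converges[of w] by (subst sums_Suc_iff) (simp add: scaleR_conv_of_real field_simps)
    from sums_divide[OF this, of w] show ?thesis using that by (simp add: mult.commute)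
  qed
  have rE: "fps_conv_radius E = \<infinity>"
    unfolding fps_conv_radius_def E_def fps_nth_Abs_fps
  proof (rule conv_radius_inftyI'')
    fix z :: complex
    show "summable (\<lambda>n. 1 / fact (Suc n) * z ^ n)"
    proof (cases "z = 0")
      case True then show ?thesis using summable_0_powser[of "\<lambda>n. 1 / fact (Suc n) :: complex"] by (simp del: fact_Suc)
    next
      case False then show ?thesis using sums_summable[OF sE[OF False]] by simp
    qed
  qed
  have ev: "eval_fps (B * E) w = eval_fps 1 w" if "norm w < 1" for w
  proof (cases "w = 0")
    case True then show ?thesis by (simp add: eval_fps_at_0 B_def E_def bern_coeff_def)
  next
    case False
    have e1: "exp w \<noteq> 1"
    proof
      assume "exp w = 1"
      then have "((\<lambda>m. bern_coeff m * w ^ m) has_sum 0) UNIV"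
        using bern_coeff_has_sum[OF False that] by simp
      have "(\<lambda>n. w ^ n / fact (Suc n)) sums 0" using sE[OF False] \<open>exp w = 1\<close> by simp
      obtain n where n: "Re w = 0" "Im w = of_int (2 * n) * pi" using \<open>exp w = 1\<close> by (auto simp: exp_eq_1)
      then have "norm w = \<bar>of_int (2 * n)\<bar> * pi" by (simp add: cmod_def abs_mult)
      moreover have "n \<noteq> 0" using n False by (auto simp: complex_eq_iff)
      then have "1 \<le> \<bar>real_of_int (2 * n)\<bar>" by linarith
      then have "1 * pi \<le> \<bar>real_of_int (2 * n)\<bar> * pi" by (intro mult_right_mono) auto
      ultimately show False using that pi_gt3 by linarith
    qed
    have "ereal (norm w) < fps_conv_radius B" using that rB
      by (metis ereal_less(3) less_le_trans one_ereal_def ereal_less_eq(3) less_ereal.simps(1))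
    then have "eval_fps (B * E) w = eval_fps B w * eval_fps E w"
      by (intro eval_fps_mult) (auto simp: rE)
    also have "eval_fps B w = w / (exp w - 1)"
      unfolding eval_fps_def B_def using has_sum_imp_sums[OF bern_coeff_has_sum[OF False that]]
      by (simp add: sums_iff)
    also have "eval_fps E w = (exp w - 1) / w"
      unfolding eval_fps_def E_def using sE[OF False] by (simp add: sums_iff)
    finally show ?thesis using False e1 by simp
  qed
  \<comment> \<open>Both sides agree on the unit disc, inside both discs of convergence, so the
    formal series agree.\<close>
  have BE: "B * E = 1"
  proof (rule eval_fps_eqD)
    have "0 < min (fps_conv_radius B) (fps_conv_radius E)" using rB rE
      by (auto simp: min_def intro: less_le_trans[of 0 1])
    then show "fps_conv_radius (B * E) > 0" using fps_conv_radius_mult[of B E] by (rule less_le_trans)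
    show "fps_conv_radius (1 :: complex fps) > 0" by simp
    have "eventually (\<lambda>z. z \<in> ball 0 1) (nhds (0 :: complex))"
      by (rule eventually_nhds_in_open) auto
    then show "eventually (\<lambda>z. eval_fps (B * E) z = eval_fps 1 z) (nhds 0)"
      by eventually_elim (use ev in auto)
  qed
  show ?thesis
  proof (induction m rule: less_induct)
    case (less m)
    show ?case
    proof (cases "m = 0")
      case True then show ?thesis by (simp add: bern_coeff_def)
    next
      case False
      \<comment> \<open>In positive degree m the unknown \<open>bern_coeff m\<close> occurs with
        factor 1/1! = 1, and the other summands are rational by induction.\<close>
      have "0 = (B * E) $ m" using BE False by simp
      also have "\<dots> = (\<Sum>i=0..m. bern_coeff i * (1 / fact (Suc (m - i))))"
        by (simp add: fps_mult_nth B_def E_def)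
      also have "{0..m} = insert m {0..<m}" by auto
      finally have "bern_coeff m = - (\<Sum>i\<in>{0..<m}. bern_coeff i * (1 / fact (Suc (m - i))))"
        by (simp add: add_eq_0_iff2)
      also have "\<dots> \<in> \<rat>"
      proof -
        have "(1 / fact n :: complex) \<in> \<rat>" for n
          using Rats_divide[OF Rats_1 Rats_of_nat[of "fact n"]] unfolding of_nat_fact .
        then show ?thesis unfolding Rats_minus_iff
          using less.IH by (intro Rats_sum Rats_mult) (auto simp del: fact_Suc)
      qed
      finally show ?thesis .
    qed
  qed
qed

text \<open>For an even exponent the terms of n and -n agree, which accounts for the factor 2 in
  \<open>bern_coeff\<close>; for odd exponents they would cancel. This is where even arguments of
  the zeta function enter.\<close>

lemma bern_coeff_even_has_sum:
  assumes "even m" "2 \<le> m"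
  shows "((\<lambda>n. 1 / (2 * of_real pi * \<i> * of_int n) ^ m) has_sum (- bern_coeff m)) (UNIV - {0 :: int})"
proof -
  define s where "s = (\<Sum>\<^sub>\<infinity>n. recip2pii (Suc n) ^ m)"
  have h: "((\<lambda>n. recip2pii (Suc n) ^ m) has_sum s) UNIV"
    unfolding s_def by (intro has_sum_infsum recip2pii_power_summable assms)
  define F where "F = (\<lambda>n. 1 / (2 * of_real pi * \<i> * of_int n :: complex) ^ m)"
  have p: "(F has_sum s) {1..}"
    by (rule iffD1[OF has_sum_reindex_bij_witness[where j = "\<lambda>n. int (Suc n)" and i = "\<lambda>k. nat (k - 1)"] h])
       (auto simp: F_def recip2pii_def power_divide nat_diff_distrib)
  have n: "(F has_sum s) {..-1}"
    by (rule iffD1[OF has_sum_reindex_bij_witness[where j = "\<lambda>n. - n" and i = "\<lambda>n. - n"] p])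
       (use assms in \<open>auto simp: F_def power_minus_even\<close>)
  have "(F has_sum (s + s)) ({1..} \<union> {..-1})"
    by (rule has_sum_Un_disjoint[OF p n]) auto
  moreover have "{1..} \<union> {..-1} = UNIV - {0 :: int}" by auto
  moreover have "bern_coeff m = - 2 * s" using assms by (auto simp: bern_coeff_def s_def)
  ultimately show ?thesis by (simp add: F_def)
qed


section \<open>Power series in finitely many variables\<close>

text \<open>Extension by zero gives each finite family a unique representative, so bijections
  between index sets are equalities of functions. The value type is open because both exponent
  vectors (\<open>nat\<close>) and lattice points (\<open>int\<close>) are indexed this way.\<close>

definition supp_in :: "nat set \<Rightarrow> (nat \<Rightarrow> 'b::zero) set" where
  "supp_in I = {k. \<forall>i. i \<notin> I \<longrightarrow> k i = 0}"

lemma has_sum_finite_sum: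
  fixes f :: "'a \<Rightarrow> 'b \<Rightarrow> complex"
  assumes "finite I" "\<And>i. i \<in> I \<Longrightarrow> (f i has_sum a i) A"
  shows "((\<lambda>x. \<Sum>i\<in>I. f i x) has_sum (\<Sum>i\<in>I. a i)) A"
  using assms by (induction I rule: finite_induct) (auto intro!: has_sum_add)

text \<open>Fubini over disjoint blocks: a function supported on the union amounts to one function
  for each block, and each factor sees only its own block. Peeling off one block reduces the claim
  to \<open>has_sum_Times_mult\<close>.\<close>

lemma has_sum_prod_blocks:
  fixes f :: "'c \<Rightarrow> (nat \<Rightarrow> 'b::zero) \<Rightarrow> complex"
  assumes "finite R"
    and "\<And>\<rho> \<sigma>. \<rho> \<in> R \<Longrightarrow> \<sigma> \<in> R \<Longrightarrow> \<rho> \<noteq> \<sigma> \<Longrightarrow> K \<rho> \<inter> K \<sigma> = {}"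
    and "\<And>\<rho>. \<rho> \<in> R \<Longrightarrow> (f \<rho> has_sum a \<rho>) (supp_in (K \<rho>))"
    and "\<And>\<rho> k k'. \<rho> \<in> R \<Longrightarrow> (\<And>i. i \<in> K \<rho> \<Longrightarrow> k i = k' i) \<Longrightarrow> f \<rho> k = f \<rho> k'"
  shows "((\<lambda>k. \<Prod>\<rho>\<in>R. f \<rho> k) has_sum (\<Prod>\<rho>\<in>R. a \<rho>)) (supp_in (\<Union>\<rho>\<in>R. K \<rho>))"
  using assms
proof (induction R rule: finite_induct)
  case empty
  have e: "supp_in (\<Union>\<rho>\<in>{}. K \<rho>) = {\<lambda>_. 0 :: 'b}" by (auto simp: supp_in_def)
  show ?case unfolding e by (simp add: has_sum_finite_iff)
next
  case (insert x R)
  let ?U = "\<Union>\<rho>\<in>R. K \<rho>"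
  have disj: "K x \<inter> ?U = {}" using insert.hyps insert.prems(1)[of x] by fastforce
  have IH: "((\<lambda>k. \<Prod>\<rho>\<in>R. f \<rho> k) has_sum (\<Prod>\<rho>\<in>R. a \<rho>)) (supp_in ?U)"
  proof (rule insert.IH)
    fix \<rho> \<sigma> assume "\<rho> \<in> R" "\<sigma> \<in> R" "\<rho> \<noteq> \<sigma>"
    then show "K \<rho> \<inter> K \<sigma> = {}" by (intro insert.prems(1) insertI2)
  next
    fix \<rho> assume "\<rho> \<in> R"
    then show "(f \<rho> has_sum a \<rho>) (supp_in (K \<rho>))" by (intro insert.prems(2) insertI2)
  next
    fix \<rho> and k k' :: "nat \<Rightarrow> 'b" assume "\<rho> \<in> R" "\<And>i. i \<in> K \<rho> \<Longrightarrow> k i = k' i"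
    then show "f \<rho> k = f \<rho> k'" using insert.prems(3)[of \<rho> k k'] by blast
  qed
  have fx: "(f x has_sum a x) (supp_in (K x))" using insert.prems(2) by simp
  have "((\<lambda>(k, l). f x k * (\<Prod>\<rho>\<in>R. f \<rho> l)) has_sum (a x * (\<Prod>\<rho>\<in>R. a \<rho>))) (supp_in (K x) \<times> supp_in ?U)"
    by (rule has_sum_Times_mult[OF fx IH])
  also have "?this \<longleftrightarrow> ((\<lambda>k. \<Prod>\<rho>\<in>insert x R. f \<rho> k) has_sum (\<Prod>\<rho>\<in>insert x R. a \<rho>)) (supp_in (\<Union>\<rho>\<in>insert x R. K \<rho>))"
  proof (rule has_sum_reindex_bij_witness[where j = "\<lambda>(k, l) i. if i \<in> K x then k i else l i"
        and i = "\<lambda>k. (\<lambda>i. if i \<in> K x then k i else 0, \<lambda>i. if i \<in> ?U then k i else 0)"])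
    fix p :: "(nat \<Rightarrow> 'b) \<times> (nat \<Rightarrow> 'b)" assume p: "p \<in> supp_in (K x) \<times> supp_in ?U"
    obtain k l where kl: "p = (k, l)" by (cases p)
    have k: "\<And>i. i \<notin> K x \<Longrightarrow> k i = 0" and l: "\<And>i. i \<notin> ?U \<Longrightarrow> l i = 0"
      using p kl by (auto simp: supp_in_def)
    let ?m = "\<lambda>i. if i \<in> K x then k i else l i"
    have kk: "(\<lambda>i. if i \<in> K x then ?m i else 0) = k" using k by auto
    have ll: "(\<lambda>i. if i \<in> ?U then ?m i else 0) = l" using l disj by (intro ext) (auto; fastforce)
    show "(\<lambda>k. (\<lambda>i. if i \<in> K x then k i else 0, \<lambda>i. if i \<in> ?U then k i else 0))
        ((\<lambda>(k, l) i. if i \<in> K x then k i else l i) p) = p"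
      unfolding kl prod.case using kk ll by (intro prod_eqI) (simp_all only: fst_conv snd_conv)
    show "(\<lambda>(k, l) i. if i \<in> K x then k i else l i) p \<in> supp_in (\<Union>\<rho>\<in>insert x R. K \<rho>)"
      unfolding kl prod.case using l by (auto simp: supp_in_def)
    have "f x ?m = f x k" using insert.prems(3)[of x ?m k] by simp
    moreover have "f \<rho> ?m = f \<rho> l" if "\<rho> \<in> R" for \<rho>
      using disj that by (intro insert.prems(3)) auto
    ultimately show "(\<Prod>\<rho>\<in>insert x R. f \<rho> ((\<lambda>(k, l) i. if i \<in> K x then k i else l i) p)) =
       (case p of (k, l) \<Rightarrow> f x k * (\<Prod>\<rho>\<in>R. f \<rho> l))"
      unfolding kl prod.case using insert.hyps by simp
  next
    fix k :: "nat \<Rightarrow> 'b" assume k: "k \<in> supp_in (\<Union>\<rho>\<in>insert x R. K \<rho>)"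
    have k0: "i \<notin> K x \<Longrightarrow> i \<notin> ?U \<Longrightarrow> k i = 0" for i using k by (auto simp: supp_in_def)
    show "(\<lambda>(k, l) i. if i \<in> K x then k i else l i)
       ((\<lambda>k. (\<lambda>i. if i \<in> K x then k i else 0, \<lambda>i. if i \<in> ?U then k i else 0)) k) = k"
      unfolding prod.case using k0 by (intro ext) (simp split: if_split)
    show "(\<lambda>k. (\<lambda>i. if i \<in> K x then k i else 0, \<lambda>i. if i \<in> ?U then k i else 0)) k \<in> supp_in (K x) \<times> supp_in ?U"
      by (auto simp: supp_in_def)
  qed (use insert.hyps in simp)
  finally show ?case .
qed

lemma has_sum_prod_coords:
  fixes g :: "nat \<Rightarrow> 'b::zero \<Rightarrow> complex"
  assumes "finite I" and "\<And>i. i \<in> I \<Longrightarrow> (g i has_sum a i) UNIV"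
  shows "((\<lambda>k. \<Prod>i\<in>I. g i (k i)) has_sum (\<Prod>i\<in>I. a i)) (supp_in I)"
proof -
  have "((\<lambda>k. \<Prod>i\<in>I. g i (k i)) has_sum (\<Prod>i\<in>I. a i)) (supp_in (\<Union>i\<in>I. {i}))"
  proof (rule has_sum_prod_blocks[OF assms(1)])
    fix i assume "i \<in> I"
    show "((\<lambda>k. g i (k i)) has_sum a i) (supp_in {i})"
      by (rule iffD1[OF has_sum_reindex_bij_witness[where j = "\<lambda>b j. if j = i then b else 0" and i = "\<lambda>k. k i"] assms(2)[OF \<open>i \<in> I\<close>]])
         (auto simp: supp_in_def)
  qed auto
  then show ?thesis by simp
qed

lemma has_sum_geometric:
  fixes z :: complex
  assumes "norm z < 1"
  shows "((\<lambda>n. z ^ n) has_sum (1 / (1 - z))) UNIV"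
  using assms geometric_sums[of z]
  by (intro norm_summable_imp_has_sum) (auto simp: norm_power intro!: summable_geometric)

lemma finite_supp_in_sum:
  assumes "finite K"
  shows "finite {k \<in> supp_in K. sum k K = (m :: nat)}"
proof (rule finite_subset)
  show "{k \<in> supp_in K. sum k K = m} \<subseteq> {k. \<forall>i. (i \<in> K \<longrightarrow> k i \<in> {..m}) \<and> (i \<notin> K \<longrightarrow> k i = 0)}"
    using assms member_le_sum[of _ K] by (fastforce simp: supp_in_def)
  show "finite {k. \<forall>i. (i \<in> K \<longrightarrow> k i \<in> {..m}) \<and> (i \<notin> K \<longrightarrow> k i = 0)}"
    by (rule finite_set_of_finite_funs) (use assms in auto)
qed

text \<open>Partial fractions in z of a function with simple poles at the nodes \<open>v b\<close>.
  At z = 0 it says that the Lagrange weights sum to 1; at a further node it gives the weight of that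
  node.\<close>

lemma partial_fractions_prod:
  fixes v :: "'i \<Rightarrow> complex"
  assumes "finite K" "K \<noteq> {}" "inj_on v K" "z \<notin> v ` K"
  shows "(\<Prod>g\<in>K. v g / (v g - z)) = (\<Sum>b\<in>K. (\<Prod>g\<in>K - {b}. v g / (v g - v b)) * (v b / (v b - z)))"
  using assms
proof (induction K arbitrary: z rule: finite_ne_induct)
  case (singleton x)
  then show ?case by simp
next
  case (insert x K)
  let ?c = "\<lambda>b. \<Prod>g\<in>K - {b}. v g / (v g - v b)"
  have vx: "v x \<notin> v ` K" using insert by (auto simp: inj_on_def)
  have IH: "(\<Prod>g\<in>K. v g / (v g - z)) = (\<Sum>b\<in>K. ?c b * (v b / (v b - z)))"
       "(\<Prod>g\<in>K. v g / (v g - v x)) = (\<Sum>b\<in>K. ?c b * (v b / (v b - v x)))"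
    by (rule insert.IH; use insert.prems vx in auto)+
  \<comment> \<open>The case of two nodes. The first summand puts the factor of \<open>x\<close>
    into the old weights; the second collects everything at \<open>x\<close>, where the hypothesis
    is applied once more with z = \<open>v x\<close>.\<close>
  have split: "(v b / (v b - z)) * (v x / (v x - z)) =
      (v b / (v b - z)) * (v x / (v x - v b)) + (v x / (v x - z)) * (v b / (v b - v x))" if "b \<in> K" for b
  proof -
    have "v b \<noteq> v x" using vx that by (metis imageI)
    then have "v b - z \<noteq> 0" "v x - z \<noteq> 0" "v x - v b \<noteq> 0" "v b - v x \<noteq> 0" using insert.prems vx that by auto
    then show ?thesis by (simp add: divide_simps) (simp add: algebra_simps)
  qed
  have "(\<Prod>g\<in>insert x K. v g / (v g - z)) = (\<Sum>b\<in>K. ?c b * ((v b / (v b - z)) * (v x / (v x - z))))"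
    using insert.hyps by (simp add: IH(1) sum_distrib_left sum_distrib_right mult_ac)
  also have "\<dots> = (\<Sum>b\<in>K. ?c b * (v x / (v x - v b)) * (v b / (v b - z))) +
       (v x / (v x - z)) * (\<Sum>b\<in>K. ?c b * (v b / (v b - v x)))"
    unfolding sum_distrib_left sum.distrib[symmetric]
    by (rule sum.cong[OF refl]) (simp only: split distrib_left mult_ac)
  also have "(\<Sum>b\<in>K. ?c b * (v x / (v x - v b)) * (v b / (v b - z))) =
      (\<Sum>b\<in>K. (\<Prod>g\<in>insert x K - {b}. v g / (v g - v b)) * (v b / (v b - z)))"
  proof (rule sum.cong[OF refl])
    fix b assume b: "b \<in> K"
    have "insert x K - {b} = insert x (K - {b})" using b insert.hyps by auto
    then show "?c b * (v x / (v x - v b)) * (v b / (v b - z)) =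
       (\<Prod>g\<in>insert x K - {b}. v g / (v g - v b)) * (v b / (v b - z))"
      using insert.hyps by simp
  qed
  also have "(\<Sum>b\<in>K. ?c b * (v b / (v b - v x))) = (\<Prod>g\<in>insert x K - {x}. v g / (v g - v x))"
    using insert.hyps IH(2) by simp
  finally show ?case using insert.hyps by (simp add: mult_ac)
qed

text \<open>The monomials with these exponents sum to prod v_i times the complete homogeneous
  symmetric polynomial of degree m - |K|.\<close>

definition pos_multi :: "nat set \<Rightarrow> nat \<Rightarrow> (nat \<Rightarrow> nat) set" where
  "pos_multi K m = {k \<in> supp_in K. (\<forall>i\<in>K. 1 \<le> k i) \<and> sum k K = m}"

lemma pos_multi_insert_sum:
  fixes v :: "nat \<Rightarrow> complex"
  assumes "finite K" "x \<notin> K"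
  shows "(\<Sum>k\<in>pos_multi (insert x K) m. \<Prod>i\<in>insert x K. v i ^ k i) =
    (\<Sum>j\<in>{1..m}. v x ^ j * (\<Sum>k\<in>pos_multi K (m - j). \<Prod>i\<in>K. v i ^ k i))"
proof -
  have fin: "finite (pos_multi K j)" for j
    unfolding pos_multi_def by (rule finite_subset[OF _ finite_supp_in_sum[OF assms(1), of j]]) auto
  have "(\<Sum>j\<in>{1..m}. v x ^ j * (\<Sum>k\<in>pos_multi K (m - j). \<Prod>i\<in>K. v i ^ k i)) =
     (\<Sum>p\<in>Sigma {1..m} (\<lambda>j. pos_multi K (m - j)). v x ^ fst p * (\<Prod>i\<in>K. v i ^ snd p i))"
    by (simp add: fin sum_distrib_left sum.Sigma case_prod_unfold)
  also have "\<dots> = (\<Sum>k\<in>pos_multi (insert x K) m. \<Prod>i\<in>insert x K. v i ^ k i)"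
  proof (rule sum.reindex_bij_witness[where j = "\<lambda>(j, k). k(x := j)" and i = "\<lambda>k. (k x, k(x := 0))"])
    fix p assume p: "p \<in> Sigma {1..m} (\<lambda>j. pos_multi K (m - j))"
    obtain j k where jk: "p = (j, k)" by (cases p)
    have j: "1 \<le> j" "j \<le> m" and k: "k \<in> pos_multi K (m - j)" using p jk by auto
    have kx: "k x = 0" using k assms by (auto simp: pos_multi_def supp_in_def)
    have e: "(\<Sum>i\<in>K. (k(x := j)) i) = sum k K" "(\<Prod>i\<in>K. v i ^ (k(x := j)) i) = (\<Prod>i\<in>K. v i ^ k i)"
      using assms by (auto intro!: sum.cong prod.cong)
    show "(\<lambda>k. (k x, k(x := 0))) ((\<lambda>(j, k). k(x := j)) p) = p" using kx by (auto simp: jk)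
    show "(\<lambda>(j, k). k(x := j)) p \<in> pos_multi (insert x K) m"
      using j k assms e by (auto simp: jk pos_multi_def supp_in_def)
    show "(\<Prod>i\<in>insert x K. v i ^ ((\<lambda>(j, k). k(x := j)) p) i) = v x ^ fst p * (\<Prod>i\<in>K. v i ^ snd p i)"
      using assms e by (simp add: jk)
  next
    fix k assume k: "k \<in> pos_multi (insert x K) m"
    show "(\<lambda>(j, k). k(x := j)) ((\<lambda>k. (k x, k(x := 0))) k) = k" by simp
    have e: "(\<Sum>i\<in>K. (k(x := 0)) i) = sum k K" using assms by (auto intro!: sum.cong)
    show "(k x, k(x := 0)) \<in> Sigma {1..m} (\<lambda>j. pos_multi K (m - j))"
      using k assms e by (auto simp: pos_multi_def supp_in_def)
  qed
  finally show ?thesis ..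
qed

text \<open>The classical Lagrange sum for complete homogeneous symmetric polynomials, multiplied by
  prod v_i; the sign comes from writing v_g - v_b instead of v_b - v_g. For m = 0 the left side
  would be 0 while the weights sum to 1, so degree 0 gets a value of its own in
  \<open>block_coeff\<close>.\<close>

lemma lagrange_power_sum:
  fixes v :: "nat \<Rightarrow> complex"
  assumes "finite K" "K \<noteq> {}" "inj_on v K" "1 \<le> m"
  shows "(\<Sum>k\<in>pos_multi K m. \<Prod>i\<in>K. v i ^ k i) =
     (-1) ^ (card K - 1) * (\<Sum>b\<in>K. (\<Prod>g\<in>K - {b}. v g / (v g - v b)) * v b ^ m)"
  using assms
proof (induction K arbitrary: m rule: finite_ne_induct)
  case (singleton x)
  have "pos_multi {x} m = {\<lambda>i. if i = x then m else 0}"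
    using singleton by (auto simp: pos_multi_def supp_in_def)
  then show ?case by simp
next
  case (insert x K)
  let ?c = "\<lambda>b. \<Prod>g\<in>K - {b}. v g / (v g - v b)"
  let ?E = "\<lambda>K m. \<Sum>k\<in>pos_multi K m. \<Prod>i\<in>K. v i ^ k i"
  define s :: complex where "s = (-1) ^ (card K - 1)"
  have vx: "v x \<notin> v ` K" using insert by (auto simp: inj_on_def)
  have E0: "?E K 0 = 0" 
  proof -
    have "pos_multi K 0 = {}" using insert.hyps by (auto simp: pos_multi_def)
    then show ?thesis by simp
  qed
  have geo: "(\<Sum>j\<in>{1..<m}. v x ^ j * v b ^ (m - j)) =
      - (v x / (v x - v b) * v b ^ m) - v b / (v b - v x) * v x ^ m" if "b \<in> K" for b
  proof -
    have "v b \<noteq> v x" using vx that by (metis imageI)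
    then have nz: "v x - v b \<noteq> 0" "v b - v x \<noteq> 0" by auto
    have "(\<Sum>j\<in>{1..<m}. v x ^ j * v b ^ (m - j)) = v x * v b * (\<Sum>j<m - 1. v b ^ (m - 1 - Suc j) * v x ^ j)"
      unfolding sum_distrib_left
      by (rule sum.reindex_bij_witness[where i = Suc and j = "\<lambda>j. j - 1"])
         (auto simp: power_Suc[symmetric] Suc_diff_Suc mult_ac simp del: power_Suc
           simp flip: power_Suc power_Suc2, simp add: power_eq_if mult_ac)
    moreover have "v x ^ (m - 1) - v b ^ (m - 1) = (v x - v b) * (\<Sum>j<m - 1. v b ^ (m - 1 - Suc j) * v x ^ j)"
      by (rule power_diff_sumr2)
    ultimately have "(v x - v b) * (\<Sum>j\<in>{1..<m}. v x ^ j * v b ^ (m - j)) = v x * v b * (v x ^ (m - 1) - v b ^ (m - 1))"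
      by simp
    also have "\<dots> = v b * v x ^ m - v x * v b ^ m"
      using insert.prems(2) by (cases m) (auto simp: algebra_simps)
    finally have "(\<Sum>j\<in>{1..<m}. v x ^ j * v b ^ (m - j)) = (v b * v x ^ m - v x * v b ^ m) / (v x - v b)"
      using nz(1) by (metis nonzero_eq_divide_eq mult.commute)
    moreover have "v b / (v b - v x) = - (v b / (v x - v b))"
      by (metis minus_diff_eq minus_divide_right)
    ultimately show ?thesis by (simp add: diff_divide_distrib)
  qed
  have "?E (insert x K) m = (\<Sum>j\<in>{1..m}. v x ^ j * ?E K (m - j))"
    using insert.hyps by (intro pos_multi_insert_sum)
  \<comment> \<open>The exponent of \<open>x\<close> cannot use up the whole degree, since the
    nonempty rest has positive exponents.\<close>
  also have "\<dots> = (\<Sum>j\<in>{1..<m}. v x ^ j * ?E K (m - j))"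
  proof (rule sum.mono_neutral_right)
    show "\<forall>j\<in>{1..m} - {1..<m}. v x ^ j * ?E K (m - j) = 0"
    proof
      fix j assume "j \<in> {1..m} - {1..<m}"
      then have "m - j = 0" by auto
      then show "v x ^ j * ?E K (m - j) = 0" using E0 by simp
    qed
  qed auto
  also have "\<dots> = (\<Sum>j\<in>{1..<m}. v x ^ j * (s * (\<Sum>b\<in>K. ?c b * v b ^ (m - j))))"
  proof (rule sum.cong[OF refl])
    fix j assume "j \<in> {1..<m}"
    then have "?E K (m - j) = s * (\<Sum>b\<in>K. ?c b * v b ^ (m - j))"
      unfolding s_def using insert.prems by (intro insert.IH) auto
    then show "v x ^ j * ?E K (m - j) = v x ^ j * (s * (\<Sum>b\<in>K. ?c b * v b ^ (m - j)))" by simp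
  qed
  also have "\<dots> = s * (\<Sum>b\<in>K. ?c b * (\<Sum>j\<in>{1..<m}. v x ^ j * v b ^ (m - j)))"
    by (simp add: sum_distrib_left mult_ac) (rule sum.swap)
  also have "\<dots> = s * (\<Sum>b\<in>K. - (?c b * (v x / (v x - v b)) * v b ^ m) - ?c b * (v b / (v b - v x)) * v x ^ m)"
    by (rule arg_cong[where f = "\<lambda>t. s * t"], rule sum.cong[OF refl], subst geo) (auto simp: algebra_simps)
  also have "\<dots> = - s * ((\<Sum>b\<in>K. ?c b * (v x / (v x - v b)) * v b ^ m) + (\<Sum>b\<in>K. ?c b * (v b / (v b - v x))) * v x ^ m)"
    by (simp add: sum_subtractf sum_negf sum_distrib_left sum_distrib_right algebra_simps)
  also have "(\<Sum>b\<in>K. ?c b * (v x / (v x - v b)) * v b ^ m) =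
      (\<Sum>b\<in>K. (\<Prod>g\<in>insert x K - {b}. v g / (v g - v b)) * v b ^ m)"
  proof (rule sum.cong[OF refl])
    fix b assume b: "b \<in> K"
    have "insert x K - {b} = insert x (K - {b})" using b insert.hyps by auto
    then show "?c b * (v x / (v x - v b)) * v b ^ m =
       (\<Prod>g\<in>insert x K - {b}. v g / (v g - v b)) * v b ^ m"
      using insert.hyps by simp
  qed
  also have "(\<Sum>b\<in>K. ?c b * (v b / (v b - v x))) = (\<Prod>g\<in>insert x K - {x}. v g / (v g - v x))"
    using insert.hyps insert.prems vx partial_fractions_prod[of K v "v x"] by simp
  also have "- s = (-1) ^ (card (insert x K) - 1)"
    using insert.hyps by (simp add: s_def card_gt_0_iff power_eq_if)
  finally show ?case using insert.hyps by (simp add: add_ac)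
qed

text \<open>Coefficients of the Lagrange sum \<open>\<Sum>b\<in>K. (\<Prod>g\<in>K - {b}. v g / (v g - v b)) * H (v b)\<close> as a power series
  in the \<open>v i\<close>, where \<open>h\<close> are the coefficients of \<open>H\<close>.\<close>

definition block_coeff :: "nat set \<Rightarrow> (nat \<Rightarrow> complex) \<Rightarrow> (nat \<Rightarrow> nat) \<Rightarrow> complex" where
  "block_coeff K h k = (if \<forall>i\<in>K. k i = 0 then h 0
     else if \<forall>i\<in>K. 1 \<le> k i then (-1) ^ (card K - 1) * h (sum k K) else 0)"

text \<open>Single terms have poles at \<open>v g\<close> = \<open>v b\<close>, yet their sum is a
  power series. Bounded coefficients and a product of geometric series allow grouping by total
  degree, and in degree m the finite sum is \<open>h m\<close> times the Lagrange sum of m-th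
  powers.\<close>

lemma block_has_sum:
  fixes v :: "nat \<Rightarrow> complex"
  assumes K: "finite K" "K \<noteq> {}" "inj_on v K" "\<And>i. i \<in> K \<Longrightarrow> v i \<noteq> 0" "\<And>i. i \<in> K \<Longrightarrow> norm (v i) < 1"
    and C: "\<And>m. norm (h m) \<le> C"
    and H: "\<And>i. i \<in> K \<Longrightarrow> ((\<lambda>m. h m * v i ^ m) has_sum H i) UNIV"
  shows "((\<lambda>k. block_coeff K h k * (\<Prod>i\<in>K. v i ^ k i)) has_sum
      (\<Sum>b\<in>K. (\<Prod>g\<in>K - {b}. v g / (v g - v b)) * H b)) (supp_in K)"
proof -
  let ?c = "\<lambda>b. \<Prod>g\<in>K - {b}. v g / (v g - v b)"
  define f where "f k = block_coeff K h k * (\<Prod>i\<in>K. v i ^ k i)" for k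
  have C0: "0 \<le> C" using C[of 0] norm_ge_zero order_trans by blast
  have "((\<lambda>k. \<Prod>i\<in>K. v i ^ k i) has_sum (\<Prod>i\<in>K. 1 / (1 - v i))) (supp_in K)"
    by (rule has_sum_prod_coords) (use K in \<open>auto intro: has_sum_geometric\<close>)
  then have "(\<lambda>k. norm (\<Prod>i\<in>K. v i ^ k i)) summable_on supp_in K"
    by (rule iffD1[OF summable_on_iff_abs_summable_on_complex has_sum_imp_summable])
  then have s: "(\<lambda>k. C * norm (\<Prod>i\<in>K. v i ^ k i)) summable_on supp_in K"
    by (rule summable_on_cmult_right)
  have "(\<lambda>k. norm (f k)) summable_on supp_in K"
  proof (rule Infinite_Sum.abs_summable_on_comparison_test'[OF s])
    fix k
    have "norm (block_coeff K h k) \<le> C" using C C0 by (auto simp: block_coeff_def norm_mult norm_power)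
    then show "norm (f k) \<le> C * norm (\<Prod>i\<in>K. v i ^ k i)"
      unfolding f_def norm_mult by (rule mult_right_mono) simp
  qed
  then have fs: "f summable_on supp_in K" using summable_on_iff_abs_summable_on_complex by blast
  let ?F = "\<lambda>m. {k \<in> supp_in K :: (nat \<Rightarrow> nat) set. sum k K = m}"
  have fin: "finite (?F m)" for m by (rule finite_supp_in_sum[OF K(1)])
  have "(f has_sum infsum f (supp_in K)) (supp_in K)" by (rule has_sum_infsum[OF fs])
  also have "?this \<longleftrightarrow> ((\<lambda>(m, k). f k) has_sum infsum f (supp_in K)) (Sigma UNIV ?F)"
    by (rule has_sum_reindex_bij_witness[where j = "\<lambda>k. (sum k K, k)" and i = snd]) auto
  finally have sig: "((\<lambda>(m, k). f k) has_sum infsum f (supp_in K)) (Sigma UNIV ?F)" .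
  have fib: "(\<Sum>k\<in>?F m. f k) = h m * (\<Sum>b\<in>K. ?c b * v b ^ m)" for m
  proof (cases "m = 0")
    case True
    have "?F m = {\<lambda>_. 0}" using True K(1) by (auto simp: supp_in_def)
    moreover have "(\<Sum>b\<in>K. ?c b) = 1"
    proof -
      have "0 \<notin> v ` K" using K(4) by force
      then have "(\<Prod>g\<in>K. v g / (v g - 0)) = (\<Sum>b\<in>K. ?c b * (v b / (v b - 0)))"
        by (rule partial_fractions_prod[OF K(1-3)])
      moreover have "(\<Prod>g\<in>K. v g / (v g - 0)) = 1" using K(4) by (intro prod.neutral) auto
      moreover have "(\<Sum>b\<in>K. ?c b * (v b / (v b - 0))) = (\<Sum>b\<in>K. ?c b)" using K(4) by (intro sum.cong) auto
      ultimately show ?thesis by simp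
    qed
    ultimately show ?thesis using True by (simp add: f_def block_coeff_def)
  next
    case False
    have "(\<Sum>k\<in>?F m. f k) = (\<Sum>k\<in>pos_multi K m. f k)"
    proof (rule sum.mono_neutral_right[OF fin])
      show "pos_multi K m \<subseteq> ?F m" by (auto simp: pos_multi_def)
      show "\<forall>k\<in>?F m - pos_multi K m. f k = 0"
      proof
        fix k assume k: "k \<in> ?F m - pos_multi K m"
        have "\<not> (\<forall>i\<in>K. k i = 0)"
        proof
          assume "\<forall>i\<in>K. k i = 0"
          then have "sum k K = 0" by simp
          then show False using k False by simp
        qed
        moreover have "\<not> (\<forall>i\<in>K. 1 \<le> k i)" using k by (auto simp: pos_multi_def)
        ultimately show "f k = 0" by (simp only: f_def block_coeff_def if_False mult_zero_left)
      qed
    qed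
    also have "\<dots> = (\<Sum>k\<in>pos_multi K m. (-1) ^ (card K - 1) * h m * (\<Prod>i\<in>K. v i ^ k i))"
    proof (rule sum.cong[OF refl])
      fix k assume k: "k \<in> pos_multi K m"
      then have "\<not> (\<forall>i\<in>K. k i = 0)" using K(2) by (force simp: pos_multi_def)
      then show "f k = (-1) ^ (card K - 1) * h m * (\<Prod>i\<in>K. v i ^ k i)"
        using k by (auto simp: f_def block_coeff_def pos_multi_def)
    qed
    also have "\<dots> = (-1) ^ (card K - 1) * h m * (\<Sum>k\<in>pos_multi K m. \<Prod>i\<in>K. v i ^ k i)"
      by (simp add: sum_distrib_left)
    \<comment> \<open>The sign in \<open>block_coeff\<close> cancels the one in
      \<open>lagrange_power_sum\<close>.\<close>
    also have "\<dots> = h m * (\<Sum>b\<in>K. ?c b * v b ^ m)"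
      using False by (subst lagrange_power_sum[OF K(1-3)]) (auto simp: power_add[symmetric] mult_2[symmetric] power_mult)
    finally show ?thesis .
  qed
  have "((\<lambda>m. \<Sum>k\<in>?F m. f k) has_sum infsum f (supp_in K)) UNIV"
    by (rule has_sum_Sigma'[OF sig]) (use fin in auto)
  moreover have "((\<lambda>m. \<Sum>b\<in>K. ?c b * (h m * v b ^ m)) has_sum (\<Sum>b\<in>K. ?c b * H b)) UNIV"
    by (intro has_sum_finite_sum has_sum_cmult_right K(1) H)
  moreover have "(\<Sum>k\<in>?F m. f k) = (\<Sum>b\<in>K. ?c b * (h m * v b ^ m))" for m
    unfolding fib by (simp add: sum_distrib_left mult_ac)
  ultimately have "infsum f (supp_in K) = (\<Sum>b\<in>K. ?c b * H b)"
    using has_sum_unique by simp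
  then show ?thesis using has_sum_infsum[OF fs] by (simp add: f_def[abs_def])
qed


section \<open>Uniqueness of the coefficients of a power series\<close>

text \<open>Vanishing is assumed at small positive reals only, since the substitution below is known
  to avoid the singular set of \<open>F\<close> there. Zeros accumulating at 0 still force all
  coefficients to vanish.\<close>

lemma powser_eq_zero_on_positive:
  fixes Q :: "nat \<Rightarrow> complex"
  assumes e: "0 < \<epsilon>" and s: "\<And>s :: real. 0 < s \<Longrightarrow> s < \<epsilon> \<Longrightarrow> (\<lambda>n. Q n * of_real s ^ n) sums 0"
  shows "Q m = 0"
proof (rule ccontr)
  assume m: "Q m \<noteq> 0"
  \<comment> \<open>Multiplying the series by x makes it vanish at 0 and moves the nonzero
    coefficient to a positive index, which is the form that \<open>powser_0_nonzero\<close>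
    expects.\<close>
  define Q' where "Q' n = (case n of 0 \<Rightarrow> 0 | Suc j \<Rightarrow> Q j)" for n
  define f where "f x = x * (\<Sum>n. Q n * x ^ n)" for x
  have "summable (\<lambda>n. Q n * of_real (\<epsilon> / 2) ^ n)"
    using s[of "\<epsilon> / 2"] e sums_summable by auto
  then have "summable (\<lambda>n. Q n * x ^ n)" if "norm x < \<epsilon> / 2" for x
    by (rule powser_inside) (use that e in auto)
  then have Q'sums: "(\<lambda>n. Q' n * x ^ n) sums f x" if "norm x < \<epsilon> / 2" for x
  proof -
    have "(\<lambda>n. Q n * x ^ n) sums (\<Sum>n. Q n * x ^ n)" using \<open>norm x < \<epsilon> / 2 \<Longrightarrow> _\<close> that by (simp add: summable_sums)
    then have "(\<lambda>n. x * (Q n * x ^ n)) sums f x" unfolding f_def by (rule sums_mult)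
    then have "(\<lambda>n. Q' (Suc n) * x ^ Suc n) sums f x" by (simp add: Q'_def mult_ac)
    then show ?thesis by (subst (asm) sums_Suc_iff) (simp add: Q'_def)
  qed
  obtain t where t: "0 < t" "\<And>z. z \<in> cball 0 t - {0} \<Longrightarrow> f z \<noteq> 0"
  proof (rule powser_0_nonzero[of "\<epsilon> / 2" 0 Q' f "Suc m"])
    show "(\<lambda>n. Q' n * (x - 0) ^ n) sums f x" if "norm (x - 0) < \<epsilon> / 2" for x
      using Q'sums that by simp
  qed (use e m in \<open>auto simp: f_def Q'_def\<close>)
  define u where "u = min t (\<epsilon> / 2)"
  have u: "0 < u" "u \<le> t" "u < \<epsilon>" using t e by (auto simp: u_def)
  have "(\<Sum>n. Q n * of_real u ^ n) = 0" using s[OF u(1) u(3)] by (simp add: sums_iff)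
  then have "f (of_real u) = 0" by (simp add: f_def)
  moreover have "f (of_real u) \<noteq> 0" using u by (intro t(2)) auto
  ultimately show False by simp
qed

lemma digits_unique:
  fixes k l :: "nat \<Rightarrow> nat"
  assumes "\<forall>i<r. k i < M" "\<forall>i<r. l i < M" "(\<Sum>i<r. k i * M ^ i) = (\<Sum>i<r. l i * M ^ i)" "i < r"
  shows "k i = l i"
  using assms
proof (induction r arbitrary: k l i)
  case 0 then show ?case by simp
next
  case (Suc r)
  have sh: "(\<Sum>i<Suc r. k i * M ^ i) = k 0 + M * (\<Sum>i<r. k (Suc i) * M ^ i)" for k :: "nat \<Rightarrow> nat"
    by (simp add: sum.lessThan_Suc_shift sum_distrib_left mult_ac del: sum.lessThan_Suc)
  have eq: "k 0 + M * (\<Sum>i<r. k (Suc i) * M ^ i) = l 0 + M * (\<Sum>i<r. l (Suc i) * M ^ i)"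
    using Suc.prems(3) unfolding sh .
  have lt: "k 0 < M" "l 0 < M" using Suc.prems by auto
  have "k 0 = (k 0 + M * (\<Sum>i<r. k (Suc i) * M ^ i)) mod M" using lt by simp
  also have "\<dots> = l 0" unfolding eq using lt by simp
  finally have 0: "k 0 = l 0" .
  have "(\<Sum>i<r. k (Suc i) * M ^ i) = (\<Sum>i<r. l (Suc i) * M ^ i)" using eq 0 lt by simp
  then have "j < r \<Longrightarrow> k (Suc j) = l (Suc j)" for j
    using Suc.prems by (intro Suc.IH[of "\<lambda>i. k (Suc i)" "\<lambda>i. l (Suc i)"]) auto
  then show ?case using 0 Suc.prems(4) by (cases i) auto
qed

text \<open>Kronecker substitution \<open>t i = s ^ w i\<close> with \<open>w i = W + M ^ i\<close>: for large \<open>M\<close> the indices of total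
  degree \<open>m\<close> get distinct exponents, and for large \<open>W\<close> these are smaller than those of higher degree.\<close>

lemma multi_powser_eq_zero:
  fixes P :: "(nat \<Rightarrow> nat) \<Rightarrow> complex"
  assumes e: "0 < \<epsilon>"
    and H: "\<And>w s. inj_on w {..<r} \<Longrightarrow> (\<forall>i<r. 1 \<le> w i) \<Longrightarrow> 0 < s \<Longrightarrow> s < \<epsilon> \<Longrightarrow>
      ((\<lambda>k. P k * (\<Prod>i<r. (of_real s ^ w i) ^ k i)) has_sum 0) (supp_in {..<r})"
    and k0: "k0 \<in> supp_in {..<r}"
  shows "P k0 = 0"
  using k0
proof (induction "sum k0 {..<r}" arbitrary: k0 rule: less_induct)
  case (less k0)
  define m where "m = sum k0 {..<r}"
  \<comment> \<open>The entries of an index of degree m are digits below this base, and a base of at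
    least 2 makes the weights \<open>w i\<close> distinct.\<close>
  define M where "M = m + 2"
  \<comment> \<open>\<open>N k0\<close> is at most m * M^r, so one more unit of total degree
    outweighs it.\<close>
  define W where "W = m * M ^ r + 1"
  define w where "w i = W + M ^ i" for i
  define n where "n k = (\<Sum>i<r. k i * w i)" for k :: "nat \<Rightarrow> nat"
  define N where "N k = (\<Sum>i<r. k i * M ^ i)" for k :: "nat \<Rightarrow> nat"
  have nN: "n k = sum k {..<r} * W + N k" for k
    by (simp add: n_def N_def w_def distrib_left sum.distrib sum_distrib_right)
  have w1: "\<forall>i<r. 1 \<le> w i" by (simp add: w_def W_def)
  have winj: "inj_on w {..<r}"
    by (rule inj_onI) (auto simp: w_def M_def)
  let ?F = "\<lambda>j. {k \<in> supp_in {..<r} :: (nat \<Rightarrow> nat) set. n k = j}"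
  have fin: "finite (?F j)" for j
  proof (rule finite_subset)
    show "?F j \<subseteq> {k. \<forall>i. (i \<in> {..<r} \<longrightarrow> k i \<in> {..j}) \<and> (i \<notin> {..<r} \<longrightarrow> k i = 0)}"
    proof (rule subsetI)
      fix k assume k: "k \<in> ?F j"
      have "k i \<le> j" if i: "i < r" for i
      proof -
        have "k i \<le> k i * w i" using w1 i by simp
        also have "\<dots> \<le> n k" unfolding n_def using i by (intro member_le_sum) auto
        finally show ?thesis using k by simp
      qed
      then show "k \<in> {k. \<forall>i. (i \<in> {..<r} \<longrightarrow> k i \<in> {..j}) \<and> (i \<notin> {..<r} \<longrightarrow> k i = 0)}"
        using k by (auto simp: supp_in_def)
    qed
    show "finite {k. \<forall>i. (i \<in> {..<r} \<longrightarrow> k i \<in> {..j}) \<and> (i \<notin> {..<r} \<longrightarrow> k i = (0::nat))}"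
      by (rule finite_set_of_finite_funs) auto
  qed
  define Q where "Q j = (\<Sum>k\<in>?F j. P k)" for j
  have "Q (n k0) = 0"
  proof (rule powser_eq_zero_on_positive[OF e])
    fix s :: real assume s: "0 < s" "s < \<epsilon>"
    have pr: "(\<Prod>i<r. (of_real s ^ w i) ^ k i) = complex_of_real s ^ n k" for k
      by (simp add: n_def power_sum power_mult[symmetric] mult.commute)
    have "((\<lambda>k. P k * of_real s ^ n k) has_sum 0) (supp_in {..<r})"
      using H[OF winj w1 s] unfolding pr .
    also have "?this \<longleftrightarrow> ((\<lambda>(j, k). P k * of_real s ^ n k) has_sum 0) (Sigma UNIV ?F)"
      by (rule has_sum_reindex_bij_witness[where j = "\<lambda>k. (n k, k)" and i = snd]) auto
    finally have "((\<lambda>j. Q j * of_real s ^ j) has_sum 0) UNIV"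
    proof (rule has_sum_Sigma')
      fix j
      have "(\<Sum>k\<in>?F j. P k * of_real s ^ n k) = Q j * of_real s ^ j"
        unfolding Q_def sum_distrib_right by (rule sum.cong) auto
      then show "((\<lambda>k. case (j, k) of (j, k) \<Rightarrow> P k * of_real s ^ n k) has_sum Q j * of_real s ^ j) (?F j)"
        using has_sum_finite[OF fin[of j], of "\<lambda>k. P k * of_real s ^ n k"] by simp
    qed
    then show "(\<lambda>j. Q j * of_real s ^ j) sums 0" by (rule has_sum_imp_sums)
  qed
  \<comment> \<open>Only \<open>k0\<close> survives: lower degrees vanish by induction, equal
    degrees are separated by their digits, and higher degrees exceed the exponent
    \<open>n k0\<close>.\<close>
  moreover have "Q (n k0) = (\<Sum>k\<in>{k0}. P k)"
    unfolding Q_def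
  proof (rule sum.mono_neutral_right[OF fin])
    show "{k0} \<subseteq> ?F (n k0)" using less.prems by simp
    show "\<forall>k\<in>?F (n k0) - {k0}. P k = 0"
    proof
      fix k assume "k \<in> ?F (n k0) - {k0}"
      then have k: "k \<in> supp_in {..<r}" "n k = n k0" "k \<noteq> k0" by auto
      have lower: "P k = 0" if "sum k {..<r} < m" using less.hyps[of k] that k(1) by (simp add: m_def)
      have "\<not> m < sum k {..<r}"
      proof
        assume "m < sum k {..<r}"
        then have "(m + 1) * W \<le> sum k {..<r} * W" by (intro mult_right_mono) auto
        also have "\<dots> \<le> n k" by (simp add: nN)
        also have "n k = m * W + N k0" using k nN[of k0] by (simp add: m_def)
        finally have "W \<le> N k0" by (simp add: algebra_simps)
        moreover have "N k0 \<le> m * M ^ r"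
          unfolding N_def m_def sum_distrib_right
          by (intro sum_mono mult_left_mono power_increasing) (auto simp: M_def)
        ultimately show False by (simp add: W_def)
      qed
      moreover have "k = k0" if "sum k {..<r} = m"
      proof (rule ext)
        fix i
        have "k j < M" if "j < r" for j
          using member_le_sum[of j "{..<r}" k] that \<open>sum k {..<r} = m\<close> by (simp add: M_def)
        moreover have "k0 j < M" if "j < r" for j
          using member_le_sum[of j "{..<r}" k0] that by (simp add: M_def m_def)
        moreover have "N k = N k0" using k nN[of k0] nN[of k] that by (simp add: m_def)
        ultimately have "k i = k0 i" if "i < r"
          using digits_unique[of r k M k0 i] that by (simp add: N_def)
        then show "k i = k0 i" using k(1) less.prems by (cases "i < r") (auto simp: supp_in_def)
      qed
      ultimately show "P k = 0" using lower k(3) by linarith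
    qed
  qed
  ultimately show ?case by simp
qed


section \<open>Linear algebra of the root system\<close>

lemma ip_commute: "ip r x y = ip r y x"
  by (simp add: ip_def mult.commute)

lemma ip_unitv_right: "i < r \<Longrightarrow> ip r x (unitv i) = x i"
  by (simp add: ip_def unitv_def if_distrib[of "\<lambda>t. _ * t"] cong: if_cong)

lemma ip_unitv_left: "i < r \<Longrightarrow> ip r (unitv i) x = x i"
  by (simp add: ip_commute[of r "unitv i"] ip_unitv_right)

lemma ip_diff_right: "ip r x (\<lambda>k. y k - z k) = ip r x y - ip r x z"
  by (simp add: ip_def right_diff_distrib sum_subtractf)

lemma ip_add_right: "ip r x (\<lambda>k. y k + z k) = ip r x y + ip r x z"
  by (simp add: ip_def distrib_left sum.distrib)

lemma ip_scale_right: "ip r x (\<lambda>k. c * y k) = c * ip r x y"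
  by (simp add: ip_def sum_distrib_left mult_ac)

lemma ip_scale_left: "ip r (\<lambda>k. c * x k) y = c * ip r x y"
  by (simp add: ip_def sum_distrib_left mult_ac)

lemma ip_diff_left: "ip r (\<lambda>k. x k - y k) z = ip r x z - ip r y z"
  by (simp add: ip_def left_diff_distrib sum_subtractf)

lemma ip_sum_left: "ip r (\<lambda>k. \<Sum>\<beta>\<in>S. c \<beta> * f \<beta> k) y = (\<Sum>\<beta>\<in>S. c \<beta> * ip r (f \<beta>) y)"
  by (simp add: ip_def sum_distrib_left sum_distrib_right mult.assoc) (rule sum.swap)

lemma ip_sum_right: "ip r y (\<lambda>k. \<Sum>\<beta>\<in>S. c \<beta> * f \<beta> k) = (\<Sum>\<beta>\<in>S. c \<beta> * ip r y (f \<beta>))"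
  unfolding ip_commute[of r y] by (rule ip_sum_left)

lemma ip_self_eq_0: "ip r x x = 0 \<Longrightarrow> k < r \<Longrightarrow> x k = 0"
  by (auto simp: ip_def sum_nonneg_eq_0_iff)

lemma lin_hull_orthogonal:
  assumes "x \<in> lin_hull S" "\<forall>\<beta>\<in>S. ip r \<beta> y = 0"
  shows "ip r x y = 0"
  using assms by (auto simp: lin_hull_def ip_sum_left[where f = "\<lambda>\<beta>. \<beta>"])

text \<open>Gram-Schmidt for a set that may be dependent: the new vector \<open>b\<close> is first
  made orthogonal to S, then its component is removed from the residual of \<open>x\<close>.\<close>

lemma orthogonal_projection:
  assumes "finite S"
  shows "\<exists>c. \<forall>\<beta>\<in>S. ip r \<beta> (\<lambda>k. x k - (\<Sum>\<gamma>\<in>S. c \<gamma> * \<gamma> k)) = 0"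
  using assms
proof (induction S arbitrary: x rule: finite_induct)
  case empty then show ?case by simp
next
  case (insert b S)
  obtain c where c: "\<forall>\<beta>\<in>S. ip r \<beta> (\<lambda>k. x k - (\<Sum>\<gamma>\<in>S. c \<gamma> * \<gamma> k)) = 0" using insert.IH by blast
  obtain d where d: "\<forall>\<beta>\<in>S. ip r \<beta> (\<lambda>k. b k - (\<Sum>\<gamma>\<in>S. d \<gamma> * \<gamma> k)) = 0" using insert.IH by blast
  define p where "p k = x k - (\<Sum>\<gamma>\<in>S. c \<gamma> * \<gamma> k)" for k
  define b' where "b' k = b k - (\<Sum>\<gamma>\<in>S. d \<gamma> * \<gamma> k)" for k
  have c': "\<forall>\<beta>\<in>S. ip r \<beta> p = 0" and d': "\<forall>\<beta>\<in>S. ip r \<beta> b' = 0"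
    using c d by (simp_all add: p_def[abs_def] b'_def[abs_def])
  \<comment> \<open>If \<open>b\<close> adds no direction beyond S, then \<open>b'\<close> is zero,
    the quotient is 0 by the convention for division, and the residual stays as it was.\<close>
  define t where "t = ip r b' p / ip r b' b'"
  define e where "e \<gamma> = (if \<gamma> = b then t else c \<gamma> - t * d \<gamma>)" for \<gamma>
  have "(\<Sum>\<gamma>\<in>insert b S. e \<gamma> * \<gamma> k) = t * b k + (\<Sum>\<gamma>\<in>S. (c \<gamma> - t * d \<gamma>) * \<gamma> k)" for k
  proof -
    have "(\<Sum>\<gamma>\<in>S. e \<gamma> * \<gamma> k) = (\<Sum>\<gamma>\<in>S. (c \<gamma> - t * d \<gamma>) * \<gamma> k)"
      using insert.hyps by (intro sum.cong) (auto simp: e_def)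
    then show ?thesis using insert.hyps by (simp add: e_def)
  qed
  then have q: "(\<lambda>k. x k - (\<Sum>\<gamma>\<in>insert b S. e \<gamma> * \<gamma> k)) = (\<lambda>k. p k - t * b' k)"
    by (auto simp: p_def b'_def algebra_simps sum_subtractf sum_distrib_left)
  have ipq: "ip r y (\<lambda>k. p k - t * b' k) = ip r y p - t * ip r y b'" for y
    by (simp add: ip_diff_right ip_scale_right)
  have bb: "ip r b y = ip r b' y" if "\<forall>\<beta>\<in>S. ip r \<beta> y = 0" for y
  proof -
    have "ip r b' y = ip r b y - (\<Sum>\<gamma>\<in>S. d \<gamma> * ip r \<gamma> y)"
      by (simp add: b'_def[abs_def] ip_diff_left ip_sum_left[where f = "\<lambda>\<gamma>. \<gamma>"])
    then show ?thesis using that by simp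
  qed
  have "ip r b p - t * ip r b b' = 0"
  proof (cases "ip r b' b' = 0")
    case True
    then have "ip r b' p = 0" using ip_self_eq_0[OF True] by (simp add: ip_def)
    then show ?thesis using bb[OF c'] True by (simp add: t_def)
  next
    case False
    then show ?thesis using bb[OF c'] bb[OF d'] by (simp add: t_def)
  qed
  then show ?case using c' d' by (intro exI[of _ e]) (simp add: q ipq)
qed

text \<open>The residual of \<open>x\<close> after projection is orthogonal to S, hence zero. This
  proves that sets span without counting dimensions.\<close>

lemma spanning_if_perp_trivial:
  assumes "finite S" "\<forall>\<beta>\<in>S. inV r \<beta>" and "inV r x"
    and triv: "\<And>y. inV r y \<Longrightarrow> \<forall>\<beta>\<in>S. ip r \<beta> y = 0 \<Longrightarrow> y = (\<lambda>_. 0)"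
  shows "x \<in> lin_hull S"
proof -
  obtain c where c: "\<forall>\<beta>\<in>S. ip r \<beta> (\<lambda>k. x k - (\<Sum>\<gamma>\<in>S. c \<gamma> * \<gamma> k)) = 0"
    using orthogonal_projection[OF assms(1)] by blast
  have "inV r (\<lambda>k. x k - (\<Sum>\<gamma>\<in>S. c \<gamma> * \<gamma> k))"
    using assms by (auto simp: inV_def intro!: sum.neutral)
  then have "(\<lambda>k. x k - (\<Sum>\<gamma>\<in>S. c \<gamma> * \<gamma> k)) = (\<lambda>_. 0)" using triv c by blast
  then have "x = (\<lambda>k. \<Sum>\<gamma>\<in>S. c \<gamma> * \<gamma> k)" by (auto simp: fun_eq_iff)
  then show ?thesis by (auto simp: lin_hull_def)
qed

section \<open>Positive roots and bases of type B\<close>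

definition long_posroots_B :: "nat \<Rightarrow> (nat \<Rightarrow> real) set" where
  "long_posroots_B r = {(\<lambda>k. unitv i k + \<sigma> * unitv j k) | i j \<sigma>. i < j \<and> j < r \<and> \<sigma> \<in> {1, -1}}"

lemma short_posroots_eq: "short_posroots_B r = unitv ` {..<r}"
proof
  show "short_posroots_B r \<subseteq> unitv ` {..<r}" by (auto simp: short_posroots_B_def gammaB_def)
  show "unitv ` {..<r} \<subseteq> short_posroots_B r"
  proof
    fix x assume "x \<in> unitv ` {..<r}"
    then obtain i where "i < r" "x = unitv i" by auto
    then have "x = gammaB r (r - i)" "1 \<le> r - i" "r - i \<le> r" by (auto simp: gammaB_def)
    then show "x \<in> short_posroots_B r" unfolding short_posroots_B_def by blast
  qed
qed

lemma long_posroots_cases: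
  assumes "\<beta> \<in> long_posroots_B r"
  obtains i j \<sigma> where "\<beta> = (\<lambda>k. unitv i k + \<sigma> * unitv j k)" "i < j" "j < r" "\<sigma> \<in> {1, -1}"
  using assms unfolding long_posroots_B_def by blast

lemma long_posroots_split:
  "long_posroots_B r = (\<lambda>(i, j) k. unitv i k + unitv j k) ` {(i, j). i < j \<and> j < r}
    \<union> (\<lambda>(i, j) k. unitv i k - unitv j k) ` {(i, j). i < j \<and> j < r}" (is "_ = ?A \<union> ?B")
proof
  show "long_posroots_B r \<subseteq> ?A \<union> ?B"
  proof
    fix \<beta> assume "\<beta> \<in> long_posroots_B r"
    then obtain i j \<sigma> where b: "\<beta> = (\<lambda>k. unitv i k + \<sigma> * unitv j k)" "i < j" "j < r" "\<sigma> \<in> {1, -1}"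
      by (rule long_posroots_cases)
    show "\<beta> \<in> ?A \<union> ?B"
    proof (cases "\<sigma> = 1")
      case True
      then have "\<beta> = (\<lambda>(i, j) k. unitv i k + unitv j k) (i, j)" by (simp add: b(1))
      then show ?thesis using b(2,3) by blast
    next
      case False
      then have "\<beta> = (\<lambda>(i, j) k. unitv i k - unitv j k) (i, j)" using b(4) by (simp add: b(1))
      then show ?thesis using b(2,3) by blast
    qed
  qed
  have "(\<lambda>k. unitv i k + \<sigma> * unitv j k) \<in> long_posroots_B r" if "i < j" "j < r" "\<sigma> \<in> {1, -1}" for i j \<sigma>
    unfolding long_posroots_B_def using that by blast
  from this[of _ _ 1] this[of _ _ "-1"] show "?A \<union> ?B \<subseteq> long_posroots_B r" by auto
qed

lemma posroots_eq: "posroots_B r = long_posroots_B r \<union> short_posroots_B r"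
proof -
  have "{(\<lambda>k. unitv i k - unitv j k) | i j. i < j \<and> j < r} = (\<lambda>(i, j) k. unitv i k - unitv j k) ` {(i, j). i < j \<and> j < r}"
    "{(\<lambda>k. unitv i k + unitv j k) | i j. i < j \<and> j < r} = (\<lambda>(i, j) k. unitv i k + unitv j k) ` {(i, j). i < j \<and> j < r}"
    by (auto simp: image_iff)
  then show ?thesis unfolding posroots_B_def short_posroots_eq long_posroots_split by auto
qed

lemma inj_unitv: "inj unitv"
  by (rule injI) (metis unitv_def zero_neq_one)

lemma unitv_eq_iff [simp]: "unitv i = unitv j \<longleftrightarrow> i = j"
  using inj_unitv by (auto dest: injD)

lemma long_short_disjoint: "long_posroots_B r \<inter> short_posroots_B r = {}"
proof (rule ccontr)
  assume "long_posroots_B r \<inter> short_posroots_B r \<noteq> {}"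
  then obtain \<beta> where "\<beta> \<in> long_posroots_B r" "\<beta> \<in> short_posroots_B r" by blast
  then obtain l where l: "\<beta> = unitv l" unfolding short_posroots_eq by blast
  obtain i j \<sigma> where "\<beta> = (\<lambda>k. unitv i k + \<sigma> * unitv j k)" "i < j" "j < r" "\<sigma> \<in> {1, -1}"
    using \<open>\<beta> \<in> long_posroots_B r\<close> by (rule long_posroots_cases)
  then have e: "(\<lambda>k. unitv i k + \<sigma> * unitv j k) = unitv l" "i < j" "\<sigma> \<in> {1, -1}"
    using l by auto
  then show False using fun_cong[OF e(1), of i] fun_cong[OF e(1), of j] by (auto simp: unitv_def split: if_splits)
qed

lemma posroots_minus_short: "posroots_B r - short_posroots_B r = long_posroots_B r"
  using long_short_disjoint[of r] by (auto simp: posroots_eq)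

lemma finite_long_posroots: "finite (long_posroots_B r)"
proof -
  have "finite {(i, j). i < j \<and> j < r}" by (rule finite_subset[of _ "{..<r} \<times> {..<r}"]) auto
  then show ?thesis unfolding long_posroots_split by blast
qed

lemma finite_posroots: "finite (posroots_B r)"
  by (simp add: posroots_eq finite_long_posroots short_posroots_eq)

lemma inV_posroots: "\<beta> \<in> posroots_B r \<Longrightarrow> inV r \<beta>"
  by (auto simp: posroots_eq long_posroots_B_def short_posroots_eq inV_def unitv_def)

lemma ip_long_root:
  assumes "i < j" "j < r"
  shows "ip r (\<lambda>k. unitv i k + \<sigma> * unitv j k) x = x i + \<sigma> * x j"
  using assms ip_add_right[of r x "unitv i" "\<lambda>k. \<sigma> * unitv j k"]
  by (simp add: ip_commute[of r _ x] ip_scale_right ip_unitv_right)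

text \<open>There are r(r - 1) long positive roots, two signs for each pair of indices. The parity
  allows (-1)^|A - V| to be replaced by (-1)^|A \<inter> V|, where A is the set of long positive
  roots.\<close>

lemma even_card_long_posroots: "even (card (long_posroots_B r))"
proof -
  let ?P = "{(i, j). i < j \<and> j < r}"
  let ?f = "\<lambda>(i, j) k. unitv i k + unitv j k" and ?g = "\<lambda>(i, j) k. unitv i k - unitv j k"
  have sf: "{k. ?f (i, j) k \<noteq> 0} = {i, j}" if "i < j" for i j
    using that by (auto simp: unitv_def)
  have sg: "{k. ?g (i, j) k \<noteq> 0} = {i, j}" if "i < j" for i j
    using that by (auto simp: unitv_def)
  have pair: "(i, j) = (i', j')" if "i < j" "i' < j'" "{i, j} = {i', j'}" for i j i' j' :: nat
    using that by (auto simp: doubleton_eq_iff)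
  have injf: "inj_on ?f ?P"
  proof (rule inj_onI)
    fix p q assume p: "p \<in> ?P" "q \<in> ?P" and e: "?f p = ?f q"
    obtain i j i' j' where ij: "p = (i, j)" "q = (i', j')" by (cases p; cases q) auto
    have lt: "i < j" "i' < j'" using p unfolding ij by auto
    have "{i, j} = {k. ?f p k \<noteq> 0}" unfolding ij by (rule sf[OF lt(1), symmetric])
    also have "\<dots> = {k. ?f q k \<noteq> 0}" unfolding e ..
    also have "\<dots> = {i', j'}" unfolding ij by (rule sf[OF lt(2)])
    finally show "p = q" unfolding ij by (intro pair lt)
  qed
  have injg: "inj_on ?g ?P"
  proof (rule inj_onI)
    fix p q assume p: "p \<in> ?P" "q \<in> ?P" and e: "?g p = ?g q"
    obtain i j i' j' where ij: "p = (i, j)" "q = (i', j')" by (cases p; cases q) auto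
    have lt: "i < j" "i' < j'" using p unfolding ij by auto
    have "{i, j} = {k. ?g p k \<noteq> 0}" unfolding ij by (rule sg[OF lt(1), symmetric])
    also have "\<dots> = {k. ?g q k \<noteq> 0}" unfolding e ..
    also have "\<dots> = {i', j'}" unfolding ij by (rule sg[OF lt(2)])
    finally show "p = q" unfolding ij by (intro pair lt)
  qed
  have disj: "?f ` ?P \<inter> ?g ` ?P = {}"
  proof (rule ccontr)
    assume "?f ` ?P \<inter> ?g ` ?P \<noteq> {}"
    then obtain p q where pq: "p \<in> ?P" "q \<in> ?P" "?f p = ?g q" by blast
    obtain i j i' j' where ij: "p = (i, j)" "q = (i', j')" by (cases p; cases q) auto
    have "unitv i j' + unitv j j' = unitv i' j' - unitv j' j'" using fun_cong[OF pq(3), of j'] by (simp add: ij)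
    moreover have "i' < j'" using pq ij by auto
    ultimately show False by (auto simp: unitv_def split: if_splits)
  qed
  have "finite ?P" by (rule finite_subset[of _ "{..<r} \<times> {..<r}"]) auto
  then have "card (long_posroots_B r) = card ?P + card ?P"
    using injf injg disj unfolding long_posroots_split by (simp add: card_Un_disjoint card_image)
  then show ?thesis by simp
qed

lemma coroot_unitv: "i < r \<Longrightarrow> coroot r (unitv i) = (\<lambda>k. 2 * unitv i k)"
  by (simp add: coroot_def ip_unitv_left) (simp add: unitv_def)

lemma coroot_long:
  assumes "\<beta> \<in> long_posroots_B r"
  shows "coroot r \<beta> = \<beta>"
proof -
  obtain i j \<sigma> where b: "\<beta> = (\<lambda>k. unitv i k + \<sigma> * unitv j k)" "i < j" "j < r" "\<sigma> \<in> {1, -1}"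
    using assms by (rule long_posroots_cases)
  have "ip r \<beta> \<beta> = 2" unfolding b(1) using b(2-4) by (auto simp: ip_long_root) (auto simp: unitv_def)
  then show ?thesis by (simp add: coroot_def)
qed

lemma ip_coroot_eq_0_iff:
  assumes "\<beta> \<in> posroots_B r"
  shows "ip r (coroot r \<beta>) x = 0 \<longleftrightarrow> ip r \<beta> x = 0"
  using assms by (auto simp: posroots_eq short_posroots_eq coroot_long coroot_unitv ip_scale_left)

lemma
  assumes "Vb \<in> bases_B r"
  shows bases_finite: "finite Vb" and bases_subset: "Vb \<subseteq> posroots_B r"
    and bases_indep: "lin_indep Vb" and bases_span: "inV r x \<Longrightarrow> x \<in> lin_hull Vb"
  using assms finite_posroots[of r] by (auto simp: bases_B_def intro: finite_subset)

lemma bases_perp_trivial: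
  assumes "Vb \<in> bases_B r" "inV r x" "\<forall>\<beta>\<in>Vb. ip r \<beta> x = 0"
  shows "x = (\<lambda>_. 0)"
proof -
  have "ip r x x = 0" using lin_hull_orthogonal[OF bases_span[OF assms(1,2)] assms(3)] .
  then show ?thesis using ip_self_eq_0[of r x] assms(2) by (auto simp: inV_def fun_eq_iff) (metis not_le)
qed

text \<open>\<open>A\<close> holds the coordinates of the unit vectors in the basis. Expanding a
  basis vector through unit vectors and comparing coefficients shows that it is an inverse from the
  other side too. No cardinality enters, and \<open>card_bases\<close> is deduced from it.\<close>

lemma bases_dual:
  assumes V: "Vb \<in> bases_B r"
  shows "\<exists>A. (\<forall>k<r. unitv k = (\<lambda>j. \<Sum>\<beta>\<in>Vb. A k \<beta> * \<beta> j)) \<and>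
    (\<forall>\<beta>\<in>Vb. \<forall>\<gamma>\<in>Vb. (\<Sum>k<r. \<gamma> k * A k \<beta>) = (if \<gamma> = \<beta> then 1 else (0::real)))"
proof -
  have fin: "finite Vb" by (rule bases_finite[OF V])
  have "\<exists>c. unitv k = (\<lambda>j. \<Sum>\<beta>\<in>Vb. c \<beta> * \<beta> j)" if "k < r" for k
    using bases_span[OF V, of "unitv k"] that by (auto simp: inV_def unitv_def lin_hull_def)
  then obtain A where A: "\<And>k. k < r \<Longrightarrow> unitv k = (\<lambda>j. \<Sum>\<beta>\<in>Vb. A k \<beta> * \<beta> j)" by metis
  have "(\<Sum>k<r. \<gamma> k * A k \<beta>) = (if \<gamma> = \<beta> then 1 else 0)" if b: "\<beta> \<in> Vb" and g: "\<gamma> \<in> Vb" for \<beta> \<gamma>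
  proof -
    let ?c = "\<lambda>\<beta>. (\<Sum>k<r. \<gamma> k * A k \<beta>) - (if \<gamma> = \<beta> then 1 else 0)"
    have "(\<Sum>\<beta>\<in>Vb. ?c \<beta> * \<beta> j) = 0" for j
    proof -
      have "\<gamma> j = (\<Sum>k<r. \<gamma> k * unitv k j)"
      proof (cases "j < r")
        case True
        then show ?thesis by (simp add: unitv_def if_distrib[of "\<lambda>t. _ * t"] cong: if_cong)
      next
        case False
        then show ?thesis using inV_posroots bases_subset[OF V] g
          by (auto simp: inV_def unitv_def intro!: sum.neutral[symmetric])
      qed
      also have "\<dots> = (\<Sum>k<r. \<gamma> k * (\<Sum>\<beta>\<in>Vb. A k \<beta> * \<beta> j))"
      proof (rule sum.cong[OF refl])
        fix k assume "k \<in> {..<r}"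
        then show "\<gamma> k * unitv k j = \<gamma> k * (\<Sum>\<beta>\<in>Vb. A k \<beta> * \<beta> j)"
          using fun_cong[OF A[of k], of j] by simp
      qed
      also have "\<dots> = (\<Sum>\<beta>\<in>Vb. (\<Sum>k<r. \<gamma> k * A k \<beta>) * \<beta> j)"
        by (simp add: sum_distrib_left sum_distrib_right mult_ac) (rule sum.swap)
      finally have 1: "(\<Sum>\<beta>\<in>Vb. (\<Sum>k<r. \<gamma> k * A k \<beta>) * \<beta> j) = \<gamma> j" by simp
      have 2: "(\<Sum>\<beta>\<in>Vb. (if \<gamma> = \<beta> then 1 else 0) * \<beta> j) = \<gamma> j"
        using fin g by (simp add: if_distrib[of "\<lambda>t. t * _"] cong: if_cong)
      show ?thesis unfolding left_diff_distrib sum_subtractf 1 2 by simp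
    qed
    moreover have "(\<forall>k. (\<Sum>\<beta>\<in>Vb. c \<beta> * \<beta> k) = 0) \<longrightarrow> (\<forall>\<beta>\<in>Vb. c \<beta> = 0)" for c
      using bases_indep[OF V] unfolding lin_indep_def by blast
    from this[of ?c] have "(\<forall>k. (\<Sum>\<beta>\<in>Vb. ?c \<beta> * \<beta> k) = 0) \<longrightarrow> (\<forall>\<beta>\<in>Vb. ?c \<beta> = 0)" .
    ultimately have "?c \<beta> = 0" using b by blast
    then show ?thesis by simp
  qed
  then show ?thesis using A by blast
qed

lemma card_bases:
  assumes V: "Vb \<in> bases_B r"
  shows "card Vb = r"
proof -
  obtain A where A: "\<And>k. k < r \<Longrightarrow> unitv k = (\<lambda>j. \<Sum>\<beta>\<in>Vb. A k \<beta> * \<beta> j)"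
    and A2: "\<And>\<beta> \<gamma>. \<beta> \<in> Vb \<Longrightarrow> \<gamma> \<in> Vb \<Longrightarrow> (\<Sum>k<r. \<gamma> k * A k \<beta>) = (if \<gamma> = \<beta> then 1 else (0::real))"
    using bases_dual[OF V] by blast
  txt \<open>Both sides are the trace of the identity.\<close>
  have "real (card Vb) = (\<Sum>\<beta>\<in>Vb. \<Sum>k<r. \<beta> k * A k \<beta>)" using A2 by simp
  also have "\<dots> = (\<Sum>k<r. \<Sum>\<beta>\<in>Vb. A k \<beta> * \<beta> k)" by (subst sum.swap) (simp add: mult.commute)
  also have "\<dots> = (\<Sum>k<r. unitv k k)"
  proof (rule sum.cong[OF refl])
    fix k assume "k \<in> {..<r}"
    then show "(\<Sum>\<beta>\<in>Vb. A k \<beta> * \<beta> k) = unitv k k" using fun_cong[OF A[of k], of k] by simp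
  qed
  also have "\<dots> = real r" by (simp add: unitv_def)
  finally show ?thesis by simp
qed

text \<open>Two candidates differ by a vector orthogonal to the whole basis. The definite
  description \<open>mu\<close> can thus be computed by exhibiting a vector.\<close>

lemma mu_eqI:
  assumes V: "Vb \<in> bases_B r" and m: "inV r m" "\<And>\<gamma>. \<gamma> \<in> Vb \<Longrightarrow> ip r (coroot r \<gamma>) m = (if \<gamma> = \<beta> then 1 else 0)"
  shows "mu r Vb \<beta> = m"
  unfolding mu_def
proof (rule the_equality)
  show "inV r m \<and> (\<forall>\<gamma>\<in>Vb. ip r (coroot r \<gamma>) m = (if \<gamma> = \<beta> then 1 else 0))" using m by blast
  fix x assume x: "inV r x \<and> (\<forall>\<gamma>\<in>Vb. ip r (coroot r \<gamma>) x = (if \<gamma> = \<beta> then 1 else 0))"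
  have "(\<lambda>k. x k - m k) = (\<lambda>_. 0)"
  proof (rule bases_perp_trivial[OF V])
    show "inV r (\<lambda>k. x k - m k)" using x m by (simp add: inV_def)
    show "\<forall>\<gamma>\<in>Vb. ip r \<gamma> (\<lambda>k. x k - m k) = 0"
    proof
      fix \<gamma> assume g: "\<gamma> \<in> Vb"
      then have "ip r (coroot r \<gamma>) (\<lambda>k. x k - m k) = 0" using x m by (simp add: ip_diff_right)
      then show "ip r \<gamma> (\<lambda>k. x k - m k) = 0" using ip_coroot_eq_0_iff bases_subset[OF V] g by blast
    qed
  qed
  then show "x = m" by (auto simp: fun_eq_iff)
qed

text \<open>Dual to the roots themselves, hence a scalar multiple of \<open>mu\<close>, which is
  dual to the coroots.\<close>

lemma dual_vector_exists:
  assumes V: "Vb \<in> bases_B r" and b: "\<beta> \<in> Vb"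
  obtains m where "inV r m" "\<And>\<gamma>. \<gamma> \<in> Vb \<Longrightarrow> ip r \<gamma> m = (if \<gamma> = \<beta> then 1 else (0::real))"
proof -
  obtain A where "\<And>k. k < r \<Longrightarrow> unitv k = (\<lambda>j. \<Sum>\<beta>\<in>Vb. A k \<beta> * \<beta> j)"
    and A2: "\<And>\<beta> \<gamma>. \<beta> \<in> Vb \<Longrightarrow> \<gamma> \<in> Vb \<Longrightarrow> (\<Sum>k<r. \<gamma> k * A k \<beta>) = (if \<gamma> = \<beta> then 1 else (0::real))"
    using bases_dual[OF V] by blast
  let ?m = "\<lambda>k. if k < r then A k \<beta> else 0"
  have "inV r ?m" by (simp add: inV_def)
  moreover have "ip r \<gamma> ?m = (if \<gamma> = \<beta> then 1 else 0)" if "\<gamma> \<in> Vb" for \<gamma>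
    using A2[OF b that] by (simp add: ip_def)
  ultimately show ?thesis using that by blast
qed

section \<open>Coordinate classes on an orthogonal complement\<close>

definition perp :: "nat \<Rightarrow> (nat \<Rightarrow> real) set \<Rightarrow> (nat \<Rightarrow> real) set" where
  "perp r S = {x. inV r x \<and> (\<forall>\<beta>\<in>S. ip r \<beta> x = 0)}"

text \<open>On \<open>perp r S\<close> every coordinate is \<open>x i = class_sign r S i * x (class_rep r S i)\<close>, where
  \<open>class_sign r S i\<close> is \<open>0\<close> exactly for the coordinates that vanish identically.\<close>

definition perp_zeros :: "nat \<Rightarrow> (nat \<Rightarrow> real) set \<Rightarrow> nat set" where
  "perp_zeros r S = {i. i < r \<and> (\<forall>x\<in>perp r S. x i = 0)}"

definition class_rep :: "nat \<Rightarrow> (nat \<Rightarrow> real) set \<Rightarrow> nat \<Rightarrow> nat" where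
  "class_rep r S i = (LEAST j. \<exists>\<sigma>\<in>{1, -1}. \<forall>x\<in>perp r S. x i = \<sigma> * x j)"

definition class_sign :: "nat \<Rightarrow> (nat \<Rightarrow> real) set \<Rightarrow> nat \<Rightarrow> real" where
  "class_sign r S i = (if \<forall>x\<in>perp r S. x i = 0 then 0
     else SOME \<sigma>. \<sigma> \<in> {1, -1} \<and> (\<forall>x\<in>perp r S. x i = \<sigma> * x (class_rep r S i)))"

text \<open>For a set S of long roots these vectors, one for each representative, form a basis of
  \<open>perp r S\<close>: by \<open>perp_eq_sign\<close> the coordinates of x in it are the values
  of x at the representatives. Coordinates that vanish identically drop out because their sign is
  0.\<close>

definition class_vec :: "nat \<Rightarrow> (nat \<Rightarrow> real) set \<Rightarrow> nat \<Rightarrow> nat \<Rightarrow> real" where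
  "class_vec r S \<rho> = (\<lambda>k. if k < r \<and> class_rep r S k = \<rho> then class_sign r S k else 0)"

definition class_reps :: "nat \<Rightarrow> (nat \<Rightarrow> real) set \<Rightarrow> nat set" where
  "class_reps r S = {\<rho>. \<rho> < r \<and> \<rho> \<notin> perp_zeros r S \<and> class_rep r S \<rho> = \<rho>}"

definition class_of :: "nat \<Rightarrow> (nat \<Rightarrow> real) set \<Rightarrow> nat \<Rightarrow> nat set" where
  "class_of r S \<rho> = {i. i < r \<and> i \<notin> perp_zeros r S \<and> class_rep r S i = \<rho>}"

lemma class_rep_ex: "\<exists>\<sigma>\<in>{1, -1}. \<forall>x\<in>perp r S. x i = \<sigma> * x (class_rep r S i)"
  unfolding class_rep_def by (rule LeastI[where k = i]) (auto intro: bexI[of _ 1])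

lemma class_rep_le: "class_rep r S i \<le> i"
  unfolding class_rep_def by (rule Least_le) (auto intro: bexI[of _ 1])

text \<open>Equality up to sign is an equivalence relation on coordinates, so both representatives
  are least elements of the same set.\<close>

lemma class_rep_eqI:
  assumes "\<sigma> \<in> {1, -1}" "\<forall>x\<in>perp r S. x i = \<sigma> * x j"
  shows "class_rep r S i = class_rep r S j"
proof -
  have s: "\<sigma> * \<sigma> = 1" using assms(1) by auto
  have j: "\<forall>x\<in>perp r S. x j = \<sigma> * x i"
  proof
    fix x assume "x \<in> perp r S"
    then have "\<sigma> * x i = (\<sigma> * \<sigma>) * x j" using assms(2) by simp
    then show "x j = \<sigma> * x i" using s by simp
  qed
  have "(\<exists>\<tau>\<in>{1, -1}. \<forall>x\<in>perp r S. x i = \<tau> * x l) \<longleftrightarrow> (\<exists>\<tau>\<in>{1, -1}. \<forall>x\<in>perp r S. x j = \<tau> * x l)" for l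
  proof
    assume "\<exists>\<tau>\<in>{1, -1}. \<forall>x\<in>perp r S. x i = \<tau> * x l"
    then obtain \<tau> where "\<tau> \<in> {1, -1}" "\<forall>x\<in>perp r S. x i = \<tau> * x l" by blast
    then have "\<forall>x\<in>perp r S. x j = (\<sigma> * \<tau>) * x l" "\<sigma> * \<tau> \<in> {1, -1}" using j assms(1) by (metis mult.assoc, auto)
    then show "\<exists>\<tau>\<in>{1, -1}. \<forall>x\<in>perp r S. x j = \<tau> * x l" by blast
  next
    assume "\<exists>\<tau>\<in>{1, -1}. \<forall>x\<in>perp r S. x j = \<tau> * x l"
    then obtain \<tau> where "\<tau> \<in> {1, -1}" "\<forall>x\<in>perp r S. x j = \<tau> * x l" by blast
    then have "\<forall>x\<in>perp r S. x i = (\<sigma> * \<tau>) * x l" "\<sigma> * \<tau> \<in> {1, -1}" using assms by (metis mult.assoc, auto)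
    then show "\<exists>\<tau>\<in>{1, -1}. \<forall>x\<in>perp r S. x i = \<tau> * x l" by blast
  qed
  then show ?thesis unfolding class_rep_def by simp
qed

lemma class_rep_idem: "class_rep r S (class_rep r S i) = class_rep r S i"
  using class_rep_ex[of r S i] class_rep_eqI by metis

lemma class_sign_nonzero:
  assumes "\<not> (\<forall>x\<in>perp r S. x i = 0)"
  shows "class_sign r S i \<in> {1, -1} \<and> (\<forall>x\<in>perp r S. x i = class_sign r S i * x (class_rep r S i))"
proof -
  have "\<exists>\<sigma>. \<sigma> \<in> {1, -1} \<and> (\<forall>x\<in>perp r S. x i = \<sigma> * x (class_rep r S i))"
    using class_rep_ex[of r S i] by blast
  from someI_ex[OF this] show ?thesis unfolding class_sign_def if_not_P[OF assms] .
qed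

lemma class_sign_zero: "\<forall>x\<in>perp r S. x i = 0 \<Longrightarrow> class_sign r S i = 0"
  by (simp add: class_sign_def)

lemma perp_eq_sign:
  assumes "x \<in> perp r S"
  shows "x i = class_sign r S i * x (class_rep r S i)"
proof (cases "\<forall>x\<in>perp r S. x i = 0")
  case True then show ?thesis using assms class_sign_zero[OF True] by simp
next
  case False then show ?thesis using assms class_sign_nonzero[OF False] by blast
qed

lemma class_sign_eq_0_iff: "class_sign r S i = 0 \<longleftrightarrow> (\<forall>x\<in>perp r S. x i = 0)"
proof (cases "\<forall>x\<in>perp r S. x i = 0")
  case True then show ?thesis using class_sign_zero[OF True] by simp
next
  case False then show ?thesis using class_sign_nonzero[OF False] by auto
qed

lemma class_sign_in: "class_sign r S i \<in> {0, 1, -1}"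
proof (cases "\<forall>x\<in>perp r S. x i = 0")
  case True then show ?thesis using class_sign_zero[OF True] by simp
next
  case False then show ?thesis using class_sign_nonzero[OF False] by auto
qed

lemma class_sign_nz: "i < r \<Longrightarrow> class_sign r S i \<noteq> 0 \<longleftrightarrow> i \<notin> perp_zeros r S"
  by (auto simp: perp_zeros_def class_sign_eq_0_iff)

lemma class_sign_square: "i < r \<Longrightarrow> i \<notin> perp_zeros r S \<Longrightarrow> class_sign r S i * class_sign r S i = 1"
  using class_sign_in[of r S i] class_sign_nz[of i r S] by auto

lemma class_rep_in_reps:
  assumes "i < r" "i \<notin> perp_zeros r S"
  shows "class_rep r S i \<in> class_reps r S"
proof -
  obtain x where x: "x \<in> perp r S" "x i \<noteq> 0" using assms by (auto simp: perp_zeros_def)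
  then have "x (class_rep r S i) \<noteq> 0" using perp_eq_sign[OF x(1), of i] by auto
  then have "\<not> (\<forall>x\<in>perp r S. x (class_rep r S i) = 0)" using x(1) by blast
  moreover have "class_rep r S i < r" using assms class_rep_le[of r S i] by simp
  ultimately show ?thesis by (auto simp: class_reps_def perp_zeros_def class_rep_idem)
qed

lemma class_sign_rep:
  assumes "\<rho> \<in> class_reps r S"
  shows "class_sign r S \<rho> = 1"
proof -
  have r: "\<rho> < r" "\<rho> \<notin> perp_zeros r S" "class_rep r S \<rho> = \<rho>" using assms by (auto simp: class_reps_def)
  then obtain x where "x \<in> perp r S" "x \<rho> \<noteq> 0" by (auto simp: perp_zeros_def)
  then have "x \<rho> = class_sign r S \<rho> * x \<rho>" using perp_eq_sign[of x r S \<rho>] r(3) by metis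
  then show ?thesis using \<open>x \<rho> \<noteq> 0\<close> by simp
qed

text \<open>A long root only says that two coordinates agree up to a sign. It puts both into one
  class and relates their class signs in the same way, so every class vector satisfies it. This is
  special to long roots: a short root would force a coordinate to vanish.\<close>

lemma class_vec_perp:
  assumes S: "S \<subseteq> long_posroots_B r"
  shows "class_vec r S \<rho> \<in> perp r S"
proof -
  have "ip r \<beta> (class_vec r S \<rho>) = 0" if b: "\<beta> \<in> S" for \<beta>
  proof -
    obtain i j \<sigma> where ij: "\<beta> = (\<lambda>k. unitv i k + \<sigma> * unitv j k)" "i < j" "j < r" "\<sigma> \<in> {1, -1}"
      using S b long_posroots_cases by blast
    have rel: "x i = (- \<sigma>) * x j" if "x \<in> perp r S" for x
    proof -
      have "ip r \<beta> x = 0" using that b by (simp add: perp_def)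
      then show ?thesis using ij by (simp add: ip_long_root)
    qed
    have s: "- \<sigma> \<in> {1, -1}" using ij(4) by auto
    have c: "class_rep r S i = class_rep r S j" by (rule class_rep_eqI[OF s]) (use rel in blast)
    \<comment> \<open>The relation is read off at a vector of the complement whose coordinate
      \<open>i\<close> is nonzero.\<close>
    have "class_sign r S i = (- \<sigma>) * class_sign r S j"
    proof (cases "\<forall>x\<in>perp r S. x i = 0")
      case True
      then have "\<forall>x\<in>perp r S. x j = 0" using rel s by force
      then have "class_sign r S i = 0" "class_sign r S j = 0" using True class_sign_eq_0_iff by blast+
      then show ?thesis by simp
    next
      case False
      then obtain x where x: "x \<in> perp r S" "x i \<noteq> 0" by blast
      have "class_sign r S i * x (class_rep r S i) = (- \<sigma>) * (class_sign r S j * x (class_rep r S i))"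
        using rel[OF x(1)] perp_eq_sign[OF x(1), of i] perp_eq_sign[OF x(1), of j] c by metis
      moreover have "x (class_rep r S i) \<noteq> 0" using x perp_eq_sign[OF x(1), of i] by auto
      moreover have "(class_sign r S i - (- \<sigma>) * class_sign r S j) * x (class_rep r S i) = 0"
        using calculation(1) by (simp add: algebra_simps)
      ultimately show ?thesis by simp
    qed
    then show ?thesis using ij s c by (auto simp: ip_long_root class_vec_def)
  qed
  then show ?thesis by (simp add: perp_def inV_def class_vec_def)
qed

lemma class_of_disjoint: "\<rho> \<noteq> \<sigma> \<Longrightarrow> class_of r S \<rho> \<inter> class_of r S \<sigma> = {}"
  by (auto simp: class_of_def)

lemma rep_in_class_of: "\<rho> \<in> class_reps r S \<Longrightarrow> \<rho> \<in> class_of r S \<rho>"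
  by (auto simp: class_of_def class_reps_def)

lemma union_classes: "{..<r} - perp_zeros r S = (\<Union>\<rho>\<in>class_reps r S. class_of r S \<rho>)"
  using class_rep_in_reps by (fastforce simp: class_of_def)

lemma perp_zeros_subset: "perp_zeros r S \<subseteq> {..<r}"
  by (auto simp: perp_zeros_def)

lemma finite_class_reps: "finite (class_reps r S)"
  by (rule finite_subset[of _ "{..<r}"]) (auto simp: class_reps_def)

lemma finite_class_of: "finite (class_of r S \<rho>)"
  by (rule finite_subset[of _ "{..<r}"]) (auto simp: class_of_def)


section \<open>No-broken-circuit sets and the bases that extend them\<close>

text \<open>\<open>VA\<close> tests a basis only through its long part, and this is the test for
  that part: S contains no circuit from which the last element in the order of \<open>nus\<close>
  has been removed.\<close>

definition nbc_sets :: "nat \<Rightarrow> (nat \<Rightarrow> real) list \<Rightarrow> (nat \<Rightarrow> real) set set" where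
  "nbc_sets r nus = {S. S \<subseteq> long_posroots_B r \<and> (\<forall>j<length nus. nus ! j \<notin> lin_hull (S \<inter> set (take j nus)))}"

lemma finite_nbc_sets: "finite (nbc_sets r nus)"
  by (rule finite_subset[of _ "Pow (long_posroots_B r)"]) (auto simp: nbc_sets_def finite_long_posroots)

text \<open>In a linear relation on S, the root that comes last in \<open>nus\<close> among those
  with nonzero coefficient would lie in the span of earlier roots of S.\<close>

lemma nbc_indep:
  assumes nus: "set nus = long_posroots_B r" and S: "S \<in> nbc_sets r nus"
  shows "lin_indep S"
proof -
  have SA: "S \<subseteq> set nus" using S nus by (auto simp: nbc_sets_def)
  then have fin: "finite S" by (rule finite_subset) simp
  have "\<forall>\<beta>\<in>S. c \<beta> = 0" if c: "\<forall>k. (\<Sum>\<beta>\<in>S. c \<beta> * \<beta> k) = 0" for c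
  proof (rule ccontr)
    assume "\<not> (\<forall>\<beta>\<in>S. c \<beta> = 0)"
    then obtain \<beta>0 where b0: "\<beta>0 \<in> S" "c \<beta>0 \<noteq> 0" by blast
    define I where "I = {j. j < length nus \<and> nus ! j \<in> S \<and> c (nus ! j) \<noteq> 0}"
    have finI: "finite I" by (simp add: I_def)
    obtain j0 where "j0 < length nus" "nus ! j0 = \<beta>0" using b0 SA by (meson in_set_conv_nth subsetD)
    then have "I \<noteq> {}" using b0 by (auto simp: I_def)
    define j where "j = Max I"
    have jI: "j \<in> I" unfolding j_def using finI \<open>I \<noteq> {}\<close> by (rule Max_in)
    define \<nu> where "\<nu> = nus ! j"
    have j: "j < length nus" "\<nu> \<in> S" "c \<nu> \<noteq> 0" using jI by (auto simp: I_def \<nu>_def)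
    define T where "T = S \<inter> set (take j nus) - {\<nu>}"
    have zero: "c \<beta> = 0" if zz: "\<beta> \<in> S" "\<beta> \<notin> set (take j nus)" "\<beta> \<noteq> \<nu>" for \<beta>
    proof (rule ccontr)
      assume cb: "c \<beta> \<noteq> 0"
      obtain i where i: "i < length nus" "nus ! i = \<beta>" using zz SA by (meson in_set_conv_nth subsetD)
      then have "i \<in> I" using cb zz by (auto simp: I_def)
      then have "i \<le> j" unfolding j_def using finI by (rule Max_ge[rotated])
      moreover have "i \<noteq> j" using i zz by (auto simp: \<nu>_def)
      ultimately have "\<beta> \<in> set (take j nus)" using i by (auto simp: in_set_conv_nth)
      then show False using zz by simp
    qed
    \<comment> \<open>If \<open>nus\<close> repeats entries, \<nu> may occur among the earlier ones
      as well; it is then given coefficient 0.\<close>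
    have eq: "\<nu> k = (\<Sum>\<beta>\<in>S \<inter> set (take j nus). (if \<beta> = \<nu> then 0 else - c \<beta> / c \<nu>) * \<beta> k)" for k
    proof -
      have "0 = (\<Sum>\<beta>\<in>S. c \<beta> * \<beta> k)" using c by simp
      also have "\<dots> = c \<nu> * \<nu> k + (\<Sum>\<beta>\<in>S - {\<nu>}. c \<beta> * \<beta> k)" using fin j by (simp add: sum.remove)
      also have "(\<Sum>\<beta>\<in>S - {\<nu>}. c \<beta> * \<beta> k) = (\<Sum>\<beta>\<in>T. c \<beta> * \<beta> k)"
        by (rule sum.mono_neutral_right) (use fin zero in \<open>auto simp: T_def\<close>)
      finally have 1: "c \<nu> * \<nu> k = - (\<Sum>\<beta>\<in>T. c \<beta> * \<beta> k)" by simp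
      have "(\<Sum>\<beta>\<in>S \<inter> set (take j nus). (if \<beta> = \<nu> then 0 else - c \<beta> / c \<nu>) * \<beta> k) = (\<Sum>\<beta>\<in>T. - c \<beta> / c \<nu> * \<beta> k)"
        by (rule sum.mono_neutral_cong_right) (use fin in \<open>auto simp: T_def\<close>)
      also have "\<dots> = (- (\<Sum>\<beta>\<in>T. c \<beta> * \<beta> k)) / c \<nu>" by (simp add: sum_divide_distrib sum_negf)
      also have "\<dots> = \<nu> k" using 1 j by (simp add: field_simps)
      finally show ?thesis ..
    qed
    have "\<nu> \<in> lin_hull (S \<inter> set (take j nus))" unfolding lin_hull_def
      by (intro CollectI exI[of _ "\<lambda>\<beta>. if \<beta> = \<nu> then 0 else - c \<beta> / c \<nu>"] conjI TrueI ext) (rule eq)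
    then show False using S j(1) by (auto simp: nbc_sets_def \<nu>_def)
  qed
  then show ?thesis using fin by (simp add: lin_indep_def)
qed

lemma VA_iff:
  assumes nus: "set nus = long_posroots_B r"
  shows "Vb \<in> VA r nus \<longleftrightarrow> Vb \<in> bases_B r \<and> Vb \<inter> long_posroots_B r \<in> nbc_sets r nus"
proof -
  have "Vb \<inter> set (take j nus) = Vb \<inter> long_posroots_B r \<inter> set (take j nus)" for j
    using nus set_take_subset[of j nus] by auto
  then show ?thesis by (auto simp: VA_def nbc_sets_def)
qed

text \<open>Unit vectors of coordinates that vanish identically on \<open>perp r S\<close> are
  already in the span of S, so these coordinates contribute no short root.\<close>

definition choice_basis :: "nat \<Rightarrow> (nat \<Rightarrow> real) set \<Rightarrow> (nat \<Rightarrow> nat) \<Rightarrow> (nat \<Rightarrow> real) set" where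
  "choice_basis r S g = S \<union> unitv ` g ` class_reps r S"

lemma choice_less:
  assumes "g \<in> PiE (class_reps r S) (class_of r S)" "\<rho> \<in> class_reps r S"
  shows "g \<rho> < r" "g \<rho> \<notin> perp_zeros r S" "class_rep r S (g \<rho>) = \<rho>" "g \<rho> \<in> class_of r S \<rho>"
  using PiE_mem[OF assms] by (auto simp: class_of_def)

lemma choice_inj:
  assumes "g \<in> PiE (class_reps r S) (class_of r S)"
  shows "inj_on g (class_reps r S)"
  by (rule inj_onI) (metis choice_less(3)[OF assms])

lemma unitv_notin_long: "unitv i \<notin> long_posroots_B r"
proof
  assume "unitv i \<in> long_posroots_B r"
  then obtain a b \<sigma> where e: "unitv i = (\<lambda>k. unitv a k + \<sigma> * unitv b k)" "a < b" "\<sigma> \<in> {1, -1}"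
    by (rule long_posroots_cases)
  from fun_cong[OF e(1), of a] fun_cong[OF e(1), of b] e(2,3) show False
    by (auto simp: unitv_def split: if_splits)
qed

lemma class_vec_inV: "inV r (class_vec r S \<rho>)"
  by (simp add: inV_def class_vec_def)

lemma class_vec_choice:
  assumes g: "g \<in> PiE (class_reps r S) (class_of r S)" and r: "\<rho> \<in> class_reps r S" "\<sigma> \<in> class_reps r S"
  shows "class_vec r S \<rho> (g \<sigma>) = (if \<sigma> = \<rho> then class_sign r S (g \<rho>) else 0)"
  using choice_less[OF g r(2)] by (auto simp: class_vec_def)

text \<open>Pairing a linear relation with \<open>class_vec r S \<rho>\<close> kills S and all short
  roots except \<open>unitv (g \<rho>)\<close>; what then remains is a relation on S. For spanning,
  a vector orthogonal to S is determined by one coordinate from each class.\<close>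

lemma choice_basis_basis:
  assumes nus: "set nus = long_posroots_B r" and S: "S \<in> nbc_sets r nus"
    and g: "g \<in> PiE (class_reps r S) (class_of r S)"
  shows "choice_basis r S g \<in> bases_B r"
proof -
  let ?R = "class_reps r S" and ?V = "choice_basis r S g"
  have SA: "S \<subseteq> long_posroots_B r" using S by (auto simp: nbc_sets_def)
  have fin: "finite S" using SA finite_long_posroots by (rule finite_subset)
  have finV: "finite ?V" by (simp add: choice_basis_def fin finite_class_reps)
  have disj: "S \<inter> unitv ` g ` ?R = {}" using SA unitv_notin_long by blast
  have sub: "?V \<subseteq> posroots_B r"
    using SA choice_less(1)[OF g] by (auto simp: choice_basis_def posroots_eq short_posroots_eq)
  have inVV: "\<forall>\<beta>\<in>?V. inV r \<beta>" using sub inV_posroots by blast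
  have ipS: "ip r \<beta> (class_vec r S \<rho>) = 0" if "\<beta> \<in> S" for \<beta> \<rho>
    using class_vec_perp[OF SA, of \<rho>] that by (simp add: perp_def)
  have ipU: "ip r (unitv (g \<sigma>)) x = x (g \<sigma>)" if "\<sigma> \<in> ?R" for \<sigma> x
    using choice_less(1)[OF g that] by (rule ip_unitv_left)
  have sumV: "(\<Sum>\<beta>\<in>?V. f \<beta>) = (\<Sum>\<beta>\<in>S. f \<beta>) + (\<Sum>\<rho>\<in>?R. f (unitv (g \<rho>)))" for f :: "_ \<Rightarrow> real"
  proof -
    have "(\<Sum>\<beta>\<in>unitv ` g ` ?R. f \<beta>) = (\<Sum>\<rho>\<in>?R. f (unitv (g \<rho>)))"
      using choice_inj[OF g] by (simp add: sum.reindex inj_on_def o_def)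
    then show ?thesis unfolding choice_basis_def
      using disj fin finite_class_reps[of r S] by (simp add: sum.union_disjoint)
  qed
  have "lin_indep ?V" unfolding lin_indep_def
  proof (intro conjI finV allI impI)
    fix c :: "(nat \<Rightarrow> real) \<Rightarrow> real" assume c: "\<forall>k. (\<Sum>\<beta>\<in>?V. c \<beta> * \<beta> k) = 0"
    have z: "c (unitv (g \<rho>)) = 0" if r: "\<rho> \<in> ?R" for \<rho>
    proof -
      have "0 = ip r (\<lambda>k. \<Sum>\<beta>\<in>?V. c \<beta> * \<beta> k) (class_vec r S \<rho>)" using c by (simp add: ip_def)
      also have "\<dots> = (\<Sum>\<beta>\<in>?V. c \<beta> * ip r \<beta> (class_vec r S \<rho>))" by (rule ip_sum_left)
      also have "\<dots> = (\<Sum>\<sigma>\<in>?R. c (unitv (g \<sigma>)) * class_vec r S \<rho> (g \<sigma>))"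
        unfolding sumV using ipS by (simp add: ipU)
      also have "\<dots> = (\<Sum>\<sigma>\<in>?R. if \<sigma> = \<rho> then c (unitv (g \<rho>)) * class_sign r S (g \<rho>) else 0)"
        by (rule sum.cong) (auto simp: class_vec_choice[OF g r])
      also have "\<dots> = c (unitv (g \<rho>)) * class_sign r S (g \<rho>)" using r finite_class_reps by simp
      finally show ?thesis using class_sign_nz[of "g \<rho>" r S] choice_less[OF g r] by simp
    qed
    have "\<forall>k. (\<Sum>\<beta>\<in>S. c \<beta> * \<beta> k) = 0" using c unfolding sumV by (simp add: z)
    then have "\<forall>\<beta>\<in>S. c \<beta> = 0" using nbc_indep[OF nus S] unfolding lin_indep_def by blast
    then show "\<forall>\<beta>\<in>?V. c \<beta> = 0" using z by (auto simp: choice_basis_def)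
  qed
  moreover have "x \<in> lin_hull ?V" if "inV r x" for x
  proof (rule spanning_if_perp_trivial[OF finV inVV that])
    fix y assume y: "inV r y" "\<forall>\<beta>\<in>?V. ip r \<beta> y = 0"
    have yp: "y \<in> perp r S" using y by (auto simp: perp_def choice_basis_def)
    have "y (g \<rho>) = 0" if "\<rho> \<in> ?R" for \<rho>
    proof -
      have "ip r (unitv (g \<rho>)) y = 0" using y(2) that by (auto simp: choice_basis_def)
      then show ?thesis using ipU[OF that, of y] by simp
    qed
    then have yr: "y \<rho> = 0" if "\<rho> \<in> ?R" for \<rho>
      using perp_eq_sign[OF yp, of "g \<rho>"] choice_less[OF g that] class_sign_nz[of "g \<rho>" r S] that by simp
    show "y = (\<lambda>_. 0)"
    proof
      fix i
      show "y i = 0"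
      proof (cases "i < r \<and> i \<notin> perp_zeros r S")
        case True
        then have "y (class_rep r S i) = 0" by (intro yr class_rep_in_reps) auto
        then show ?thesis using perp_eq_sign[OF yp, of i] by simp
      next
        case False
        then show ?thesis using yp y(1) by (auto simp: perp_zeros_def inV_def)
      qed
    qed
  qed
  ultimately show ?thesis using sub by (simp add: bases_B_def)
qed

text \<open>If a class contained no short root of the basis, its class vector would be orthogonal to
  the whole basis. A dual vector of a short root shows that its coordinate does not vanish
  identically and that no second short root lies in the same class.\<close>

lemma basis_is_choice_basis:
  assumes S: "S \<subseteq> long_posroots_B r" and V: "Vb \<in> bases_B r" and VS: "Vb \<inter> long_posroots_B r = S"
  shows "\<exists>g\<in>PiE (class_reps r S) (class_of r S). Vb = choice_basis r S g"
proof -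
  let ?R = "class_reps r S"
  define B where "B = {i. i < r \<and> unitv i \<in> Vb}"
  have VB: "Vb = S \<union> unitv ` B"
    using bases_subset[OF V] VS by (auto simp: B_def posroots_eq short_posroots_eq)
  have ex: "\<exists>b\<in>B. b \<in> class_of r S \<rho>" if r: "\<rho> \<in> ?R" for \<rho>
  proof (rule ccontr)
    assume no: "\<not> (\<exists>b\<in>B. b \<in> class_of r S \<rho>)"
    have "class_vec r S \<rho> = (\<lambda>_. 0)"
    proof (rule bases_perp_trivial[OF V class_vec_inV], rule ballI)
      fix \<beta> assume "\<beta> \<in> Vb"
      then consider "\<beta> \<in> S" | b where "b \<in> B" "\<beta> = unitv b" using VB by blast
      then show "ip r \<beta> (class_vec r S \<rho>) = 0"
      proof cases
        case 1 then show ?thesis using class_vec_perp[OF S, of \<rho>] by (simp add: perp_def)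
      next
        case 2
        then have "b < r" by (simp add: B_def)
        moreover have "class_vec r S \<rho> b = 0"
          using no 2(1) \<open>b < r\<close> class_sign_nz[of b r S] by (auto simp: class_vec_def class_of_def)
        ultimately show ?thesis by (simp add: 2 ip_unitv_left)
      qed
    qed
    then have "class_vec r S \<rho> \<rho> = 0" by simp
    then show False using r class_sign_rep[OF r] by (simp add: class_vec_def class_reps_def)
  qed
  have dual: "\<exists>m\<in>perp r S. m b = 1 \<and> (\<forall>b'\<in>B. b' \<noteq> b \<longrightarrow> m b' = 0)" if b: "b \<in> B" for b
  proof -
    have bV: "unitv b \<in> Vb" using b by (simp add: B_def)
    obtain m where m: "inV r m" "\<And>\<gamma>. \<gamma> \<in> Vb \<Longrightarrow> ip r \<gamma> m = (if \<gamma> = unitv b then 1 else (0::real))"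
      using dual_vector_exists[OF V bV] by blast
    have "m \<in> perp r S"
      using m VB S unitv_notin_long[of b r] by (auto simp: perp_def)
    moreover have "m b' = (if b' = b then 1 else 0)" if "b' \<in> B" for b'
      using m(2)[of "unitv b'"] that by (auto simp: B_def ip_unitv_left)
    ultimately show ?thesis using b by (intro bexI[of _ m]) auto
  qed
  have nz: "b \<notin> perp_zeros r S" if bB: "b \<in> B" for b
  proof -
    obtain m where "m \<in> perp r S" "m b = 1" using dual[OF bB] by blast
    then have "\<not> (\<forall>x\<in>perp r S. x b = 0)" by force
    then show ?thesis by (auto simp: perp_zeros_def)
  qed
  have uniq: "b = b'" if bb: "b \<in> B" "b' \<in> B" "class_rep r S b = class_rep r S b'" for b b'
  proof (rule ccontr)
    assume ne: "b \<noteq> b'"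
    obtain m where m: "m \<in> perp r S" "m b = 1" "m b' = 0" using dual[OF bb(1)] bb(2) ne by metis
    have "m (class_rep r S b) \<noteq> 0" using perp_eq_sign[OF m(1), of b] m(2) by auto
    moreover have "class_sign r S b' \<noteq> 0" using class_sign_nz[of b' r S] nz[OF bb(2)] bb(2) by (simp add: B_def)
    ultimately have "m b' \<noteq> 0" using perp_eq_sign[OF m(1), of b'] bb(3) by simp
    then show False using m(3) by simp
  qed
  define g where "g = (\<lambda>\<rho>\<in>?R. SOME b. b \<in> B \<and> b \<in> class_of r S \<rho>)"
  have g: "g \<rho> \<in> B" "g \<rho> \<in> class_of r S \<rho>" if "\<rho> \<in> ?R" for \<rho>
  proof -
    have "\<exists>b. b \<in> B \<and> b \<in> class_of r S \<rho>" using ex[OF that] by blast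
    from someI_ex[OF this] show "g \<rho> \<in> B" "g \<rho> \<in> class_of r S \<rho>" using that by (auto simp: g_def)
  qed
  have gP: "g \<in> PiE ?R (class_of r S)" using g by (auto simp: g_def PiE_def extensional_def)
  have "B = g ` ?R"
  proof
    show "g ` ?R \<subseteq> B" using g by auto
    show "B \<subseteq> g ` ?R"
    proof
      fix b assume b: "b \<in> B"
      then have rep: "class_rep r S b \<in> ?R" using nz by (intro class_rep_in_reps) (auto simp: B_def)
      have "g (class_rep r S b) = b" by (rule uniq) (use g[OF rep] b in \<open>auto simp: class_of_def\<close>)
      then show "b \<in> g ` ?R" using rep by force
    qed
  qed
  then have "Vb = choice_basis r S g" using VB by (simp add: choice_basis_def)
  then show ?thesis using gP by blast
qed

lemma choice_basis_long:
  assumes "S \<subseteq> long_posroots_B r"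
  shows "choice_basis r S g \<inter> long_posroots_B r = S"
  using assms unitv_notin_long by (auto simp: choice_basis_def)

lemma choice_basis_short: 
  assumes "S \<subseteq> long_posroots_B r"
  shows "choice_basis r S g - long_posroots_B r = unitv ` g ` class_reps r S"
  using assms unitv_notin_long by (auto simp: choice_basis_def)

text \<open>S is recovered as the long part of the basis, and g from the short part, since every
  chosen coordinate remembers its class. The choices in different classes are independent.\<close>

lemma VA_bij:
  assumes nus: "set nus = long_posroots_B r"
  shows "bij_betw (\<lambda>(S, g). choice_basis r S g)
    (Sigma (nbc_sets r nus) (\<lambda>S. PiE (class_reps r S) (class_of r S))) (VA r nus)"
proof (rule bij_betw_imageI)
  have long: "S \<subseteq> long_posroots_B r" if "S \<in> nbc_sets r nus" for S using that by (auto simp: nbc_sets_def)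
  show "inj_on (\<lambda>(S, g). choice_basis r S g) (Sigma (nbc_sets r nus) (\<lambda>S. PiE (class_reps r S) (class_of r S)))"
  proof (rule inj_onI)
    fix p q assume p: "p \<in> Sigma (nbc_sets r nus) (\<lambda>S. PiE (class_reps r S) (class_of r S))"
      and q: "q \<in> Sigma (nbc_sets r nus) (\<lambda>S. PiE (class_reps r S) (class_of r S))"
      and pq: "(\<lambda>(S, g). choice_basis r S g) p = (\<lambda>(S, g). choice_basis r S g) q"
    obtain S g S' g' where pe: "p = (S, g)" "q = (S', g')" by (metis surj_pair)
    have S: "S \<in> nbc_sets r nus" "S' \<in> nbc_sets r nus"
      and g: "g \<in> PiE (class_reps r S) (class_of r S)" and g': "g' \<in> PiE (class_reps r S') (class_of r S')"
      and e: "choice_basis r S g = choice_basis r S' g'"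
      using p q pq unfolding pe by auto
    have SS: "S = S'" using choice_basis_long[OF long[OF S(1)], of g] choice_basis_long[OF long[OF S(2)], of g'] e by simp
    have "unitv ` g ` class_reps r S = unitv ` g' ` class_reps r S"
      using choice_basis_short[OF long[OF S(1)], of g] choice_basis_short[OF long[OF S(2)], of g'] e SS by simp
    then have im: "g ` class_reps r S = g' ` class_reps r S" by (simp only: inj_image_eq_iff[OF inj_unitv])
    have "g = g'"
    proof (rule PiE_ext[OF g g'[folded SS]])
      fix \<rho> assume r: "\<rho> \<in> class_reps r S"
      then obtain \<sigma> where s: "\<sigma> \<in> class_reps r S" "g \<rho> = g' \<sigma>" using im by blast
      then have "\<rho> = \<sigma>" using choice_less(3)[OF g r] choice_less(3)[OF g'[folded SS] s(1)] by simp
      then show "g \<rho> = g' \<rho>" using s by simp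
    qed
    then show "p = q" using SS pe by simp
  qed
  show "(\<lambda>(S, g). choice_basis r S g) ` (Sigma (nbc_sets r nus) (\<lambda>S. PiE (class_reps r S) (class_of r S))) = VA r nus"
  proof
    show "(\<lambda>(S, g). choice_basis r S g) ` (Sigma (nbc_sets r nus) (\<lambda>S. PiE (class_reps r S) (class_of r S))) \<subseteq> VA r nus"
      using choice_basis_basis[OF nus] choice_basis_long[OF long] by (auto simp: VA_iff[OF nus])
    show "VA r nus \<subseteq> (\<lambda>(S, g). choice_basis r S g) ` (Sigma (nbc_sets r nus) (\<lambda>S. PiE (class_reps r S) (class_of r S)))"
    proof
      fix Vb assume "Vb \<in> VA r nus"
      then have V: "Vb \<in> bases_B r" "Vb \<inter> long_posroots_B r \<in> nbc_sets r nus" using VA_iff[OF nus] by auto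
      obtain g where "g \<in> PiE (class_reps r (Vb \<inter> long_posroots_B r)) (class_of r (Vb \<inter> long_posroots_B r))"
        "Vb = choice_basis r (Vb \<inter> long_posroots_B r) g"
        using basis_is_choice_basis[OF long[OF V(2)] V(1) refl] by blast
      then show "Vb \<in> (\<lambda>(S, g). choice_basis r S g) ` (Sigma (nbc_sets r nus) (\<lambda>S. PiE (class_reps r S) (class_of r S)))"
        using V(2) by (intro image_eqI[of _ _ "(Vb \<inter> long_posroots_B r, g)"]) auto
    qed
  qed
qed

text \<open>A vector dual to a short root is orthogonal to S and to the other chosen coordinates, so
  it is a multiple of one class vector. The 1/2 is due to the coroot 2 e_i; it makes pairings with
  lattice points half-integral, so that modulo integers only 0 and 1/2 reach
  \<open>brace\<close>.\<close>

lemma mu_choice: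
  assumes nus: "set nus = long_posroots_B r" and S: "S \<in> nbc_sets r nus"
    and g: "g \<in> PiE (class_reps r S) (class_of r S)" and r: "\<rho> \<in> class_reps r S"
  shows "mu r (choice_basis r S g) (unitv (g \<rho>)) = (\<lambda>k. class_sign r S (g \<rho>) / 2 * class_vec r S \<rho> k)"
proof (rule mu_eqI[OF choice_basis_basis[OF nus S g]])
  have SA: "S \<subseteq> long_posroots_B r" using S by (auto simp: nbc_sets_def)
  show "inV r (\<lambda>k. class_sign r S (g \<rho>) / 2 * class_vec r S \<rho> k)"
    using class_vec_inV[of r S \<rho>] by (simp add: inV_def)
  fix \<gamma> assume "\<gamma> \<in> choice_basis r S g"
  then consider "\<gamma> \<in> S" | \<sigma> where "\<sigma> \<in> class_reps r S" "\<gamma> = unitv (g \<sigma>)" by (auto simp: choice_basis_def)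
  then show "ip r (coroot r \<gamma>) (\<lambda>k. class_sign r S (g \<rho>) / 2 * class_vec r S \<rho> k) = (if \<gamma> = unitv (g \<rho>) then 1 else 0)"
  proof cases
    case 1
    then have "ip r \<gamma> (class_vec r S \<rho>) = 0" using class_vec_perp[OF SA, of \<rho>] by (simp add: perp_def)
    moreover have "\<gamma> \<in> long_posroots_B r" "\<gamma> \<noteq> unitv (g \<rho>)" using 1 SA unitv_notin_long by auto
    ultimately show ?thesis by (simp only: coroot_long ip_scale_right if_False mult_zero_right)
  next
    case 2
    have "class_sign r S (g \<rho>) * class_sign r S (g \<rho>) = 1"
      using choice_less[OF g r] by (intro class_sign_square)
    moreover have "g \<sigma> = g \<rho> \<longleftrightarrow> \<sigma> = \<rho>" using choice_inj[OF g] 2(1) r by (auto dest: inj_onD)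
    ultimately show ?thesis using choice_less[OF g 2(1)] choice_less[OF g r]
      by (simp add: 2(2) coroot_unitv ip_scale_right ip_scale_left ip_unitv_left class_vec_choice[OF g r 2(1)])
  qed
qed

text \<open>The number of classes is the dimension of \<open>perp r S\<close>. It is found by
  counting one basis with long part S, the one in which each class chooses its
  representative.\<close>

lemma card_nbc_class_reps:
  assumes nus: "set nus = long_posroots_B r" and S: "S \<in> nbc_sets r nus"
  shows "card S + card (class_reps r S) = r"
proof -
  have SA: "S \<subseteq> long_posroots_B r" using S by (auto simp: nbc_sets_def)
  have fin: "finite S" using SA finite_long_posroots by (rule finite_subset)
  define g where "g = (\<lambda>\<rho>\<in>class_reps r S. \<rho>)"
  have g: "g \<in> PiE (class_reps r S) (class_of r S)" using rep_in_class_of by (auto simp: g_def)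
  have "card (choice_basis r S g) = r" using card_bases[OF choice_basis_basis[OF nus S g]] .
  moreover have "S \<inter> unitv ` g ` class_reps r S = {}" using SA unitv_notin_long by blast
  then have "card (choice_basis r S g) = card S + card (unitv ` g ` class_reps r S)"
    unfolding choice_basis_def using fin finite_class_reps[of r S] by (intro card_Un_disjoint) auto
  moreover have "card (unitv ` g ` class_reps r S) = card (class_reps r S)"
    using choice_inj[OF g] by (simp add: card_image inj_on_def)
  ultimately show ?thesis by simp
qed


section \<open>Averages over the coroot lattice\<close>

text \<open>The character (-1)^x of the integers; the floor makes it total on the reals, in which
  lattice vectors are written.\<close>

definition parity_sign :: "real \<Rightarrow> complex" where
  "parity_sign x = (if even \<lfloor>x\<rfloor> then 1 else -1)"

lemma parity_sign_of_int: "parity_sign (of_int n) = (if even n then 1 else -1)"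
  by (simp add: parity_sign_def)

lemma parity_sign_add:
  assumes "x \<in> \<int>" "y \<in> \<int>"
  shows "parity_sign (x + y) = parity_sign x * parity_sign y"
  using assms by (auto elim!: Ints_cases simp: parity_sign_of_int simp flip: of_int_add)

lemma parity_sign_sum:
  assumes "finite D" "\<And>i. i \<in> D \<Longrightarrow> f i \<in> \<int>"
  shows "parity_sign (\<Sum>i\<in>D. f i) = (\<Prod>i\<in>D. parity_sign (f i))"
  using assms
proof (induction D rule: finite_induct)
  case empty then show ?case by (simp add: parity_sign_def)
next
  case (insert x D)
  then have "(\<Sum>i\<in>D. f i) \<in> \<int>" by (intro Ints_sum) auto
  then show ?case using insert by (simp add: parity_sign_add)
qed

lemma coroot_simple_root:
  assumes "i \<in> {1..r}"
  shows "coroot r (simple_root r i) = (if i < r then (\<lambda>k. unitv (i - 1) k - unitv i k) else (\<lambda>k. 2 * unitv (r - 1) k))"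
proof (cases "i < r")
  case True
  then have "(\<lambda>k. unitv (i - 1) k + (-1) * unitv i k) \<in> long_posroots_B r"
    using assms unfolding long_posroots_B_def by (intro CollectI exI[of _ "i - 1"] exI[of _ i] exI[of _ "-1"]) auto
  then show ?thesis using True by (simp add: simple_root_def coroot_long)
next
  case False
  then show ?thesis using assms by (simp add: simple_root_def coroot_unitv)
qed

lemma coroot_lattice_add:
  assumes "p \<in> coroot_lattice r" "q \<in> coroot_lattice r"
  shows "(\<lambda>k. p k + q k) \<in> coroot_lattice r"
proof -
  obtain a b :: "nat \<Rightarrow> int" where ab: "p = (\<lambda>k. \<Sum>i\<in>{1..r}. of_int (a i) * coroot r (simple_root r i) k)"
     "q = (\<lambda>k. \<Sum>i\<in>{1..r}. of_int (b i) * coroot r (simple_root r i) k)"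
    using assms unfolding coroot_lattice_def by blast
  have "(\<lambda>k. p k + q k) = (\<lambda>k. \<Sum>i\<in>{1..r}. of_int (a i + b i) * coroot r (simple_root r i) k)"
    by (simp add: ab algebra_simps sum.distrib)
  then show ?thesis unfolding coroot_lattice_def by (intro CollectI exI[of _ "\<lambda>i. a i + b i"]) simp
qed

lemma coroot_lattice_minus:
  assumes "p \<in> coroot_lattice r"
  shows "(\<lambda>k. - p k) \<in> coroot_lattice r"
proof -
  obtain a :: "nat \<Rightarrow> int" where a: "p = (\<lambda>k. \<Sum>i\<in>{1..r}. of_int (a i) * coroot r (simple_root r i) k)"
    using assms unfolding coroot_lattice_def by blast
  have "(\<lambda>k. - p k) = (\<lambda>k. \<Sum>i\<in>{1..r}. of_int (- a i) * coroot r (simple_root r i) k)"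
    by (simp add: a sum_negf)
  then show ?thesis unfolding coroot_lattice_def by (intro CollectI exI[of _ "\<lambda>i. - a i"]) simp
qed

lemma coroot_lattice_diff:
  assumes "p \<in> coroot_lattice r" "q \<in> coroot_lattice r"
  shows "(\<lambda>k. p k - q k) \<in> coroot_lattice r"
  using coroot_lattice_add[OF assms(1) coroot_lattice_minus[OF assms(2)]] by simp

lemma coroot_lattice_zero: "(\<lambda>_. 0) \<in> coroot_lattice r"
  unfolding coroot_lattice_def by (intro CollectI exI[of _ "\<lambda>_. 0"]) simp

lemma coroot_lattice_simple:
  assumes "i \<in> {1..r}"
  shows "coroot r (simple_root r i) \<in> coroot_lattice r"
  unfolding coroot_lattice_def
  by (intro CollectI exI[of _ "\<lambda>j. if j = i then 1 else 0"])
     (use assms in \<open>auto simp: if_distrib[of of_int] if_distrib[of "\<lambda>t. t * _"] cong: if_cong\<close>)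

text \<open>Telescoping sum of simple coroots. These vectors serve as translations that change the
  parity of two coordinates only.\<close>

lemma unitv_diff_in_coroot_lattice:
  assumes "i < r" "j < r"
  shows "(\<lambda>k. unitv i k - unitv j k) \<in> coroot_lattice r"
proof -
  have up: "(\<lambda>k. unitv i k - unitv (i + n) k) \<in> coroot_lattice r" if "i + n < r" for i n
    using that
  proof (induction n)
    case 0 then show ?case using coroot_lattice_zero by simp
  next
    case (Suc n)
    have "(\<lambda>k. unitv (i + n) k - unitv (i + Suc n) k) \<in> coroot_lattice r"
      using coroot_lattice_simple[of "i + Suc n" r] coroot_simple_root[of "i + Suc n" r] Suc.prems by simp
    then have "(\<lambda>k. (unitv i k - unitv (i + n) k) + (unitv (i + n) k - unitv (i + Suc n) k)) \<in> coroot_lattice r"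
      using Suc by (intro coroot_lattice_add) auto
    then show ?case by simp
  qed
  show ?thesis
  proof (cases "i \<le> j")
    case True then show ?thesis using up[of i "j - i"] assms by simp
  next
    case False
    then show ?thesis using coroot_lattice_minus[OF up[of j "i - j"]] assms by simp
  qed
qed

text \<open>Inclusion of the coroot lattice in the integral vectors of even coordinate sum. The even
  sum makes the product of all class parities trivial when no coordinate vanishes
  identically.\<close>

lemma coroot_lattice_props:
  assumes "q \<in> coroot_lattice r"
  shows "inV r q \<and> (\<forall>k. q k \<in> \<int>) \<and> (\<exists>n. (\<Sum>k<r. q k) = of_int (2 * n))"
proof -
  obtain a :: "nat \<Rightarrow> int" where q: "q = (\<lambda>k. \<Sum>i\<in>{1..r}. of_int (a i) * coroot r (simple_root r i) k)"
    using assms unfolding coroot_lattice_def by blast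
  have c: "coroot r (simple_root r i) k = of_int (if i < r then (if k = i - 1 then 1 else 0) - (if k = i then 1 else 0)
       else (if k = r - 1 then 2 else 0))" if "i \<in> {1..r}" for i k
    using coroot_simple_root[OF that] by (auto simp: unitv_def)
  have Z: "q k \<in> \<int>" for k unfolding q by (intro Ints_sum Ints_mult) (auto simp: c)
  have V: "inV r q" unfolding inV_def q
  proof safe
    fix k assume k: "r \<le> k"
    show "(\<Sum>i\<in>{1..r}. of_int (a i) * coroot r (simple_root r i) k) = 0"
      by (rule sum.neutral) (use k in \<open>auto simp: c\<close>)
  qed
  have s: "(\<Sum>k<r. coroot r (simple_root r i) k) = (if i < r then 0 else 2)" if i: "i \<in> {1..r}" for i
  proof -
    have u: "(\<Sum>k<r. unitv j k) = 1" if "j < r" for j using that by (simp add: unitv_def)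
    show ?thesis
    proof (cases "i < r")
      case True
      then show ?thesis using i by (simp add: coroot_simple_root[OF i] sum_subtractf u)
    next
      case False
      then have "coroot r (simple_root r i) = (\<lambda>k. 2 * unitv (r - 1) k)" by (simp add: coroot_simple_root[OF i])
      moreover have "(\<Sum>k<r. 2 * unitv (r - 1) k) = 2 * (\<Sum>k<r. unitv (r - 1) k)" by (simp only: sum_distrib_left)
      ultimately show ?thesis using i False u[of "r - 1"] by simp
    qed
  qed
  have "(\<Sum>k<r. q k) = (\<Sum>i\<in>{1..r}. of_int (a i) * (\<Sum>k<r. coroot r (simple_root r i) k))"
    unfolding q by (subst sum.swap) (simp add: sum_distrib_left)
  also have "\<dots> = (\<Sum>i\<in>{1..r}. of_int (a i) * (if i < r then 0 else 2))"
    by (rule sum.cong) (auto simp: s)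
  also have "\<dots> = of_int (2 * (\<Sum>i\<in>{1..r}. a i * (if i < r then 0 else 1)))"
    by (simp add: sum_distrib_left) (rule sum.cong, auto)
  finally show ?thesis using V Z by blast
qed

lemma coroot_lattice_Ints: "q \<in> coroot_lattice r \<Longrightarrow> q k \<in> \<int>"
  using coroot_lattice_props by blast

lemma Lcoroots_zero: "(\<lambda>_. 0) \<in> Lcoroots r Vb"
  unfolding Lcoroots_def by (intro CollectI exI[of _ "\<lambda>_. 0"]) simp

lemma Lcoroots_add:
  assumes "p \<in> Lcoroots r Vb" "q \<in> Lcoroots r Vb"
  shows "(\<lambda>k. p k + q k) \<in> Lcoroots r Vb"
proof -
  obtain a b :: "(nat \<Rightarrow> real) \<Rightarrow> int" where ab: "p = (\<lambda>k. \<Sum>\<beta>\<in>Vb. of_int (a \<beta>) * coroot r \<beta> k)"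
     "q = (\<lambda>k. \<Sum>\<beta>\<in>Vb. of_int (b \<beta>) * coroot r \<beta> k)"
    using assms unfolding Lcoroots_def by blast
  have "(\<lambda>k. p k + q k) = (\<lambda>k. \<Sum>\<beta>\<in>Vb. of_int (a \<beta> + b \<beta>) * coroot r \<beta> k)"
    by (simp add: ab algebra_simps sum.distrib)
  then show ?thesis unfolding Lcoroots_def by (intro CollectI exI[of _ "\<lambda>i. a i + b i"]) simp
qed

lemma Lcoroots_minus:
  assumes "p \<in> Lcoroots r Vb"
  shows "(\<lambda>k. - p k) \<in> Lcoroots r Vb"
proof -
  obtain a :: "(nat \<Rightarrow> real) \<Rightarrow> int" where a: "p = (\<lambda>k. \<Sum>\<beta>\<in>Vb. of_int (a \<beta>) * coroot r \<beta> k)"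
    using assms unfolding Lcoroots_def by blast
  have "(\<lambda>k. - p k) = (\<lambda>k. \<Sum>\<beta>\<in>Vb. of_int (- a \<beta>) * coroot r \<beta> k)"
    by (simp add: a sum_negf)
  then show ?thesis unfolding Lcoroots_def by (intro CollectI exI[of _ "\<lambda>i. - a i"]) simp
qed

definition lattice_rel :: "nat \<Rightarrow> (nat \<Rightarrow> real) set \<Rightarrow> ((nat \<Rightarrow> real) \<times> (nat \<Rightarrow> real)) set" where
  "lattice_rel r Vb = {(p, q). p \<in> coroot_lattice r \<and> q \<in> coroot_lattice r \<and> (\<lambda>k. p k - q k) \<in> Lcoroots r Vb}"

lemma Qclasses_eq: "Qclasses r Vb = coroot_lattice r // lattice_rel r Vb"
  by (simp add: Qclasses_def lattice_rel_def)

lemma equiv_lattice_rel: "equiv (coroot_lattice r) (lattice_rel r Vb)"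
proof (rule equivI)
  show "lattice_rel r Vb \<subseteq> coroot_lattice r \<times> coroot_lattice r" by (auto simp: lattice_rel_def)
  show "refl_on (coroot_lattice r) (lattice_rel r Vb)"
    using Lcoroots_zero by (auto simp: refl_on_def lattice_rel_def)
  show "sym (lattice_rel r Vb)"
  proof (rule symI)
    fix p q assume "(p, q) \<in> lattice_rel r Vb"
    then show "(q, p) \<in> lattice_rel r Vb" using Lcoroots_minus[of "\<lambda>k. p k - q k" r Vb] by (auto simp: lattice_rel_def)
  qed
  show "trans (lattice_rel r Vb)"
  proof (rule transI)
    fix p q s assume "(p, q) \<in> lattice_rel r Vb" "(q, s) \<in> lattice_rel r Vb"
    then show "(p, s) \<in> lattice_rel r Vb"
      using Lcoroots_add[of "\<lambda>k. p k - q k" r Vb "\<lambda>k. q k - s k"] by (auto simp: lattice_rel_def)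
  qed
qed

text \<open>\<open>Fgen\<close> evaluates its summands at representatives picked by
  \<open>SOME\<close>; these facts are all that is known about them.\<close>

lemma Qclasses_rep:
  assumes "X \<in> Qclasses r Vb"
  shows "(SOME q. q \<in> X) \<in> X" "(SOME q. q \<in> X) \<in> coroot_lattice r"
    "X = lattice_rel r Vb `` {SOME q. q \<in> X}"
proof -
  have X: "X \<in> coroot_lattice r // lattice_rel r Vb" using assms by (simp add: Qclasses_eq)
  have "X \<noteq> {}" using in_quotient_imp_non_empty[OF equiv_lattice_rel X] .
  then show 1: "(SOME q. q \<in> X) \<in> X" by (simp add: some_in_eq)
  then show 2: "(SOME q. q \<in> X) \<in> coroot_lattice r" using in_quotient_imp_subset[OF equiv_lattice_rel X] by blast
  obtain p where p: "X = lattice_rel r Vb `` {p}" "p \<in> coroot_lattice r" using X by (rule quotientE)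
  then show "X = lattice_rel r Vb `` {SOME q. q \<in> X}"
    using 1 equiv_class_eq[OF equiv_lattice_rel] by (metis Image_singleton_iff)
qed

lemma Qclasses_class:
  assumes "q \<in> coroot_lattice r"
  shows "lattice_rel r Vb `` {q} \<in> Qclasses r Vb"
    "(q, SOME p. p \<in> lattice_rel r Vb `` {q}) \<in> lattice_rel r Vb"
proof -
  show 1: "lattice_rel r Vb `` {q} \<in> Qclasses r Vb" using assms by (auto simp: Qclasses_eq intro: quotientI)
  show "(q, SOME p. p \<in> lattice_rel r Vb `` {q}) \<in> lattice_rel r Vb"
    using Qclasses_rep(1)[OF 1] by blast
qed

text \<open>Finiteness is the point: an infinite quotient would have \<open>card\<close> 0 and the
  average in \<open>Fgen\<close> would degenerate. The index itself is not computed, as it cancels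
  in the average.\<close>

lemma Qclasses_card_pos:
  assumes V: "Vb \<in> bases_B r"
  shows "0 < card (Qclasses r Vb)"
proof -
  have cInts: "coroot r \<beta> k \<in> \<int>" "\<bar>coroot r \<beta> k\<bar> \<le> 2" "inV r (coroot r \<beta>)" if b: "\<beta> \<in> Vb" for \<beta> k
  proof -
    have "\<beta> \<in> posroots_B r" using b bases_subset[OF V] by blast
    then consider "\<beta> \<in> long_posroots_B r" | i where "i < r" "\<beta> = unitv i" by (auto simp: posroots_eq short_posroots_eq)
    then have "coroot r \<beta> k \<in> \<int> \<and> \<bar>coroot r \<beta> k\<bar> \<le> 2 \<and> inV r (coroot r \<beta>)"
    proof cases
      case 1
      then obtain i j \<sigma> where "\<beta> = (\<lambda>k. unitv i k + \<sigma> * unitv j k)" "i < j" "j < r" "\<sigma> \<in> {1, -1}"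
        by (rule long_posroots_cases)
      then show ?thesis using coroot_long[OF 1] by (auto simp: unitv_def inV_def)
    next
      case 2
      then have "coroot r \<beta> = (\<lambda>k. 2 * unitv i k)" by (simp add: coroot_unitv)
      then show ?thesis using 2(1) by (auto simp: unitv_def inV_def)
    qed
    then show "coroot r \<beta> k \<in> \<int>" "\<bar>coroot r \<beta> k\<bar> \<le> 2" "inV r (coroot r \<beta>)" by auto
  qed
  have ex: "\<exists>c. q = (\<lambda>k. \<Sum>\<beta>\<in>Vb. c \<beta> * coroot r \<beta> k)" if "q \<in> coroot_lattice r" for q
  proof -
    have "inV r q" using coroot_lattice_props[OF that] by blast
    then obtain d where d: "q = (\<lambda>k. \<Sum>\<beta>\<in>Vb. d \<beta> * \<beta> k)"
      using bases_span[OF V] unfolding lin_hull_def by blast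
    have dc: "d \<beta> * \<beta> k = (d \<beta> * ip r \<beta> \<beta> / 2) * coroot r \<beta> k" if b: "\<beta> \<in> Vb" for \<beta> k
    proof -
      have "ip r \<beta> \<beta> \<noteq> 0"
      proof
        assume z: "ip r \<beta> \<beta> = 0"
        obtain m where m: "inV r m" "\<And>\<gamma>. \<gamma> \<in> Vb \<Longrightarrow> ip r \<gamma> m = (if \<gamma> = \<beta> then 1 else (0::real))"
          using dual_vector_exists[OF V b] by blast
        have "ip r \<beta> m = 0" using ip_self_eq_0[OF z] by (simp add: ip_def)
        then show False using m(2)[OF b] by simp
      qed
      then show ?thesis by (simp add: coroot_def)
    qed
    then have "q = (\<lambda>k. \<Sum>\<beta>\<in>Vb. (d \<beta> * ip r \<beta> \<beta> / 2) * coroot r \<beta> k)" unfolding d by (intro ext sum.cong refl dc)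
    then show ?thesis by (rule exI[of _ "\<lambda>\<beta>. d \<beta> * ip r \<beta> \<beta> / 2"])
  qed
  define C where "C q = (SOME c. q = (\<lambda>k. \<Sum>\<beta>\<in>Vb. c \<beta> * coroot r \<beta> k))" for q
  have C: "q = (\<lambda>k. \<Sum>\<beta>\<in>Vb. C q \<beta> * coroot r \<beta> k)" if "q \<in> coroot_lattice r" for q
    using someI_ex[OF ex[OF that]] unfolding C_def .
  \<comment> \<open>Keeping the fractional parts of the coordinates changes \<open>q\<close> by an
    element of \<open>Lcoroots r Vb\<close> only.\<close>
  define F where "F q = (\<lambda>k. \<Sum>\<beta>\<in>Vb. frac (C q \<beta>) * coroot r \<beta> k)" for q
  have qF: "q k - F q k = (\<Sum>\<beta>\<in>Vb. of_int \<lfloor>C q \<beta>\<rfloor> * coroot r \<beta> k)" if "q \<in> coroot_lattice r" for q k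
  proof -
    have "q k = (\<Sum>\<beta>\<in>Vb. C q \<beta> * coroot r \<beta> k)" using fun_cong[OF C[OF that], of k] .
    then show ?thesis by (simp add: F_def frac_def left_diff_distrib sum_subtractf)
  qed
  have qFL: "(\<lambda>k. q k - F q k) \<in> Lcoroots r Vb" if "q \<in> coroot_lattice r" for q
    unfolding qF[OF that] Lcoroots_def by (intro CollectI exI[of _ "\<lambda>\<beta>. \<lfloor>C q \<beta>\<rfloor>"]) simp
  \<comment> \<open>Coroot coordinates are at most 2 in absolute value and fractional parts are
    below 1, so each basis element adds at most 2.\<close>
  let ?M = "2 * int (card Vb)"
  let ?B = "{f. \<forall>k. (k \<in> {..<r} \<longrightarrow> f k \<in> real_of_int ` {- ?M..?M}) \<and> (k \<notin> {..<r} \<longrightarrow> f k = 0)}"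
  have finB: "finite ?B" by (rule finite_set_of_finite_funs) auto
  have FB: "F q \<in> ?B" if q: "q \<in> coroot_lattice r" for q
  proof -
    have "F q k \<in> real_of_int ` {- ?M..?M}" for k
    proof -
      have "q k - F q k \<in> \<int>" unfolding qF[OF q] by (intro Ints_sum Ints_mult) (auto simp: cInts)
      from Ints_diff[OF coroot_lattice_Ints[OF q, of k] this] have "F q k \<in> \<int>" by simp
      then obtain n where n: "F q k = of_int n" by (auto elim: Ints_cases)
      have "\<bar>F q k\<bar> \<le> (\<Sum>\<beta>\<in>Vb. \<bar>frac (C q \<beta>) * coroot r \<beta> k\<bar>)" unfolding F_def by (rule sum_abs)
      also have "\<dots> \<le> (\<Sum>\<beta>\<in>Vb. 2)"
      proof (rule sum_mono)
        fix \<beta> assume "\<beta> \<in> Vb"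
        then have "\<bar>frac (C q \<beta>)\<bar> * \<bar>coroot r \<beta> k\<bar> \<le> 1 * 2"
          using cInts(2) frac_lt_1[of "C q \<beta>"] by (intro mult_mono) (auto simp: less_imp_le)
        then show "\<bar>frac (C q \<beta>) * coroot r \<beta> k\<bar> \<le> 2" by (simp add: abs_mult)
      qed
      finally have "\<bar>real_of_int n\<bar> \<le> real_of_int ?M" unfolding n by simp
      then have "\<bar>n\<bar> \<le> ?M" by linarith
      then show ?thesis unfolding n by (intro imageI) auto
    qed
    moreover have "F q k = 0" if "r \<le> k" for k
      unfolding F_def using that cInts(3) by (intro sum.neutral) (auto simp: inV_def)
    ultimately show ?thesis by auto
  qed
  txt \<open>A class is determined by an integral point in the bounded fundamental box of \<open>Vb\<close>.\<close>
  have "inj_on (\<lambda>X. F (SOME q. q \<in> X)) (Qclasses r Vb)"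
  proof (rule inj_onI)
    fix X Y assume X: "X \<in> Qclasses r Vb" and Y: "Y \<in> Qclasses r Vb"
      and e: "F (SOME q. q \<in> X) = F (SOME q. q \<in> Y)"
    let ?x = "SOME q. q \<in> X" and ?y = "SOME q. q \<in> Y"
    have "(\<lambda>k. (?x k - F ?x k) + - (?y k - F ?y k)) \<in> Lcoroots r Vb"
      by (intro Lcoroots_add Lcoroots_minus qFL Qclasses_rep(2)[OF X] Qclasses_rep(2)[OF Y])
    then have "(?x, ?y) \<in> lattice_rel r Vb"
      using e Qclasses_rep(2)[OF X] Qclasses_rep(2)[OF Y] by (simp add: lattice_rel_def)
    then have "lattice_rel r Vb `` {?x} = lattice_rel r Vb `` {?y}" using equiv_class_eq[OF equiv_lattice_rel] by blast
    then show "X = Y" using Qclasses_rep(3)[OF X] Qclasses_rep(3)[OF Y] by simp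
  qed
  moreover have "(\<lambda>X. F (SOME q. q \<in> X)) ` Qclasses r Vb \<subseteq> ?B"
    using FB Qclasses_rep(2) by blast
  ultimately have "finite (Qclasses r Vb)" using finB inj_on_finite by blast
  moreover have "Qclasses r Vb \<noteq> {}" using Qclasses_class(1)[OF coroot_lattice_zero] by blast
  ultimately show ?thesis by (simp add: card_gt_0_iff)
qed

lemma lattice_rel_shift:
  assumes "(p, \<lambda>k. q k + q0 k) \<in> lattice_rel r Vb" "q \<in> coroot_lattice r" "q0 \<in> coroot_lattice r"
  shows "(\<lambda>k. p k - q0 k, q) \<in> lattice_rel r Vb"
proof -
  have "(\<lambda>k. p k - (q k + q0 k)) = (\<lambda>k. (p k - q0 k) - q k)" by (simp add: algebra_simps)
  then show ?thesis using assms coroot_lattice_diff[of p r q0] by (simp add: lattice_rel_def)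
qed

text \<open>Orthogonality of characters in the form used here: translation by \<open>q0\<close>
  permutes the classes and negates the summand, so the sum equals its negative.\<close>

lemma Qclasses_sum_alternating:
  fixes f :: "(nat \<Rightarrow> real) \<Rightarrow> complex"
  assumes inv: "\<And>p q. (p, q) \<in> lattice_rel r Vb \<Longrightarrow> f p = f q"
    and q0: "q0 \<in> coroot_lattice r"
    and alt: "\<And>q. q \<in> coroot_lattice r \<Longrightarrow> f (\<lambda>k. q k + q0 k) = - f q"
  shows "(\<Sum>X\<in>Qclasses r Vb. f (SOME q. q \<in> X)) = 0"
proof -
  let ?s = "\<lambda>X :: (nat \<Rightarrow> real) set. SOME q. q \<in> X"
  let ?T = "\<lambda>X. lattice_rel r Vb `` {\<lambda>k. ?s X k + q0 k}"
  let ?U = "\<lambda>X. lattice_rel r Vb `` {\<lambda>k. ?s X k - q0 k}"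
  have T: "?T X \<in> Qclasses r Vb" "((\<lambda>k. ?s X k + q0 k), ?s (?T X)) \<in> lattice_rel r Vb" if "X \<in> Qclasses r Vb" for X
    using Qclasses_class[OF coroot_lattice_add[OF Qclasses_rep(2)[OF that] q0], of Vb] by auto
  have U: "?U X \<in> Qclasses r Vb" "((\<lambda>k. ?s X k - q0 k), ?s (?U X)) \<in> lattice_rel r Vb" if "X \<in> Qclasses r Vb" for X
    using Qclasses_class[OF coroot_lattice_diff[OF Qclasses_rep(2)[OF that] q0], of Vb] by auto
  have cls: "X = Y" if "X \<in> Qclasses r Vb" "Y \<in> Qclasses r Vb" "(?s X, ?s Y) \<in> lattice_rel r Vb" for X Y
    using equiv_class_eq[OF equiv_lattice_rel that(3)] Qclasses_rep(3)[OF that(1)] Qclasses_rep(3)[OF that(2)] by simp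
  have sym: "(p, q) \<in> lattice_rel r Vb \<Longrightarrow> (q, p) \<in> lattice_rel r Vb" for p q
    using equiv_lattice_rel[of r Vb] by (auto simp: equiv_def dest: symD)
  have tr: "(p, q) \<in> lattice_rel r Vb \<Longrightarrow> (q, u) \<in> lattice_rel r Vb \<Longrightarrow> (p, u) \<in> lattice_rel r Vb" for p q u
    using equiv_lattice_rel[of r Vb] by (auto simp: equiv_def dest: transD)
  have UT: "?U (?T X) = X" if X: "X \<in> Qclasses r Vb" for X
  proof (rule cls[OF U(1)[OF T(1)[OF X]] X])
    have "((\<lambda>k. ?s (?T X) k - q0 k), ?s X) \<in> lattice_rel r Vb"
      by (rule lattice_rel_shift[OF sym[OF T(2)[OF X]] Qclasses_rep(2)[OF X] q0])
    then show "(?s (?U (?T X)), ?s X) \<in> lattice_rel r Vb" using tr[OF sym[OF U(2)[OF T(1)[OF X]]]] by blast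
  qed
  have TU: "?T (?U X) = X" if X: "X \<in> Qclasses r Vb" for X
  proof (rule cls[OF T(1)[OF U(1)[OF X]] X])
    have "((\<lambda>k. ?s (?U X) k + q0 k), ?s X) \<in> lattice_rel r Vb"
      using lattice_rel_shift[of _ _ "\<lambda>k. - q0 k", OF _ Qclasses_rep(2)[OF X] coroot_lattice_minus[OF q0]] sym[OF U(2)[OF X]]
      by simp
    then show "(?s (?T (?U X)), ?s X) \<in> lattice_rel r Vb" using tr[OF sym[OF T(2)[OF U(1)[OF X]]]] by blast
  qed
  have "(\<Sum>X\<in>Qclasses r Vb. - f (?s X)) = (\<Sum>X\<in>Qclasses r Vb. f (?s X))"
  proof (rule sum.reindex_bij_witness[where j = ?T and i = ?U])
    fix X assume X: "X \<in> Qclasses r Vb"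
    show "f (?s (?T X)) = - f (?s X)"
      using inv[OF T(2)[OF X]] alt[OF Qclasses_rep(2)[OF X]] by simp
  qed (use UT TU T(1) U(1) in blast)+
  then show ?thesis by (simp add: sum_negf)
qed


section \<open>Bernoulli-type factors and the lattice average\<close>

definition half_bern :: "complex \<Rightarrow> complex" where
  "half_bern z = (z / 2) / (exp (z / 2) - 1)"

definition odd_bern :: "complex \<Rightarrow> complex" where
  "odd_bern z = z / (exp z - 1) - half_bern z"

text \<open>The right-hand sides are the values of z exp(x z)/(exp z - 1) at x = 0 and x = 1/2, the
  only fractional parts that occur. So \<open>half_bern\<close> is their mean and
  \<open>odd_bern\<close> half their difference. With u = exp(z/2) this is u^2 - 1 = (u - 1)(u +
  1).\<close>

lemma half_odd_bern:
  assumes "exp z \<noteq> 1"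
  shows "half_bern z + odd_bern z = z / (exp z - 1)"
    and "half_bern z - odd_bern z = z * exp (z / 2) / (exp z - 1)"
proof -
  show "half_bern z + odd_bern z = z / (exp z - 1)" by (simp add: odd_bern_def)
  define u where "u = exp (z / 2)"
  have e: "exp z = u * u" by (simp add: u_def exp_add[symmetric])
  have n1: "u - 1 \<noteq> 0" "u + 1 \<noteq> 0"
  proof -
    show "u - 1 \<noteq> 0" using assms e by auto
    show "u + 1 \<noteq> 0"
    proof
      assume "u + 1 = 0"
      then have "u = - 1" by (simp add: eq_neg_iff_add_eq_0)
      then show False using assms e by simp
    qed
  qed
  have f: "u * u - 1 = (u - 1) * (u + 1)" by (simp add: algebra_simps)
  have "half_bern z - odd_bern z = 2 * (z / 2 / (u - 1)) - z / (u * u - 1)"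
    by (simp add: odd_bern_def half_bern_def u_def e[unfolded u_def])
  also have "2 * (z / 2 / (u - 1)) = (2 * (z / 2)) / (u - 1)" by (rule times_divide_eq_right)
  also have "2 * (z / 2) = z" by simp
  also have "z / (u - 1) - z / (u * u - 1) = z / (u - 1) - z / ((u - 1) * (u + 1))" unfolding f ..
  also have "z / (u - 1) = z * (u + 1) / ((u - 1) * (u + 1))" using n1 by simp
  also have "z * (u + 1) / ((u - 1) * (u + 1)) - z / ((u - 1) * (u + 1)) = z * u / ((u - 1) * (u + 1))"
    by (simp add: algebra_simps flip: diff_divide_distrib)
  finally show "half_bern z - odd_bern z = z * exp (z / 2) / (exp z - 1)"
    by (simp add: u_def[symmetric] e f)
qed

lemma parity_sign_sign:
  assumes "x \<in> \<int>" "s \<in> {1, -1}"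
  shows "parity_sign (s * x) = parity_sign x"
  using assms by (auto elim!: Ints_cases simp: parity_sign_of_int simp flip: of_int_minus)

text \<open>Twice the pairing is a signed sum of the coordinates of \<open>q\<close> over one class,
  and signs do not affect parity.\<close>

lemma ip_mu_choice_parity:
  assumes nus: "set nus = long_posroots_B r" and S: "S \<in> nbc_sets r nus"
    and g: "g \<in> PiE (class_reps r S) (class_of r S)" and r: "\<rho> \<in> class_reps r S"
    and q: "\<And>k. q k \<in> \<int>"
  shows "2 * ip r q (mu r (choice_basis r S g) (unitv (g \<rho>))) \<in> \<int> \<and>
    parity_sign (2 * ip r q (mu r (choice_basis r S g) (unitv (g \<rho>)))) = parity_sign (\<Sum>k\<in>class_of r S \<rho>. q k)"
proof -
  let ?s = "class_sign r S"
  have pm: "?s k \<in> {1, -1}" if "k \<in> class_of r S \<sigma>" for k \<sigma>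
  proof -
    have "?s k \<noteq> 0" using class_sign_nz[of k r S] that by (simp add: class_of_def)
    then show ?thesis using class_sign_in[of r S k] by simp
  qed
  have sg: "?s (g \<rho>) * ?s k \<in> {1, -1}" if "k \<in> class_of r S \<rho>" for k
    using pm[OF that] pm[OF choice_less(4)[OF g r]] by (elim insertE) simp_all
  have "2 * ip r q (mu r (choice_basis r S g) (unitv (g \<rho>))) = ?s (g \<rho>) * ip r q (class_vec r S \<rho>)"
    unfolding mu_choice[OF nus S g r] ip_scale_right by simp
  also have "ip r q (class_vec r S \<rho>) = (\<Sum>k\<in>class_of r S \<rho>. q k * ?s k)"
    unfolding ip_def
  proof (rule sum.mono_neutral_cong_right)
    show "\<forall>k\<in>{..<r} - class_of r S \<rho>. q k * class_vec r S \<rho> k = 0"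
      using class_sign_nz[of _ r S] by (auto simp: class_vec_def class_of_def)
  qed (auto simp: class_of_def class_vec_def)
  also have "?s (g \<rho>) * \<dots> = (\<Sum>k\<in>class_of r S \<rho>. (?s (g \<rho>) * ?s k) * q k)"
    by (simp add: sum_distrib_left mult_ac)
  finally have e: "2 * ip r q (mu r (choice_basis r S g) (unitv (g \<rho>))) = (\<Sum>k\<in>class_of r S \<rho>. (?s (g \<rho>) * ?s k) * q k)" .
  have Z: "(?s (g \<rho>) * ?s k) * q k \<in> \<int>" if "k \<in> class_of r S \<rho>" for k
    using sg[OF that] q[of k] by (elim insertE) (simp_all add: Ints_minus)
  have "parity_sign (\<Sum>k\<in>class_of r S \<rho>. (?s (g \<rho>) * ?s k) * q k) = (\<Prod>k\<in>class_of r S \<rho>. parity_sign ((?s (g \<rho>) * ?s k) * q k))"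
    by (rule parity_sign_sum[OF finite_class_of Z])
  also have "\<dots> = (\<Prod>k\<in>class_of r S \<rho>. parity_sign (q k))"
    by (rule prod.cong[OF refl]) (rule parity_sign_sign[OF q sg])
  also have "\<dots> = parity_sign (\<Sum>k\<in>class_of r S \<rho>. q k)"
    by (rule parity_sign_sum[symmetric, OF finite_class_of q])
  finally have "parity_sign (\<Sum>k\<in>class_of r S \<rho>. (?s (g \<rho>) * ?s k) * q k) = parity_sign (\<Sum>k\<in>class_of r S \<rho>. q k)" .
  moreover have "(\<Sum>k\<in>class_of r S \<rho>. (?s (g \<rho>) * ?s k) * q k) \<in> \<int>" by (rule Ints_sum[OF Z])
  ultimately show ?thesis unfolding e by blast
qed

text \<open>At a lattice point the brace is 1/2 if the class sum is odd; if it is even, the brace is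
  0 or 1 according to the branch selected by \<phi>. Replacing \<tau> by -\<tau> exchanges the
  values for 0 and 1 and fixes the value for 1/2, so passing to \<open>v\<close> makes the formula
  the same on both branches.\<close>

lemma brace_term:
  assumes nus: "set nus = long_posroots_B r" and S: "S \<in> nbc_sets r nus"
    and g: "g \<in> PiE (class_reps r S) (class_of r S)" and r: "\<rho> \<in> class_reps r S"
    and q: "\<And>k. q k \<in> \<int>" and e1: "exp \<tau> \<noteq> (1 :: complex)"
    and v: "v = (if ip r \<phi> (mu r (choice_basis r S g) (unitv (g \<rho>))) > 0 then \<tau> else - \<tau>)"
  shows "\<tau> * exp (\<tau> * of_real (brace r \<phi> (choice_basis r S g) q (unitv (g \<rho>)))) / (exp \<tau> - 1) =
    half_bern v + parity_sign (\<Sum>k\<in>class_of r S \<rho>. q k) * odd_bern v"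
proof -
  define x where "x = ip r q (mu r (choice_basis r S g) (unitv (g \<rho>)))"
  have x: "2 * x \<in> \<int>" "parity_sign (2 * x) = parity_sign (\<Sum>k\<in>class_of r S \<rho>. q k)"
    using ip_mu_choice_parity[OF nus S g r q] by (auto simp: x_def)
  then obtain m where m: "2 * x = of_int m" by (auto elim: Ints_cases)
  define p where "p = ip r \<phi> (mu r (choice_basis r S g) (unitv (g \<rho>)))"
  have br: "brace r \<phi> (choice_basis r S g) q (unitv (g \<rho>)) = (if p > 0 then frac x else 1 - frac (- x))"
    by (simp add: brace_def x_def p_def)
  have v': "v = (if p > 0 then \<tau> else - \<tau>)" using v by (simp add: p_def)
  have ev: "exp v \<noteq> 1" using e1 by (auto simp: v' exp_minus)
  have em: "\<tau> * exp \<tau> / (exp \<tau> - 1) = (- \<tau>) / (exp (- \<tau>) - 1)"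
    using e1 by (simp add: exp_minus divide_simps) (simp add: algebra_simps)
  have eh: "\<tau> * exp (\<tau> / 2) / (exp \<tau> - 1) = (- \<tau>) * exp (- \<tau> / 2) / (exp (- \<tau>) - 1)"
  proof -
    define u where "u = exp (\<tau> / 2)"
    have u: "exp \<tau> = u * u" "u \<noteq> 0" by (simp_all add: u_def exp_add[symmetric])
    have mi: "exp (- \<tau> / 2) = 1 / u" "exp (- \<tau>) = 1 / (u * u)"
      using u by (simp_all add: u_def exp_minus inverse_eq_divide)
    have "u * u - 1 \<noteq> 0" "1 - u * u \<noteq> 0" using e1 u by auto
    then show ?thesis unfolding mi u(1) u_def[symmetric] using u(2) by (simp add: divide_simps) (simp add: algebra_simps)
  qed
  show ?thesis
  proof (cases "even m")
    case True
    then obtain j where "m = 2 * j" by (auto elim: evenE)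
    then have xj: "x = of_int j" using m by simp
    have ps: "parity_sign (\<Sum>k\<in>class_of r S \<rho>. q k) = 1" using x(2) True m by (simp add: parity_sign_of_int)
    have "frac x = 0" "frac (- x) = 0" unfolding xj by simp_all
    then have b: "brace r \<phi> (choice_basis r S g) q (unitv (g \<rho>)) = (if p > 0 then 0 else 1)" unfolding br by simp
    show ?thesis
    proof (cases "p > 0")
      case True
      then show ?thesis unfolding b ps using half_odd_bern(1)[OF ev] by (simp add: v')
    next
      case False
      then show ?thesis unfolding b ps using half_odd_bern(1)[OF ev] em by (simp add: v')
    qed
  next
    case False
    then obtain j where "m = 2 * j + 1" by (auto elim: oddE)
    then have xj: "x = of_int j + 1 / 2" using m by simp
    have ps: "parity_sign (\<Sum>k\<in>class_of r S \<rho>. q k) = -1" using x(2) False m by (simp add: parity_sign_of_int)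
    have "frac x = 1 / 2" unfolding frac_unique_iff by (simp add: xj)
    moreover have "- x - 1 / 2 = of_int (- j - 1)" by (simp add: xj)
    then have "- x - 1 / 2 \<in> \<int>" by (metis Ints_of_int)
    then have "frac (- x) = 1 / 2" unfolding frac_unique_iff by simp
    ultimately have b: "brace r \<phi> (choice_basis r S g) q (unitv (g \<rho>)) = 1 / 2" unfolding br by simp
    have "\<tau> * exp (\<tau> * of_real (brace r \<phi> (choice_basis r S g) q (unitv (g \<rho>)))) / (exp \<tau> - 1) = \<tau> * exp (\<tau> / 2) / (exp \<tau> - 1)"
      unfolding b by simp
    also have "\<dots> = v * exp (v / 2) / (exp v - 1)" using eh by (simp add: v')
    also have "\<dots> = half_bern v - odd_bern v" by (rule half_odd_bern(2)[OF ev, symmetric])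
    finally show ?thesis unfolding ps by simp
  qed
qed

text \<open>Expanding the product over subsets D of R leaves averages of products of parities. These
  products are characters of the quotient, and the trivial ones belong to D empty and, if the
  classes cover all coordinates, to D = R.\<close>

lemma lattice_average:
  fixes \<alpha> \<gamma> :: "nat \<Rightarrow> complex"
  assumes nus: "set nus = long_posroots_B r" and S: "S \<in> nbc_sets r nus"
    and g: "g \<in> PiE (class_reps r S) (class_of r S)" and r0: "1 \<le> r"
  defines "Vb \<equiv> choice_basis r S g" and "R \<equiv> class_reps r S"
  shows "1 / of_nat (card (Qclasses r Vb)) *
     (\<Sum>X\<in>Qclasses r Vb. \<Prod>\<rho>\<in>R. \<alpha> \<rho> + parity_sign (\<Sum>k\<in>class_of r S \<rho>. (SOME q. q \<in> X) k) * \<gamma> \<rho>)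
   = (\<Prod>\<rho>\<in>R. \<alpha> \<rho>) + (if perp_zeros r S = {} then \<Prod>\<rho>\<in>R. \<gamma> \<rho> else 0)"
proof -
  have V: "Vb \<in> bases_B r" unfolding Vb_def by (rule choice_basis_basis[OF nus S g])
  have finR: "finite R" by (simp add: R_def finite_class_reps)
  let ?Q = "Qclasses r Vb"
  let ?s = "\<lambda>X :: (nat \<Rightarrow> real) set. SOME q. q \<in> X"
  define p where "p \<rho> q = parity_sign (\<Sum>k\<in>class_of r S \<rho>. q k)" for \<rho> and q :: "nat \<Rightarrow> real"
  have c0: "0 < card ?Q" by (rule Qclasses_card_pos[OF V])
  define e where "e D = (\<Sum>X\<in>?Q. \<Prod>\<rho>\<in>D. p \<rho> (?s X))" for D
  have padd: "p \<rho> (\<lambda>k. q k + q' k) = p \<rho> q * p \<rho> q'" if "\<And>k. q k \<in> \<int>" "\<And>k. q' k \<in> \<int>" for \<rho> q q'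
    unfolding p_def sum.distrib by (rule parity_sign_add) (auto intro!: Ints_sum that)
  \<comment> \<open>An element of \<open>Lcoroots r Vb\<close> pairs integrally with the dual
    vectors, so twice the pairing is even and parities are well defined on classes.\<close>
  have pinv: "p \<rho> q = p \<rho> q'" if rel: "(q, q') \<in> lattice_rel r Vb" and \<rho>: "\<rho> \<in> R" for \<rho> q q'
  proof -
    have q: "q \<in> coroot_lattice r" "q' \<in> coroot_lattice r" "(\<lambda>k. q k - q' k) \<in> Lcoroots r Vb"
      using rel by (auto simp: lattice_rel_def)
    let ?d = "\<lambda>k. q k - q' k"
    have dZ: "?d k \<in> \<int>" for k using coroot_lattice_Ints[OF q(1)] coroot_lattice_Ints[OF q(2)] by (intro Ints_diff)
    obtain c :: "(nat \<Rightarrow> real) \<Rightarrow> int" where c: "?d = (\<lambda>k. \<Sum>\<beta>\<in>Vb. of_int (c \<beta>) * coroot r \<beta> k)"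
      using q(3) unfolding Lcoroots_def by blast
    let ?b = "unitv (g \<rho>)"
    have bV: "?b \<in> Vb" using \<rho> by (auto simp: Vb_def R_def choice_basis_def)
    obtain m where m: "inV r m" "\<And>\<gamma>. \<gamma> \<in> Vb \<Longrightarrow> ip r \<gamma> m = (if \<gamma> = ?b then 1 else (0::real))"
      using dual_vector_exists[OF V bV] by blast
    have co: "ip r (coroot r \<gamma>) (\<lambda>k. m k / 2) = (if \<gamma> = ?b then 1 else 0)" if "\<gamma> \<in> Vb" for \<gamma>
    proof -
      have h: "(\<lambda>k. m k / 2) = (\<lambda>k. (1/2) * m k)" by simp
      have s2: "ip r ?b ?b = 1" using choice_less(1)[OF g, of \<rho>] \<rho> by (simp add: R_def ip_unitv_left) (simp add: unitv_def)
      show ?thesis unfolding h ip_scale_right coroot_def ip_scale_left using m(2)[OF that] s2 by auto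
    qed
    have mu: "mu r Vb ?b = (\<lambda>k. m k / 2)"
      by (rule mu_eqI[OF V _ co]) (use m(1) in \<open>auto simp: inV_def\<close>)
    have "ip r ?d (mu r Vb ?b) = (\<Sum>\<beta>\<in>Vb. of_int (c \<beta>) * ip r (coroot r \<beta>) (mu r Vb ?b))"
      unfolding c by (rule ip_sum_left)
    also have "\<dots> = (\<Sum>\<beta>\<in>Vb. if \<beta> = ?b then of_int (c ?b) else 0)"
      by (rule sum.cong) (auto simp: mu co)
    also have "\<dots> = of_int (c ?b)" using bV bases_finite[OF V] by simp
    finally have "2 * ip r ?d (mu r Vb ?b) = of_int (2 * c ?b)" by simp
    then have "p \<rho> ?d = 1"
      using ip_mu_choice_parity[OF nus S g, of \<rho> ?d] dZ \<rho> unfolding p_def Vb_def R_def by (simp add: parity_sign_of_int del: of_int_mult)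
    moreover have "p \<rho> (\<lambda>k. q' k + ?d k) = p \<rho> q' * p \<rho> ?d"
      by (rule padd[OF coroot_lattice_Ints[OF q(2)] dZ])
    ultimately show ?thesis by simp
  qed
  \<comment> \<open>A coordinate \<open>j\<close> outside all classes of D allows a translation by
    the difference of the unit vectors at some \<rho>0 in D and at \<open>j\<close>, which flips
    exactly one parity in D.\<close>
  have e0: "e D = 0" if D: "D \<subseteq> R" "D \<noteq> {}" and j: "j < r" "\<And>\<rho>. \<rho> \<in> D \<Longrightarrow> j \<notin> class_of r S \<rho>" for D j
  proof -
    obtain \<rho>0 where r0: "\<rho>0 \<in> D" using D by blast
    then have r0R: "\<rho>0 \<in> class_reps r S" using D by (auto simp: R_def)
    let ?q0 = "\<lambda>k. unitv \<rho>0 k - unitv j k"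
    have q0Q: "?q0 \<in> coroot_lattice r"
      using r0R j(1) by (intro unitv_diff_in_coroot_lattice) (auto simp: class_reps_def)
    have p0: "p \<rho> ?q0 = (if \<rho> = \<rho>0 then -1 else 1)" if "\<rho> \<in> D" for \<rho>
    proof -
      have "(\<Sum>k\<in>class_of r S \<rho>. unitv j k) = 0"
        using j(2)[OF that] by (intro sum.neutral) (auto simp: unitv_def)
      moreover have "\<rho>0 \<in> class_of r S \<rho> \<longleftrightarrow> \<rho> = \<rho>0" using r0R by (auto simp: class_of_def class_reps_def)
      then have "(\<Sum>k\<in>class_of r S \<rho>. unitv \<rho>0 k) = (if \<rho> = \<rho>0 then 1 else 0)"
        using finite_class_of[of r S \<rho>] by (auto simp: unitv_def sum.delta)
      ultimately have "(\<Sum>k\<in>class_of r S \<rho>. ?q0 k) = of_int (if \<rho> = \<rho>0 then 1 else 0)" by (simp add: sum_subtractf)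
      then show ?thesis unfolding p_def by (simp only: parity_sign_of_int) simp
    qed
    have pinvD: "(\<Prod>\<rho>\<in>D. p \<rho> q) = (\<Prod>\<rho>\<in>D. p \<rho> q')" if "(q, q') \<in> lattice_rel r Vb" for q q'
      by (rule prod.cong[OF refl], rule pinv[OF that]) (use D in blast)
    have alt: "(\<Prod>\<rho>\<in>D. p \<rho> (\<lambda>k. q k + ?q0 k)) = - (\<Prod>\<rho>\<in>D. p \<rho> q)" if q: "q \<in> coroot_lattice r" for q
    proof -
    have "(\<Prod>\<rho>\<in>D. p \<rho> (\<lambda>k. q k + ?q0 k)) = (\<Prod>\<rho>\<in>D. p \<rho> q * p \<rho> ?q0)"
      by (rule prod.cong[OF refl], rule padd) (auto simp: coroot_lattice_Ints[OF q] unitv_def)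
    also have "\<dots> = (\<Prod>\<rho>\<in>D. p \<rho> q) * (\<Prod>\<rho>\<in>D. if \<rho> = \<rho>0 then -1 else 1)"
      by (simp add: prod.distrib p0)
    also have "(\<Prod>\<rho>\<in>D. if \<rho> = \<rho>0 then -1 else 1 :: complex) = -1"
      using r0 finite_subset[OF D(1) finR] by simp
    finally show ?thesis by simp
    qed
    show ?thesis unfolding e_def
      by (rule Qclasses_sum_alternating[of r Vb "\<lambda>q. \<Prod>\<rho>\<in>D. p \<rho> q", OF pinvD q0Q alt])
  qed
  have eempty: "e {} = of_nat (card ?Q)" by (simp add: e_def)
  \<comment> \<open>The parities multiply to the parity of the full coordinate sum, which is even on
    the lattice.\<close>
  have eR: "e R = of_nat (card ?Q)" if Z: "perp_zeros r S = {}"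
  proof -
    have "(\<Prod>\<rho>\<in>R. p \<rho> (?s X)) = 1" if X: "X \<in> ?Q" for X
    proof -
      have qQ: "?s X \<in> coroot_lattice r" by (rule Qclasses_rep(2)[OF X])
      have "(\<Prod>\<rho>\<in>R. p \<rho> (?s X)) = parity_sign (\<Sum>\<rho>\<in>R. \<Sum>k\<in>class_of r S \<rho>. ?s X k)"
        unfolding p_def by (rule parity_sign_sum[symmetric, OF finR]) (auto intro!: Ints_sum coroot_lattice_Ints[OF qQ])
      also have "(\<Sum>\<rho>\<in>R. \<Sum>k\<in>class_of r S \<rho>. ?s X k) = (\<Sum>k\<in>(\<Union>\<rho>\<in>R. class_of r S \<rho>). ?s X k)"
        by (rule sum.UNION_disjoint[symmetric]) (auto simp: finR finite_class_of class_of_disjoint)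
      also have "(\<Union>\<rho>\<in>R. class_of r S \<rho>) = {..<r}" using union_classes[of r S] Z by (simp add: R_def)
      finally show ?thesis using coroot_lattice_props[OF qQ] by (auto simp: parity_sign_of_int simp del: of_int_mult)
    qed
    then show ?thesis by (simp add: e_def)
  qed
  \<comment> \<open>As r is positive, the empty set and R are two different terms of the
    expansion.\<close>
  have Rne: "R \<noteq> {}" if "perp_zeros r S = {}"
  proof
    assume "R = {}"
    then have "{..<r} = {}" using union_classes[of r S] that by (simp add: R_def)
    moreover have "0 \<in> {..<r}" using r0 by simp
    ultimately show False by blast
  qed
  have "(\<Sum>X\<in>?Q. \<Prod>\<rho>\<in>R. \<alpha> \<rho> + p \<rho> (?s X) * \<gamma> \<rho>) = (\<Sum>X\<in>?Q. \<Prod>\<rho>\<in>R. p \<rho> (?s X) * \<gamma> \<rho> + \<alpha> \<rho>)"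
    by (simp add: add.commute)
  also have "\<dots> = (\<Sum>X\<in>?Q. \<Sum>D\<in>Pow R. (\<Prod>\<rho>\<in>D. p \<rho> (?s X) * \<gamma> \<rho>) * (\<Prod>\<rho>\<in>R - D. \<alpha> \<rho>))"
    by (simp only: prod_add[OF finR])
  also have "\<dots> = (\<Sum>D\<in>Pow R. e D * ((\<Prod>\<rho>\<in>D. \<gamma> \<rho>) * (\<Prod>\<rho>\<in>R - D. \<alpha> \<rho>)))"
    unfolding e_def by (subst sum.swap) (simp add: prod.distrib sum_distrib_left sum_distrib_right mult_ac)
  also have "\<dots> = of_nat (card ?Q) * ((\<Prod>\<rho>\<in>R. \<alpha> \<rho>) + (if perp_zeros r S = {} then \<Prod>\<rho>\<in>R. \<gamma> \<rho> else 0))"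
  proof (cases "perp_zeros r S = {}")
    case True
    have "(\<Sum>D\<in>Pow R. e D * ((\<Prod>\<rho>\<in>D. \<gamma> \<rho>) * (\<Prod>\<rho>\<in>R - D. \<alpha> \<rho>))) =
        (\<Sum>D\<in>{{}, R}. e D * ((\<Prod>\<rho>\<in>D. \<gamma> \<rho>) * (\<Prod>\<rho>\<in>R - D. \<alpha> \<rho>)))"
    proof (rule sum.mono_neutral_right)
      show "\<forall>D\<in>Pow R - {{}, R}. e D * ((\<Prod>\<rho>\<in>D. \<gamma> \<rho>) * (\<Prod>\<rho>\<in>R - D. \<alpha> \<rho>)) = 0"
      proof
        fix D assume D: "D \<in> Pow R - {{}, R}"
        then obtain j where j: "j \<in> R" "j \<notin> D" by blast
        have "e D = 0" using D j by (intro e0[of D j]) (auto simp: R_def class_reps_def class_of_def)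
        then show "e D * ((\<Prod>\<rho>\<in>D. \<gamma> \<rho>) * (\<Prod>\<rho>\<in>R - D. \<alpha> \<rho>)) = 0" by simp
      qed
    qed (auto simp: finR)
    then show ?thesis using Rne[OF True] True eempty eR[OF True] by (simp add: algebra_simps)
  next
    case False
    then obtain j where j: "j \<in> perp_zeros r S" by blast
    have "(\<Sum>D\<in>Pow R. e D * ((\<Prod>\<rho>\<in>D. \<gamma> \<rho>) * (\<Prod>\<rho>\<in>R - D. \<alpha> \<rho>))) =
        (\<Sum>D\<in>{{}}. e D * ((\<Prod>\<rho>\<in>D. \<gamma> \<rho>) * (\<Prod>\<rho>\<in>R - D. \<alpha> \<rho>)))"
    proof (rule sum.mono_neutral_right)
      show "\<forall>D\<in>Pow R - {{}}. e D * ((\<Prod>\<rho>\<in>D. \<gamma> \<rho>) * (\<Prod>\<rho>\<in>R - D. \<alpha> \<rho>)) = 0"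
      proof
        fix D assume D: "D \<in> Pow R - {{}}"
        have "e D = 0" using D j perp_zeros_subset[of r S] by (intro e0[of D j]) (auto simp: class_of_def)
        then show "e D * ((\<Prod>\<rho>\<in>D. \<gamma> \<rho>) * (\<Prod>\<rho>\<in>R - D. \<alpha> \<rho>)) = 0" by simp
      qed
    qed (auto simp: finR)
    then show ?thesis using False eempty by simp
  qed
  finally show ?thesis using c0 by (simp add: p_def)
qed

text \<open>The sign that turns the variable of \<open>e_i\<close> into the variable \<open>v\<close> of its class: it absorbs both the relative
  sign of the coordinate and the choice of branch made by \<open>\<phi>\<close> in \<open>brace\<close>.\<close>

definition class_scale :: "nat \<Rightarrow> (nat \<Rightarrow> real) \<Rightarrow> (nat \<Rightarrow> real) set \<Rightarrow> nat \<Rightarrow> complex" where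
  "class_scale r \<phi> S i = of_real ((if ip r \<phi> (class_vec r S (class_rep r S i)) > 0 then 1 else -1) * class_sign r S i)"

section \<open>Factorisation of the generating function\<close>

definition block_sum :: "nat set \<Rightarrow> (nat \<Rightarrow> complex) \<Rightarrow> (complex \<Rightarrow> complex) \<Rightarrow> complex" where
  "block_sum K v h = (\<Sum>b\<in>K. (\<Prod>g\<in>K - {b}. v g / (v g - v b)) * h (v b))"

lemma class_scale_in:
  assumes "i < r" "i \<notin> perp_zeros r S"
  shows "class_scale r \<phi> S i \<in> {1, -1}"
  using class_sign_in[of r S i] class_sign_nz[OF assms(1), of S] assms(2) by (auto simp: class_scale_def)

lemma coroot_mu_choice:
  assumes nus: "set nus = long_posroots_B r" and S: "S \<in> nbc_sets r nus"
    and g: "g \<in> PiE (class_reps r S) (class_of r S)" and r: "\<rho> \<in> class_reps r S" and i: "i < r"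
  shows "ip r (coroot r (unitv i)) (mu r (choice_basis r S g) (unitv (g \<rho>))) =
    (if i \<in> class_of r S \<rho> then class_sign r S (g \<rho>) * class_sign r S i else 0)"
  using i class_sign_nz[OF i, of S]
  unfolding mu_choice[OF nus S g r] coroot_unitv[OF i] ip_scale_left ip_unitv_left[OF i]
  by (auto simp: class_vec_def class_of_def)

text \<open>Only the class of coordinate \<open>i\<close> contributes. If \<open>i\<close> vanishes
  identically the sum is 0, so the factor of this coordinate in the generating function is t/t =
  1.\<close>

lemma choice_denominator:
  assumes nus: "set nus = long_posroots_B r" and S: "S \<in> nbc_sets r nus"
    and g: "g \<in> PiE (class_reps r S) (class_of r S)" and i: "i < r"
  shows "(\<Sum>\<beta>\<in>choice_basis r S g - long_posroots_B r.
       t \<beta> * complex_of_real (ip r (coroot r (unitv i)) (mu r (choice_basis r S g) \<beta>))) =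
     (if i \<in> perp_zeros r S then 0
      else t (unitv (g (class_rep r S i))) * of_real (class_sign r S (g (class_rep r S i)) * class_sign r S i))"
proof -
  have SA: "S \<subseteq> long_posroots_B r" using S by (auto simp: nbc_sets_def)
  let ?R = "class_reps r S"
  have "(\<Sum>\<beta>\<in>choice_basis r S g - long_posroots_B r.
       t \<beta> * complex_of_real (ip r (coroot r (unitv i)) (mu r (choice_basis r S g) \<beta>))) =
     (\<Sum>\<rho>\<in>?R. t (unitv (g \<rho>)) * complex_of_real (ip r (coroot r (unitv i)) (mu r (choice_basis r S g) (unitv (g \<rho>)))))"
    unfolding choice_basis_short[OF SA] using choice_inj[OF g] by (simp add: sum.reindex inj_on_def o_def)
  also have "\<dots> = (\<Sum>\<rho>\<in>?R. if i \<in> class_of r S \<rho> then t (unitv (g \<rho>)) * of_real (class_sign r S (g \<rho>) * class_sign r S i) else 0)"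
    by (rule sum.cong) (auto simp: coroot_mu_choice[OF nus S g _ i])
  also have "\<dots> = (if i \<in> perp_zeros r S then 0
      else t (unitv (g (class_rep r S i))) * of_real (class_sign r S (g (class_rep r S i)) * class_sign r S i))"
  proof (cases "i \<in> perp_zeros r S")
    case True then show ?thesis by (auto simp: class_of_def intro!: sum.neutral)
  next
    case False
    have c: "i \<in> class_of r S \<rho> \<longleftrightarrow> \<rho> = class_rep r S i" for \<rho> using False i by (auto simp: class_of_def)
    show ?thesis unfolding c using False class_rep_in_reps[OF i False] finite_class_reps[of r S] by simp
  qed
  finally show ?thesis .
qed

text \<open>The sign depending on \<phi> is common to a class, and the class sign of
  \<open>i\<close> squares to 1; hence scaling turns the denominator into a difference of scaled
  variables of one class.\<close>

lemma choice_factor: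
  fixes t :: "(nat \<Rightarrow> real) \<Rightarrow> complex" and \<phi> :: "nat \<Rightarrow> real"
  assumes nus: "set nus = long_posroots_B r" and S: "S \<in> nbc_sets r nus"
    and g: "g \<in> PiE (class_reps r S) (class_of r S)" and i: "i < r" "i \<notin> perp_zeros r S"
  defines "v \<equiv> \<lambda>i. class_scale r \<phi> S i * t (unitv i)"
  shows "class_scale r \<phi> S i * (t (unitv i) - (\<Sum>\<beta>\<in>choice_basis r S g - long_posroots_B r.
       t \<beta> * complex_of_real (ip r (coroot r (unitv i)) (mu r (choice_basis r S g) \<beta>)))) = v i - v (g (class_rep r S i))"
proof -
  let ?\<rho> = "class_rep r S i"
  have r: "?\<rho> \<in> class_reps r S" by (rule class_rep_in_reps[OF i])
  have "class_rep r S (g ?\<rho>) = ?\<rho>" by (rule choice_less(3)[OF g r])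
  moreover have "class_sign r S i * class_sign r S i = 1" by (rule class_sign_square[OF i])
  then have "complex_of_real (class_sign r S i) * complex_of_real (class_sign r S i) = 1"
    by (metis of_real_1 of_real_mult)
  ultimately show ?thesis unfolding choice_denominator[OF nus S g i(1)] v_def class_scale_def
    using i(2) by (auto simp: algebra_simps)
qed

lemma choice_Fdefined:
  assumes nus: "set nus = long_posroots_B r" and S: "S \<in> nbc_sets r nus"
    and g: "g \<in> PiE (class_reps r S) (class_of r S)" and F: "Fdefined r (short_posroots_B r) nus t"
  shows "\<rho> \<in> class_reps r S \<Longrightarrow> exp (t (unitv (g \<rho>))) \<noteq> 1"
    and "i < r \<Longrightarrow> i \<notin> g ` class_reps r S \<Longrightarrow> t (unitv i) - (\<Sum>\<beta>\<in>choice_basis r S g - long_posroots_B r.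
       t \<beta> * complex_of_real (ip r (coroot r (unitv i)) (mu r (choice_basis r S g) \<beta>))) \<noteq> 0"
proof -
  have SA: "S \<subseteq> long_posroots_B r" using S by (auto simp: nbc_sets_def)
  have V: "choice_basis r S g \<in> VA r nus"
    unfolding VA_iff[OF nus] choice_basis_long[OF SA] using S choice_basis_basis[OF nus S g] by blast
  show "exp (t (unitv (g \<rho>))) \<noteq> 1" if "\<rho> \<in> class_reps r S"
    using F V that choice_basis_short[OF SA, of g] unfolding Fdefined_def Let_def posroots_minus_short by blast
  show "t (unitv i) - (\<Sum>\<beta>\<in>choice_basis r S g - long_posroots_B r.
       t \<beta> * complex_of_real (ip r (coroot r (unitv i)) (mu r (choice_basis r S g) \<beta>))) \<noteq> 0"
    if i: "i < r" "i \<notin> g ` class_reps r S"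
  proof -
    have "unitv i \<in> posroots_B r - (choice_basis r S g \<union> long_posroots_B r)"
      using i SA unitv_notin_long[of i r] by (auto simp: posroots_eq short_posroots_eq choice_basis_def)
    then show ?thesis using F V unfolding Fdefined_def Let_def posroots_minus_short by blast
  qed
qed

text \<open>Scaling numerator and denominator by the same sign brings each factor to the shape of a
  Lagrange weight v_i/(v_i - v_b), where b is the coordinate chosen in the class of i.\<close>

lemma choice_product:
  fixes t :: "(nat \<Rightarrow> real) \<Rightarrow> complex" and \<phi> :: "nat \<Rightarrow> real"
  assumes nus: "set nus = long_posroots_B r" and S: "S \<in> nbc_sets r nus"
    and g: "g \<in> PiE (class_reps r S) (class_of r S)" and F: "Fdefined r (short_posroots_B r) nus t"
  defines "v \<equiv> \<lambda>i. class_scale r \<phi> S i * t (unitv i)"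
  shows "(\<Prod>\<gamma>\<in>posroots_B r - (choice_basis r S g \<union> long_posroots_B r).
      t \<gamma> / (t \<gamma> - (\<Sum>\<beta>\<in>choice_basis r S g - long_posroots_B r.
         t \<beta> * complex_of_real (ip r (coroot r \<gamma>) (mu r (choice_basis r S g) \<beta>))))) =
    (\<Prod>\<rho>\<in>class_reps r S. \<Prod>i\<in>class_of r S \<rho> - {g \<rho>}. v i / (v i - v (g \<rho>)))"
proof -
  have SA: "S \<subseteq> long_posroots_B r" using S by (auto simp: nbc_sets_def)
  let ?R = "class_reps r S" and ?V = "choice_basis r S g"
  let ?den = "\<lambda>i. t (unitv i) - (\<Sum>\<beta>\<in>?V - long_posroots_B r. t \<beta> * complex_of_real (ip r (coroot r (unitv i)) (mu r ?V \<beta>)))"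
  have set1: "posroots_B r - (?V \<union> long_posroots_B r) = unitv ` ({..<r} - g ` ?R)"
    using SA unitv_notin_long by (auto simp: posroots_eq short_posroots_eq choice_basis_def)
  have set2: "{..<r} - g ` ?R = perp_zeros r S \<union> (\<Union>\<rho>\<in>?R. class_of r S \<rho> - {g \<rho>})"
  proof
    show "{..<r} - g ` ?R \<subseteq> perp_zeros r S \<union> (\<Union>\<rho>\<in>?R. class_of r S \<rho> - {g \<rho>})"
    proof
      fix i assume i: "i \<in> {..<r} - g ` ?R"
      show "i \<in> perp_zeros r S \<union> (\<Union>\<rho>\<in>?R. class_of r S \<rho> - {g \<rho>})"
      proof (cases "i \<in> perp_zeros r S")
        case False
        then have r: "class_rep r S i \<in> ?R" using i by (intro class_rep_in_reps) auto
        then have "i \<in> class_of r S (class_rep r S i) - {g (class_rep r S i)}" using i False by (auto simp: class_of_def)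
        then show ?thesis using r by blast
      qed simp
    qed
    show "perp_zeros r S \<union> (\<Union>\<rho>\<in>?R. class_of r S \<rho> - {g \<rho>}) \<subseteq> {..<r} - g ` ?R"
    proof
      fix i assume "i \<in> perp_zeros r S \<union> (\<Union>\<rho>\<in>?R. class_of r S \<rho> - {g \<rho>})"
      then consider "i \<in> perp_zeros r S" | \<rho> where "\<rho> \<in> ?R" "i \<in> class_of r S \<rho>" "i \<noteq> g \<rho>" by blast
      then show "i \<in> {..<r} - g ` ?R"
      proof cases
        case 1
        then show ?thesis using perp_zeros_subset[of r S] choice_less(2)[OF g] by auto
      next
        case 2
        have "i \<noteq> g \<sigma>" if "\<sigma> \<in> ?R" for \<sigma> using 2 choice_less(3)[OF g that] by (auto simp: class_of_def)
        then show ?thesis using 2 by (auto simp: class_of_def)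
      qed
    qed
  qed
  have nz: "?den i \<noteq> 0" if "i \<in> {..<r} - g ` ?R" for i
    using choice_Fdefined(2)[OF nus S g F] that by simp
  have "(\<Prod>\<gamma>\<in>posroots_B r - (?V \<union> long_posroots_B r).
      t \<gamma> / (t \<gamma> - (\<Sum>\<beta>\<in>?V - long_posroots_B r. t \<beta> * complex_of_real (ip r (coroot r \<gamma>) (mu r ?V \<beta>))))) =
     (\<Prod>i\<in>{..<r} - g ` ?R. t (unitv i) / ?den i)"
    unfolding set1 by (subst prod.reindex) (auto simp: inj_on_def)
  also have "\<dots> = (\<Prod>i\<in>perp_zeros r S. t (unitv i) / ?den i) * (\<Prod>i\<in>(\<Union>\<rho>\<in>?R. class_of r S \<rho> - {g \<rho>}). t (unitv i) / ?den i)"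
    unfolding set2
    by (rule prod.union_disjoint)
       (auto simp: finite_class_reps finite_class_of class_of_def intro: finite_subset[OF perp_zeros_subset])
  also have "(\<Prod>i\<in>perp_zeros r S. t (unitv i) / ?den i) = 1"
  proof (rule prod.neutral, rule ballI)
    fix i assume i: "i \<in> perp_zeros r S"
    then have "i < r" using perp_zeros_subset by auto
    moreover have "?den i \<noteq> 0" using i set2 by (intro nz) blast
    ultimately show "t (unitv i) / ?den i = 1" using i unfolding choice_denominator[OF nus S g \<open>i < r\<close>] by simp
  qed
  also have "(\<Prod>i\<in>(\<Union>\<rho>\<in>?R. class_of r S \<rho> - {g \<rho>}). t (unitv i) / ?den i) =
      (\<Prod>\<rho>\<in>?R. \<Prod>i\<in>class_of r S \<rho> - {g \<rho>}. t (unitv i) / ?den i)"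
    by (rule prod.UNION_disjoint) (auto simp: finite_class_reps finite_class_of class_of_def)
  also have "\<dots> = (\<Prod>\<rho>\<in>?R. \<Prod>i\<in>class_of r S \<rho> - {g \<rho>}. v i / (v i - v (g \<rho>)))"
  proof (intro prod.cong refl)
    fix \<rho> i assume "\<rho> \<in> ?R" "i \<in> class_of r S \<rho> - {g \<rho>}"
    then have i: "i < r" "i \<notin> perp_zeros r S" "class_rep r S i = \<rho>" by (auto simp: class_of_def)
    have "class_scale r \<phi> S i \<noteq> 0" using class_scale_in[OF i(1,2), of \<phi>] by auto
    then have "t (unitv i) / ?den i = (class_scale r \<phi> S i * t (unitv i)) / (class_scale r \<phi> S i * ?den i)"
      by (rule mult_divide_mult_cancel_left[symmetric])
    also have "\<dots> = v i / (v i - v (g \<rho>))"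
      unfolding choice_factor[OF nus S g i(1,2), of \<phi> t] i(3) v_def ..
    finally show "t (unitv i) / ?den i = v i / (v i - v (g \<rho>))" .
  qed
  finally show ?thesis by simp
qed

lemma Fgen_eq:
  assumes nus: "set nus = long_posroots_B r" and r0: "1 \<le> r"
    and \<phi>: "\<forall>Vb\<in>bases_B r. \<forall>\<beta>\<in>Vb. ip r \<phi> (mu r Vb \<beta>) \<noteq> 0"
    and F: "Fdefined r (short_posroots_B r) nus t"
  defines "v \<equiv> \<lambda>S i. class_scale r \<phi> S i * t (unitv i)"
  shows "Fgen r (short_posroots_B r) nus \<phi> (\<lambda>_. 0) t =
    (\<Sum>S\<in>nbc_sets r nus. (-1) ^ card S *
      ((\<Prod>\<rho>\<in>class_reps r S. block_sum (class_of r S \<rho>) (v S) half_bern) +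
       (if perp_zeros r S = {} then \<Prod>\<rho>\<in>class_reps r S. block_sum (class_of r S \<rho>) (v S) odd_bern else 0)))"
proof -
  define trm where "trm Vb =
       (-1) ^ card (long_posroots_B r - Vb) *
       (\<Prod>\<gamma>\<in>posroots_B r - (Vb \<union> long_posroots_B r).
          t \<gamma> / (t \<gamma> - (\<Sum>\<beta>\<in>Vb - long_posroots_B r. t \<beta> * of_real (ip r (coroot r \<gamma>) (mu r Vb \<beta>))))) *
       (1 / of_nat (card (Qclasses r Vb))) *
       (\<Sum>X\<in>Qclasses r Vb.
          \<Prod>\<beta>\<in>Vb - long_posroots_B r.
            t \<beta> * exp (t \<beta> * of_real (brace r \<phi> Vb (SOME q. q \<in> X) \<beta>))
              / (exp (t \<beta>) - 1))" for Vb
  have "Fgen r (short_posroots_B r) nus \<phi> (\<lambda>_. 0) t = (\<Sum>Vb\<in>VA r nus. trm Vb)"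
    by (simp add: Fgen_def posroots_minus_short trm_def Let_def)
  also have "\<dots> = (\<Sum>p\<in>Sigma (nbc_sets r nus) (\<lambda>S. PiE (class_reps r S) (class_of r S)). trm ((\<lambda>(S, g). choice_basis r S g) p))"
    by (rule sum.reindex_bij_betw[OF VA_bij[OF nus], symmetric])
  also have "\<dots> = (\<Sum>S\<in>nbc_sets r nus. \<Sum>g\<in>PiE (class_reps r S) (class_of r S). trm (choice_basis r S g))"
    by (subst sum.Sigma) (auto simp: finite_nbc_sets finite_class_reps finite_class_of case_prod_unfold intro!: finite_PiE)
  also have "\<dots> = (\<Sum>S\<in>nbc_sets r nus. (-1) ^ card S *
      ((\<Prod>\<rho>\<in>class_reps r S. block_sum (class_of r S \<rho>) (v S) half_bern) +
       (if perp_zeros r S = {} then \<Prod>\<rho>\<in>class_reps r S. block_sum (class_of r S \<rho>) (v S) odd_bern else 0)))"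
  proof (rule sum.cong[OF refl])
    fix S assume S: "S \<in> nbc_sets r nus"
    have SA: "S \<subseteq> long_posroots_B r" using S by (auto simp: nbc_sets_def)
    let ?R = "class_reps r S"
    let ?c = "\<lambda>\<rho> b. \<Prod>i\<in>class_of r S \<rho> - {b}. v S i / (v S i - v S b)"
    have tm: "trm (choice_basis r S g) = (-1) ^ card S *
        ((\<Prod>\<rho>\<in>?R. ?c \<rho> (g \<rho>) * half_bern (v S (g \<rho>))) +
         (if perp_zeros r S = {} then \<Prod>\<rho>\<in>?R. ?c \<rho> (g \<rho>) * odd_bern (v S (g \<rho>)) else 0))"
      if g: "g \<in> PiE ?R (class_of r S)" for g
    proof -
      let ?V = "choice_basis r S g"
      have "long_posroots_B r - ?V = long_posroots_B r - S"
        using choice_basis_long[OF SA, of g] by blast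
      then have "card (long_posroots_B r - ?V) + card S = card (long_posroots_B r)"
        using SA finite_long_posroots[of r] by (simp add: card_Diff_subset card_mono finite_subset[OF SA])
      then have "even (card (long_posroots_B r - ?V) + card S)" using even_card_long_posroots[of r] by simp
      \<comment> \<open>The number of long roots is even, so S and its complement among them have
        cardinalities of the same parity.\<close>
      then have sgn: "(-1 :: complex) ^ card (long_posroots_B r - ?V) = (-1) ^ card S"
        by (simp add: minus_one_power_iff)
      have br: "(\<Prod>\<beta>\<in>?V - long_posroots_B r.
            t \<beta> * exp (t \<beta> * of_real (brace r \<phi> ?V (SOME q. q \<in> X) \<beta>)) / (exp (t \<beta>) - 1)) =
          (\<Prod>\<rho>\<in>?R. half_bern (v S (g \<rho>)) + parity_sign (\<Sum>k\<in>class_of r S \<rho>. (SOME q. q \<in> X) k) * odd_bern (v S (g \<rho>)))"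
        if X: "X \<in> Qclasses r ?V" for X
      proof -
        have "(\<Prod>\<beta>\<in>?V - long_posroots_B r.
            t \<beta> * exp (t \<beta> * of_real (brace r \<phi> ?V (SOME q. q \<in> X) \<beta>)) / (exp (t \<beta>) - 1)) =
          (\<Prod>\<rho>\<in>?R. t (unitv (g \<rho>)) * exp (t (unitv (g \<rho>)) * of_real (brace r \<phi> ?V (SOME q. q \<in> X) (unitv (g \<rho>)))) / (exp (t (unitv (g \<rho>))) - 1))"
          unfolding choice_basis_short[OF SA] using choice_inj[OF g] by (simp add: prod.reindex inj_on_def o_def)
        also have "\<dots> = (\<Prod>\<rho>\<in>?R. half_bern (v S (g \<rho>)) + parity_sign (\<Sum>k\<in>class_of r S \<rho>. (SOME q. q \<in> X) k) * odd_bern (v S (g \<rho>)))"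
        proof (rule prod.cong[OF refl])
          fix \<rho> assume r: "\<rho> \<in> ?R"
          note gl = choice_less[OF g r]
          have V: "?V \<in> bases_B r" "unitv (g \<rho>) \<in> ?V"
            using choice_basis_basis[OF nus S g] r by (auto simp: choice_basis_def)
          have mu: "ip r \<phi> (mu r ?V (unitv (g \<rho>))) = class_sign r S (g \<rho>) / 2 * ip r \<phi> (class_vec r S \<rho>)"
            unfolding mu_choice[OF nus S g r] ip_scale_right ..
          have ne: "ip r \<phi> (mu r ?V (unitv (g \<rho>))) \<noteq> 0" using \<phi> V by blast
          have "class_sign r S (g \<rho>) \<in> {1, -1}"
            using class_sign_in[of r S "g \<rho>"] class_sign_nz[OF gl(1), of S] gl(2) by auto
          \<comment> \<open>The pairing is nonzero, so a negative class sign reverses the branch of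
            \<open>brace\<close>; this is why \<open>class_scale\<close> is a product of two
            signs.\<close>
          then have vv: "v S (g \<rho>) = (if ip r \<phi> (mu r ?V (unitv (g \<rho>))) > 0 then t (unitv (g \<rho>)) else - t (unitv (g \<rho>)))"
            using ne unfolding mu v_def class_scale_def gl(3) by auto
          show "t (unitv (g \<rho>)) * exp (t (unitv (g \<rho>)) * of_real (brace r \<phi> ?V (SOME q. q \<in> X) (unitv (g \<rho>)))) / (exp (t (unitv (g \<rho>))) - 1) =
            half_bern (v S (g \<rho>)) + parity_sign (\<Sum>k\<in>class_of r S \<rho>. (SOME q. q \<in> X) k) * odd_bern (v S (g \<rho>))"
            by (rule brace_term[OF nus S g r coroot_lattice_Ints[OF Qclasses_rep(2)[OF X]] choice_Fdefined(1)[OF nus S g F r] vv])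
        qed
        finally show ?thesis .
      qed
      have cp: "(\<Prod>\<gamma>\<in>posroots_B r - (?V \<union> long_posroots_B r).
          t \<gamma> / (t \<gamma> - (\<Sum>\<beta>\<in>?V - long_posroots_B r. t \<beta> * of_real (ip r (coroot r \<gamma>) (mu r ?V \<beta>))))) =
          (\<Prod>\<rho>\<in>?R. ?c \<rho> (g \<rho>))"
        unfolding choice_product[OF nus S g F, of \<phi>] v_def ..
      have "trm ?V = (-1) ^ card S * (\<Prod>\<rho>\<in>?R. ?c \<rho> (g \<rho>)) *
         ((1 / of_nat (card (Qclasses r ?V))) * (\<Sum>X\<in>Qclasses r ?V. \<Prod>\<rho>\<in>?R. half_bern (v S (g \<rho>)) + parity_sign (\<Sum>k\<in>class_of r S \<rho>. (SOME q. q \<in> X) k) * odd_bern (v S (g \<rho>))))"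
        unfolding trm_def sgn cp using br by (simp only: mult.assoc cong: sum.cong)
      also have "\<dots> = (-1) ^ card S * (\<Prod>\<rho>\<in>?R. ?c \<rho> (g \<rho>)) *
          ((\<Prod>\<rho>\<in>?R. half_bern (v S (g \<rho>))) + (if perp_zeros r S = {} then \<Prod>\<rho>\<in>?R. odd_bern (v S (g \<rho>)) else 0))"
        by (simp only: lattice_average[OF nus S g r0])
      finally show ?thesis by (simp add: prod.distrib algebra_simps)
    qed
    \<comment> \<open>Distributivity: summing a product over independent choices gives the product
      of the sums over the classes.\<close>
    have PS: "(\<Sum>g\<in>PiE ?R (class_of r S). \<Prod>\<rho>\<in>?R. ?c \<rho> (g \<rho>) * h (v S (g \<rho>))) = (\<Prod>\<rho>\<in>?R. block_sum (class_of r S \<rho>) (v S) h)" for h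
      unfolding block_sum_def by (rule prod_sum_PiE[symmetric]) (auto simp: finite_class_reps finite_class_of)
    have "(\<Sum>g\<in>PiE ?R (class_of r S). trm (choice_basis r S g)) = (\<Sum>g\<in>PiE ?R (class_of r S). (-1) ^ card S *
        ((\<Prod>\<rho>\<in>?R. ?c \<rho> (g \<rho>) * half_bern (v S (g \<rho>))) +
         (if perp_zeros r S = {} then \<Prod>\<rho>\<in>?R. ?c \<rho> (g \<rho>) * odd_bern (v S (g \<rho>)) else 0)))"
      by (rule sum.cong[OF refl]) (rule tm)
    then show "(\<Sum>g\<in>PiE ?R (class_of r S). trm (choice_basis r S g)) = (-1) ^ card S *
      ((\<Prod>\<rho>\<in>?R. block_sum (class_of r S \<rho>) (v S) half_bern) +
       (if perp_zeros r S = {} then \<Prod>\<rho>\<in>?R. block_sum (class_of r S \<rho>) (v S) odd_bern else 0))"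
      by (simp add: PS[symmetric] sum.distrib flip: sum_distrib_left)
  qed
  finally show ?thesis .
qed


section \<open>The coefficients as lattice sums\<close>

definition half_coeff :: "nat \<Rightarrow> complex" where
  "half_coeff m = bern_coeff m / 2 ^ m"

definition odd_coeff :: "nat \<Rightarrow> complex" where
  "odd_coeff m = bern_coeff m - half_coeff m"

lemma half_bern_has_sum:
  assumes "z \<noteq> 0" "norm z < 1"
  shows "((\<lambda>m. half_coeff m * z ^ m) has_sum half_bern z) UNIV"
proof -
  have "((\<lambda>m. bern_coeff m * (z / 2) ^ m) has_sum (z / 2 / (exp (z / 2) - 1))) UNIV"
    by (rule bern_coeff_has_sum) (use assms in \<open>auto simp: norm_divide\<close>)
  then show ?thesis by (simp add: half_coeff_def half_bern_def power_divide)
qed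

lemma odd_bern_has_sum:
  assumes "z \<noteq> 0" "norm z < 1"
  shows "((\<lambda>m. odd_coeff m * z ^ m) has_sum odd_bern z) UNIV"
proof -
  have "((\<lambda>m. bern_coeff m * z ^ m + - (half_coeff m * z ^ m)) has_sum (z / (exp z - 1) + - half_bern z)) UNIV"
    by (intro has_sum_add bern_coeff_has_sum half_bern_has_sum has_sum_uminusI assms)
  then show ?thesis by (simp add: odd_coeff_def odd_bern_def algebra_simps)
qed

lemma coeff_bounds: "\<exists>C. \<forall>m. norm (half_coeff m) \<le> C \<and> norm (odd_coeff m) \<le> C"
proof -
  obtain C where C: "\<And>m. norm (bern_coeff m) \<le> C" using norm_bern_coeff_le by blast
  have h: "norm (half_coeff m) \<le> C" for m
  proof -
    have "norm (half_coeff m) = norm (bern_coeff m) / 2 ^ m" by (simp add: half_coeff_def norm_divide norm_power)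
    also have "\<dots> \<le> norm (bern_coeff m) / 1" by (intro divide_left_mono) auto
    finally show ?thesis using C[of m] by simp
  qed
  have "norm (odd_coeff m) \<le> C + C" for m
    unfolding odd_coeff_def by (intro order_trans[OF norm_triangle_ineq4] add_mono C h)
  moreover have "norm (half_coeff m) \<le> C + C" for m
    using h[of m] order_trans[OF norm_ge_zero C[of 0]] by linarith
  ultimately show ?thesis by blast
qed

text \<open>The powers of \<open>class_scale\<close> lead back from scaled to original variables.
  Variables of identically vanishing coordinates have cancelled from the term of S, so only exponent
  0 occurs there.\<close>

definition nbc_coeff :: "nat \<Rightarrow> (nat \<Rightarrow> real) \<Rightarrow> (nat \<Rightarrow> real) set \<Rightarrow> (nat \<Rightarrow> nat) \<Rightarrow> complex" where
  "nbc_coeff r \<phi> S k = (if \<forall>i\<in>perp_zeros r S. k i = 0 then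
     ((\<Prod>\<rho>\<in>class_reps r S. block_coeff (class_of r S \<rho>) half_coeff k) +
      (if perp_zeros r S = {} then \<Prod>\<rho>\<in>class_reps r S. block_coeff (class_of r S \<rho>) odd_coeff k else 0)) *
     (\<Prod>i\<in>{..<r} - perp_zeros r S. class_scale r \<phi> S i ^ k i) else 0)"

definition series_coeff :: "nat \<Rightarrow> (nat \<Rightarrow> real) \<Rightarrow> (nat \<Rightarrow> real) list \<Rightarrow> (nat \<Rightarrow> nat) \<Rightarrow> complex" where
  "series_coeff r \<phi> nus k = (\<Sum>S\<in>nbc_sets r nus. (-1) ^ card S * nbc_coeff r \<phi> S k)"

lemma block_coeff_cong:
  assumes "\<And>i. i \<in> K \<Longrightarrow> k i = k' i"
  shows "block_coeff K h k = block_coeff K h k'"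
  using assms by (simp add: block_coeff_def cong: sum.cong)

text \<open>\<open>Fdefined\<close> speaks about the denominators of single bases. Applied to the
  bases that choose \<open>i\<close> in the class of \<rho> and representatives elsewhere, it yields
  that the variables of one class are nonzero and their scaled versions distinct, as
  \<open>block_has_sum\<close> demands.\<close>

lemma scaled_variables:
  fixes t :: "(nat \<Rightarrow> real) \<Rightarrow> complex" and \<phi> :: "nat \<Rightarrow> real"
  assumes nus: "set nus = long_posroots_B r" and S: "S \<in> nbc_sets r nus"
    and F: "Fdefined r (short_posroots_B r) nus t" and r: "\<rho> \<in> class_reps r S"
  defines "v \<equiv> \<lambda>i. class_scale r \<phi> S i * t (unitv i)"
  shows "inj_on v (class_of r S \<rho>)" and "i \<in> class_of r S \<rho> \<Longrightarrow> t (unitv i) \<noteq> 0"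
proof -
  define G where "G i = (\<lambda>\<sigma>\<in>class_reps r S. if \<sigma> = \<rho> then i else \<sigma>)" for i
  have G: "G i \<in> PiE (class_reps r S) (class_of r S)" if "i \<in> class_of r S \<rho>" for i
    using that rep_in_class_of by (auto simp: G_def)
  have Gr: "G i \<rho> = i" for i using r by (simp add: G_def)
  show "t (unitv i) \<noteq> 0" if i: "i \<in> class_of r S \<rho>" for i
    using choice_Fdefined(1)[OF nus S G[OF i] F r] Gr[of i] by auto
  have "v j \<noteq> v i" if i: "i \<in> class_of r S \<rho>" and j: "j \<in> class_of r S \<rho>" and ne: "i \<noteq> j" for i j
  proof -
    have jr: "j < r" "j \<notin> perp_zeros r S" "class_rep r S j = \<rho>" using j by (auto simp: class_of_def)
    have "j \<notin> G i ` class_reps r S"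
    proof
      assume "j \<in> G i ` class_reps r S"
      then obtain \<sigma> where s: "\<sigma> \<in> class_reps r S" "j = G i \<sigma>" by blast
      then have "\<sigma> = \<rho>" using choice_less(3)[OF G[OF i] s(1)] jr by simp
      then show False using s Gr ne by simp
    qed
    from choice_Fdefined(2)[OF nus S G[OF i] F jr(1) this] have d: "t (unitv j) - (\<Sum>\<beta>\<in>choice_basis r S (G i) - long_posroots_B r.
       t \<beta> * complex_of_real (ip r (coroot r (unitv j)) (mu r (choice_basis r S (G i)) \<beta>))) \<noteq> 0" .
    have "class_scale r \<phi> S j \<noteq> 0" using class_scale_in[OF jr(1,2), of \<phi>] by auto
    then have "v j - v (G i \<rho>) \<noteq> 0"
      using choice_factor[OF nus S G[OF i] jr(1,2), of \<phi> t] d unfolding jr(3) v_def by (metis mult_eq_0_iff)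
    then show ?thesis using Gr by simp
  qed
  then show "inj_on v (class_of r S \<rho>)" by (metis inj_onI)
qed

text \<open>Stated for general \<open>h\<close> and \<open>H\<close> to cover
  \<open>half_bern\<close> and \<open>odd_bern\<close> at once. The blocks are the classes;
  exponents at identically vanishing coordinates are then filled in with coefficient 0.\<close>

lemma nbc_blocks_has_sum:
  fixes t :: "(nat \<Rightarrow> real) \<Rightarrow> complex" and \<phi> :: "nat \<Rightarrow> real"
  assumes nus: "set nus = long_posroots_B r" and S: "S \<in> nbc_sets r nus"
    and F: "Fdefined r (short_posroots_B r) nus t" and t1: "\<And>i. i < r \<Longrightarrow> norm (t (unitv i)) < 1"
    and C: "\<And>m. norm (h m) \<le> C"
    and H: "\<And>z. z \<noteq> 0 \<Longrightarrow> norm z < 1 \<Longrightarrow> ((\<lambda>m. h m * z ^ m) has_sum H z) UNIV"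
  defines "v \<equiv> \<lambda>i. class_scale r \<phi> S i * t (unitv i)"
  shows "((\<lambda>k. (if \<forall>i\<in>perp_zeros r S. k i = 0 then
      (\<Prod>\<rho>\<in>class_reps r S. block_coeff (class_of r S \<rho>) h k) *
      (\<Prod>i\<in>{..<r} - perp_zeros r S. class_scale r \<phi> S i ^ k i) else 0) * (\<Prod>i<r. t (unitv i) ^ k i)) has_sum
    (\<Prod>\<rho>\<in>class_reps r S. block_sum (class_of r S \<rho>) v H)) (supp_in {..<r})"
proof -
  let ?R = "class_reps r S" and ?Z = "perp_zeros r S"
  let ?U = "{..<r} - ?Z"
  have U: "(\<Union>\<rho>\<in>?R. class_of r S \<rho>) = ?U" by (rule union_classes[symmetric])
  have b: "((\<lambda>k. block_coeff (class_of r S \<rho>) h k * (\<Prod>i\<in>class_of r S \<rho>. v i ^ k i)) has_sum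
      block_sum (class_of r S \<rho>) v H) (supp_in (class_of r S \<rho>))" if r: "\<rho> \<in> ?R" for \<rho>
    unfolding block_sum_def
  proof (rule block_has_sum[OF finite_class_of])
    show "class_of r S \<rho> \<noteq> {}" using rep_in_class_of[OF r] by blast
    show "inj_on v (class_of r S \<rho>)" unfolding v_def by (rule scaled_variables(1)[OF nus S F r])
    fix i assume i: "i \<in> class_of r S \<rho>"
    have ir: "i < r" "i \<notin> ?Z" using i by (auto simp: class_of_def)
    have "class_scale r \<phi> S i \<in> {1, -1}" by (rule class_scale_in[OF ir])
    then show v0: "v i \<noteq> 0" and v1: "norm (v i) < 1"
      using scaled_variables(2)[OF nus S F r i] t1[OF ir(1)] by (auto simp: v_def norm_mult)
    show "((\<lambda>m. h m * v i ^ m) has_sum H (v i)) UNIV" by (rule H[OF v0 v1])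
  qed (rule C)
  have "((\<lambda>k. \<Prod>\<rho>\<in>?R. block_coeff (class_of r S \<rho>) h k * (\<Prod>i\<in>class_of r S \<rho>. v i ^ k i)) has_sum
      (\<Prod>\<rho>\<in>?R. block_sum (class_of r S \<rho>) v H)) (supp_in (\<Union>\<rho>\<in>?R. class_of r S \<rho>))"
  proof (rule has_sum_prod_blocks[OF finite_class_reps class_of_disjoint b])
    fix \<rho> and k k' :: "nat \<Rightarrow> nat" assume kk: "\<And>i. i \<in> class_of r S \<rho> \<Longrightarrow> k i = k' i"
    show "block_coeff (class_of r S \<rho>) h k * (\<Prod>i\<in>class_of r S \<rho>. v i ^ k i) =
       block_coeff (class_of r S \<rho>) h k' * (\<Prod>i\<in>class_of r S \<rho>. v i ^ k' i)"
      using block_coeff_cong[of "class_of r S \<rho>" k k' h] kk by (simp cong: prod.cong)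
  qed
  then show ?thesis unfolding U
  proof (rule iffD1[OF has_sum_cong_neutral, rotated -1])
    fix k :: "nat \<Rightarrow> nat" assume "k \<in> supp_in {..<r} - supp_in ?U"
    then have "\<not> (\<forall>i\<in>?Z. k i = 0)" by (auto simp: supp_in_def)
    then show "(if \<forall>i\<in>?Z. k i = 0 then
      (\<Prod>\<rho>\<in>?R. block_coeff (class_of r S \<rho>) h k) *
      (\<Prod>i\<in>?U. class_scale r \<phi> S i ^ k i) else 0) * (\<Prod>i<r. t (unitv i) ^ k i) = 0" by (simp only: if_False mult_zero_left)
  next
    fix k :: "nat \<Rightarrow> nat" assume "k \<in> supp_in ?U - supp_in {..<r}"
    then show "(\<Prod>\<rho>\<in>?R. block_coeff (class_of r S \<rho>) h k * (\<Prod>i\<in>class_of r S \<rho>. v i ^ k i)) = 0"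
      by (auto simp: supp_in_def)
  next
    fix k :: "nat \<Rightarrow> nat" assume "k \<in> supp_in ?U \<inter> supp_in {..<r}"
    then have k0: "\<forall>i\<in>?Z. k i = 0" by (auto simp: supp_in_def)
    have "(\<Prod>\<rho>\<in>?R. \<Prod>i\<in>class_of r S \<rho>. v i ^ k i) = (\<Prod>i\<in>?U. v i ^ k i)"
      unfolding U[symmetric]
      by (rule prod.UNION_disjoint[symmetric]) (auto simp: finite_class_reps finite_class_of class_of_def)
    also have "\<dots> = (\<Prod>i\<in>?U. class_scale r \<phi> S i ^ k i) * (\<Prod>i\<in>?U. t (unitv i) ^ k i)"
      by (simp add: v_def power_mult_distrib prod.distrib)
    also have "(\<Prod>i\<in>?U. t (unitv i) ^ k i) = (\<Prod>i<r. t (unitv i) ^ k i)"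
      by (rule prod.mono_neutral_left) (use k0 in auto)
    finally show "(\<Prod>\<rho>\<in>?R. block_coeff (class_of r S \<rho>) h k * (\<Prod>i\<in>class_of r S \<rho>. v i ^ k i)) =
      (if \<forall>i\<in>?Z. k i = 0 then (\<Prod>\<rho>\<in>?R. block_coeff (class_of r S \<rho>) h k) *
      (\<Prod>i\<in>?U. class_scale r \<phi> S i ^ k i) else 0) * (\<Prod>i<r. t (unitv i) ^ k i)"
      using k0 by (simp add: prod.distrib)
  qed
qed

lemma Fgen_has_sum:
  assumes nus: "set nus = long_posroots_B r" and r0: "1 \<le> r"
    and \<phi>: "\<forall>Vb\<in>bases_B r. \<forall>\<beta>\<in>Vb. ip r \<phi> (mu r Vb \<beta>) \<noteq> 0"
    and F: "Fdefined r (short_posroots_B r) nus t" and t1: "\<And>i. i < r \<Longrightarrow> norm (t (unitv i)) < 1"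
  shows "((\<lambda>k. series_coeff r \<phi> nus k * (\<Prod>i<r. t (unitv i) ^ k i)) has_sum
    Fgen r (short_posroots_B r) nus \<phi> (\<lambda>_. 0) t) (supp_in {..<r})"
proof -
  obtain C where C: "\<And>m. norm (half_coeff m) \<le> C" "\<And>m. norm (odd_coeff m) \<le> C" using coeff_bounds by blast
  have "((\<lambda>k. \<Sum>S\<in>nbc_sets r nus. (-1) ^ card S * (nbc_coeff r \<phi> S k * (\<Prod>i<r. t (unitv i) ^ k i))) has_sum
    Fgen r (short_posroots_B r) nus \<phi> (\<lambda>_. 0) t) (supp_in {..<r})"
    unfolding Fgen_eq[OF nus r0 \<phi> F]
  proof (intro has_sum_finite_sum[OF finite_nbc_sets] has_sum_cmult_right)
    fix S assume S: "S \<in> nbc_sets r nus"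
    let ?v = "\<lambda>i. class_scale r \<phi> S i * t (unitv i)"
    let ?A = "\<lambda>h k. (if \<forall>i\<in>perp_zeros r S. k i = 0 then
      (\<Prod>\<rho>\<in>class_reps r S. block_coeff (class_of r S \<rho>) h k) *
      (\<Prod>i\<in>{..<r} - perp_zeros r S. class_scale r \<phi> S i ^ k i) else 0) * (\<Prod>i<r. t (unitv i) ^ k i)"
    have a: "(?A half_coeff has_sum (\<Prod>\<rho>\<in>class_reps r S. block_sum (class_of r S \<rho>) ?v half_bern)) (supp_in {..<r})"
      by (rule nbc_blocks_has_sum[OF nus S F t1 C(1) half_bern_has_sum])
    have o: "(?A odd_coeff has_sum (\<Prod>\<rho>\<in>class_reps r S. block_sum (class_of r S \<rho>) ?v odd_bern)) (supp_in {..<r})"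
      by (rule nbc_blocks_has_sum[OF nus S F t1 C(2) odd_bern_has_sum])
    show "((\<lambda>k. nbc_coeff r \<phi> S k * (\<Prod>i<r. t (unitv i) ^ k i)) has_sum
       ((\<Prod>\<rho>\<in>class_reps r S. block_sum (class_of r S \<rho>) ?v half_bern) +
       (if perp_zeros r S = {} then \<Prod>\<rho>\<in>class_reps r S. block_sum (class_of r S \<rho>) ?v odd_bern else 0))) (supp_in {..<r})"
    proof (cases "perp_zeros r S = {}")
      case True
      then show ?thesis using has_sum_add[OF a o] by (simp add: nbc_coeff_def algebra_simps)
    next
      case False
      have eq: "nbc_coeff r \<phi> S k * (\<Prod>i<r. t (unitv i) ^ k i) = ?A half_coeff k" for k
        unfolding nbc_coeff_def if_not_P[OF False] by simp
      show ?thesis unfolding eq if_not_P[OF False] add_0_right by (rule a)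
    qed
  qed
  then show ?thesis by (simp add: series_coeff_def sum_distrib_right mult.assoc)
qed

section \<open>Identification of the coefficients \<open>Pcoef\<close>\<close>

definition root_index :: "nat \<Rightarrow> (nat \<Rightarrow> nat) \<Rightarrow> (nat \<Rightarrow> real) \<Rightarrow> nat" where
  "root_index r k = (\<lambda>\<alpha>. if \<alpha> \<in> short_posroots_B r then k (inv unitv \<alpha>) else 0)"

lemma root_index_unitv: "i < r \<Longrightarrow> root_index r k (unitv i) = k i"
  by (simp add: root_index_def short_posroots_eq inv_f_f[OF inj_unitv])

lemma prod_short: "(\<Prod>\<alpha>\<in>short_posroots_B r. f \<alpha>) = (\<Prod>i<r. f (unitv i))"
  unfolding short_posroots_eq by (subst prod.reindex) (auto simp: inj_on_def)

lemma has_sum_root_index: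
  "(f has_sum s) (multi_indices (short_posroots_B r)) \<longleftrightarrow>
   ((\<lambda>k. f (root_index r k)) has_sum s) (supp_in {..<r})"
proof -
  have "((\<lambda>k. f (root_index r k)) has_sum s) (supp_in {..<r}) \<longleftrightarrow> (f has_sum s) (multi_indices (short_posroots_B r))"
  proof (rule has_sum_reindex_bij_witness[where j = "root_index r" and i = "\<lambda>l i. if i < r then l (unitv i) else 0"])
    fix k :: "nat \<Rightarrow> nat" assume k: "k \<in> supp_in {..<r}"
    show "(\<lambda>i. if i < r then root_index r k (unitv i) else 0) = k"
      using k by (auto simp: root_index_unitv supp_in_def)
    show "root_index r k \<in> multi_indices (short_posroots_B r)" by (simp add: root_index_def multi_indices_def)
  next
    fix l assume l: "l \<in> multi_indices (short_posroots_B r)"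
    show "root_index r (\<lambda>i. if i < r then l (unitv i) else 0) = l"
    proof
      fix \<alpha>
      show "root_index r (\<lambda>i. if i < r then l (unitv i) else 0) \<alpha> = l \<alpha>"
      proof (cases "\<alpha> \<in> short_posroots_B r")
        case True
        then obtain i where "i < r" "\<alpha> = unitv i" by (auto simp: short_posroots_eq)
        then show ?thesis by (simp add: root_index_unitv)
      next
        case False then show ?thesis using l by (auto simp: root_index_def multi_indices_def)
      qed
    qed
    show "(\<lambda>i. if i < r then l (unitv i) else 0) \<in> supp_in {..<r}" by (simp add: supp_in_def)
  qed auto
  then show ?thesis by simp
qed

text \<open>Powers of s in (0, 1) with distinct exponents are positive and distinct, so neither
  differences nor sums of two of them vanish, and their exponentials exceed 1. These are the
  nonsingular points at which uniqueness is tested.\<close>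

lemma Fdefined_powers:
  assumes nus: "set nus = long_posroots_B r" and w: "inj_on w {..<r}" "\<forall>i<r. 1 \<le> w i"
    and s: "0 < s" "s < (1 :: real)" and t: "\<And>i. i < r \<Longrightarrow> t (unitv i) = of_real s ^ w i"
  shows "Fdefined r (short_posroots_B r) nus t"
  unfolding Fdefined_def Let_def posroots_minus_short
proof (intro ballI conjI)
  fix Vb assume "Vb \<in> VA r nus"
  then have "Vb \<in> (\<lambda>(S, g). choice_basis r S g) ` Sigma (nbc_sets r nus) (\<lambda>S. PiE (class_reps r S) (class_of r S))"
    by (simp only: bij_betw_imp_surj_on[OF VA_bij[OF nus]])
  then obtain p where p: "Vb = (\<lambda>(S, g). choice_basis r S g) p"
      "p \<in> Sigma (nbc_sets r nus) (\<lambda>S. PiE (class_reps r S) (class_of r S))"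
    by (rule imageE)
  obtain S g where Sg: "p = (S, g)" by (cases p)
  have S: "S \<in> nbc_sets r nus" and g: "g \<in> PiE (class_reps r S) (class_of r S)" and V: "Vb = choice_basis r S g"
    using p unfolding Sg by auto
  have SA: "S \<subseteq> long_posroots_B r" using S by (auto simp: nbc_sets_def)
  {
    fix \<beta> assume "\<beta> \<in> Vb - long_posroots_B r"
    then obtain \<rho> where r: "\<rho> \<in> class_reps r S" "\<beta> = unitv (g \<rho>)"
      unfolding V choice_basis_short[OF SA] by blast
    have "t \<beta> = of_real (s ^ w (g \<rho>))" using t[OF choice_less(1)[OF g r(1)]] r(2) by simp
    then have "norm (exp (t \<beta>)) = exp (s ^ w (g \<rho>))" by (simp add: norm_exp_eq_Re)
    moreover have "0 < s ^ w (g \<rho>)" using s by simp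
    ultimately have "1 < norm (exp (t \<beta>))" by simp
    then show "exp (t \<beta>) \<noteq> 1" by (metis norm_one less_irrefl)
  next
    fix \<gamma> assume "\<gamma> \<in> posroots_B r - (Vb \<union> long_posroots_B r)"
    then obtain i where i: "i < r" "\<gamma> = unitv i" "i \<notin> g ` class_reps r S"
      unfolding V by (auto simp: posroots_eq short_posroots_eq choice_basis_def)
    show "t \<gamma> - (\<Sum>\<beta>\<in>Vb - long_posroots_B r. t \<beta> * complex_of_real (ip r (coroot r \<gamma>) (mu r Vb \<beta>))) \<noteq> 0"
    proof (cases "i \<in> perp_zeros r S")
      case True
      then show ?thesis unfolding V i(2) choice_denominator[OF nus S g i(1)] using s t[OF i(1)] by simp
    next
      case False
      let ?b = "g (class_rep r S i)"
      have rep: "class_rep r S i \<in> class_reps r S" by (rule class_rep_in_reps[OF i(1) False])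
      have b: "?b < r" "?b \<notin> perp_zeros r S" by (rule choice_less[OF g rep])+
      have "?b \<noteq> i" using i(3) imageI[OF rep, of g] by auto
      then have "w ?b \<noteq> w i" using w(1) b(1) i(1) by (auto dest: inj_onD)
      then have ne: "s ^ w i \<noteq> s ^ w ?b" using s by (metis power_inject_exp' less_irrefl not_less_iff_gr_or_eq)
      have "class_sign r S ?b * class_sign r S i \<in> {1, -1}"
        using class_sign_in[of r S i] class_sign_in[of r S ?b] class_sign_nz[OF i(1), of S] class_sign_nz[OF b(1), of S] b False by auto
      moreover have "s ^ w i + s ^ w ?b > 0" using s by (intro add_pos_pos) auto
      ultimately have "s ^ w i - s ^ w ?b * (class_sign r S ?b * class_sign r S i) \<noteq> 0" using ne by auto
      then have "complex_of_real (s ^ w i - s ^ w ?b * (class_sign r S ?b * class_sign r S i)) \<noteq> 0" by (simp only: of_real_eq_0_iff not_False_eq_True)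
      then show ?thesis unfolding V i(2) choice_denominator[OF nus S g i(1)] using False t[OF i(1)] t[OF b(1)] by simp
    qed
  }
qed

text \<open>Existence of an expansion holds with radius 1 by \<open>Fgen_has_sum\<close>. Uniqueness
  follows by evaluating the difference of two expansions at the points of
  \<open>Fdefined_powers\<close>. The factorials are those in the definition of
  \<open>Pcoef\<close>.\<close>

lemma Pcoef_root_index:
  assumes nus: "set nus = long_posroots_B r" and r0: "1 \<le> r"
    and \<phi>: "\<forall>Vb\<in>bases_B r. \<forall>\<beta>\<in>Vb. ip r \<phi> (mu r Vb \<beta>) \<noteq> 0"
    and k: "k \<in> supp_in {..<r}"
  shows "Pcoef r (short_posroots_B r) nus \<phi> (\<lambda>_. 0) (root_index r k) = series_coeff r \<phi> nus k * (\<Prod>i<r. fact (k i))"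
proof -
  let ?D = "short_posroots_B r"
  let ?F = "Fgen r ?D nus \<phi> (\<lambda>_. 0)"
  define good where "good P \<longleftrightarrow> (\<forall>k. k \<notin> multi_indices ?D \<longrightarrow> P k = 0) \<and>
      (\<exists>\<epsilon>>0. \<forall>t. (\<forall>\<alpha>\<in>?D. norm (t \<alpha>) < \<epsilon>) \<and> Fdefined r ?D nus t \<longrightarrow>
         ((\<lambda>k. P k * (\<Prod>\<alpha>\<in>?D. t \<alpha> ^ k \<alpha> / fact (k \<alpha>))) has_sum ?F t) (multi_indices ?D))" for P :: "((nat \<Rightarrow> real) \<Rightarrow> nat) \<Rightarrow> complex"
  have conv: "((\<lambda>k. P k * (\<Prod>\<alpha>\<in>?D. t \<alpha> ^ k \<alpha> / fact (k \<alpha>))) has_sum x) (multi_indices ?D) \<longleftrightarrow>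
     ((\<lambda>k. P (root_index r k) / (\<Prod>i<r. fact (k i)) * (\<Prod>i<r. t (unitv i) ^ k i)) has_sum x) (supp_in {..<r})"
    for P :: "((nat \<Rightarrow> real) \<Rightarrow> nat) \<Rightarrow> complex" and t x
    unfolding has_sum_root_index prod_short
    by (rule has_sum_cong) (simp add: root_index_unitv prod_dividef)
  define P0 where "P0 l = (if l \<in> multi_indices ?D then
     series_coeff r \<phi> nus (\<lambda>i. if i < r then l (unitv i) else 0) * (\<Prod>i<r. fact (l (unitv i))) else 0)" for l
  have P0: "P0 (root_index r k) = series_coeff r \<phi> nus k * (\<Prod>i<r. fact (k i))" if "k \<in> supp_in {..<r}" for k
  proof -
    have "(\<lambda>i. if i < r then root_index r k (unitv i) else 0) = k"
      using that by (auto simp: root_index_unitv supp_in_def)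
    moreover have "root_index r k \<in> multi_indices ?D" by (simp add: root_index_def multi_indices_def)
    ultimately show ?thesis by (simp add: P0_def root_index_unitv)
  qed
  have fnz: "(\<Prod>i<r. fact (k i)) \<noteq> (0 :: complex)" for k by simp
  have good0: "good P0"
    unfolding good_def
  proof (intro conjI exI[of _ "1 :: real"] allI impI)
    fix t assume t: "(\<forall>\<alpha>\<in>?D. norm (t \<alpha>) < 1) \<and> Fdefined r ?D nus t"
    have "((\<lambda>k. series_coeff r \<phi> nus k * (\<Prod>i<r. t (unitv i) ^ k i)) has_sum ?F t) (supp_in {..<r})"
      by (rule Fgen_has_sum[OF nus r0 \<phi>]) (use t in \<open>auto simp: short_posroots_eq\<close>)
    then show "((\<lambda>k. P0 k * (\<Prod>\<alpha>\<in>?D. t \<alpha> ^ k \<alpha> / fact (k \<alpha>))) has_sum ?F t) (multi_indices ?D)"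
      unfolding conv by (rule iffD1[OF has_sum_cong, rotated]) (simp add: P0 fnz)
  qed (auto simp: P0_def)
  have uniq: "Pa = P0" if Pa: "good Pa" for Pa
  proof -
    obtain \<epsilon> where e: "\<epsilon> > 0" and H: "\<And>t. (\<forall>\<alpha>\<in>?D. norm (t \<alpha>) < \<epsilon>) \<Longrightarrow> Fdefined r ?D nus t \<Longrightarrow>
         ((\<lambda>k. Pa k * (\<Prod>\<alpha>\<in>?D. t \<alpha> ^ k \<alpha> / fact (k \<alpha>))) has_sum ?F t) (multi_indices ?D)"
      using Pa unfolding good_def by blast
    have z: "(Pa (root_index r k) - P0 (root_index r k)) / (\<Prod>i<r. fact (k i)) = 0" if "k \<in> supp_in {..<r}" for k
    \<comment> \<open>The smaller of the two radii of validity: 1 for \<open>P0\<close>, \<epsilon>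
      for the competitor.\<close>
    proof (rule multi_powser_eq_zero[of "min 1 \<epsilon>" r "\<lambda>k. (Pa (root_index r k) - P0 (root_index r k)) / (\<Prod>i<r. fact (k i))"])
      show "0 < min 1 \<epsilon>" using e by simp
      fix w :: "nat \<Rightarrow> nat" and s :: real
      assume w: "inj_on w {..<r}" "\<forall>i<r. 1 \<le> w i" and s: "0 < s" "s < min 1 \<epsilon>"
      define t where "t \<alpha> = complex_of_real s ^ w (inv unitv \<alpha>)" for \<alpha>
      have t: "t (unitv i) = of_real s ^ w i" for i by (simp add: t_def inv_f_f[OF inj_unitv])
      have s1: "s ^ w i \<le> s" if "i < r" for i
        using power_decreasing[of 1 "w i" s] w(2) that s by simp
      have small: "\<forall>\<alpha>\<in>?D. norm (t \<alpha>) < c" if "s < c" for c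
      proof
        fix \<alpha> assume "\<alpha> \<in> ?D"
        then obtain i where "i < r" "\<alpha> = unitv i" by (auto simp: short_posroots_eq)
        then show "norm (t \<alpha>) < c" using s1[of i] s that by (simp add: t norm_power)
      qed
      have F: "Fdefined r ?D nus t" by (rule Fdefined_powers[OF nus w]) (use s t in auto)
      have 1: "((\<lambda>k. Pa (root_index r k) / (\<Prod>i<r. fact (k i)) * (\<Prod>i<r. t (unitv i) ^ k i)) has_sum ?F t) (supp_in {..<r})"
        using H[OF small F] s unfolding conv by simp
      have "((\<lambda>k. series_coeff r \<phi> nus k * (\<Prod>i<r. t (unitv i) ^ k i)) has_sum ?F t) (supp_in {..<r})"
        by (rule Fgen_has_sum[OF nus r0 \<phi> F]) (use small[of 1] s in \<open>auto simp: short_posroots_eq\<close>)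
      then have 2: "((\<lambda>k. P0 (root_index r k) / (\<Prod>i<r. fact (k i)) * (\<Prod>i<r. t (unitv i) ^ k i)) has_sum ?F t) (supp_in {..<r})"
        by (rule iffD1[OF has_sum_cong, rotated]) (simp add: P0 fnz)
      from has_sum_add[OF 1 has_sum_uminusI[OF 2]]
      show "((\<lambda>k. (Pa (root_index r k) - P0 (root_index r k)) / (\<Prod>i<r. fact (k i)) * (\<Prod>i<r. (of_real s ^ w i) ^ k i)) has_sum 0) (supp_in {..<r})"
        by (simp add: t algebra_simps diff_divide_distrib)
    qed (rule that)
    show "Pa = P0"
    proof
      fix l
      show "Pa l = P0 l"
      proof (cases "l \<in> multi_indices ?D")
        case True
        let ?k = "\<lambda>i. if i < r then l (unitv i) else 0"
        have "root_index r ?k \<alpha> = l \<alpha>" for \<alpha>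
        proof (cases "\<alpha> \<in> ?D")
          case True
          then obtain i where "i < r" "\<alpha> = unitv i" by (auto simp: short_posroots_eq)
          then show ?thesis by (simp add: root_index_unitv)
        next
          case False then show ?thesis using \<open>l \<in> multi_indices ?D\<close> by (auto simp: root_index_def multi_indices_def)
        qed
        then have "root_index r ?k = l" by auto
        moreover have "?k \<in> supp_in {..<r}" by (simp add: supp_in_def)
        ultimately show ?thesis using z[of ?k] fnz[of ?k] by simp
      next
        case False
        then show ?thesis using Pa by (simp add: good_def P0_def)
      qed
    qed
  qed
  have "Pcoef r ?D nus \<phi> (\<lambda>_. 0) = (THE P. good P)" by (simp add: Pcoef_def good_def)
  also have "\<dots> = P0" using good0 uniq by (rule the_equality)
  finally show ?thesis using P0[OF k] by simp
qed


text \<open>Toggling the last root orthogonal to \<open>x\<close> is a sign-reversing involution on the no-broken-circuit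
  sets orthogonal to \<open>x\<close>: later roots are not orthogonal to \<open>x\<close>, hence never in the span.\<close>

lemma nbc_alternating_sum:
  assumes dist: "distinct nus" and nus: "set nus = long_posroots_B r"
  shows "(\<Sum>S\<in>{S \<in> nbc_sets r nus. \<forall>\<beta>\<in>S. ip r \<beta> x = 0}. (-1) ^ card S) =
    (if \<exists>\<beta>\<in>long_posroots_B r. ip r \<beta> x = 0 then 0 else (1 :: complex))"
proof (cases "\<exists>\<beta>\<in>long_posroots_B r. ip r \<beta> x = 0")
  case False
  have "{S \<in> nbc_sets r nus. \<forall>\<beta>\<in>S. ip r \<beta> x = 0} = {{}}"
  proof
    show "{S \<in> nbc_sets r nus. \<forall>\<beta>\<in>S. ip r \<beta> x = 0} \<subseteq> {{}}" using False by (auto simp: nbc_sets_def)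
    \<comment> \<open>The span of the empty set is zero, and the zero vector is orthogonal to
      \<open>x\<close>, which no long root is in this case.\<close>
    have "nus ! j \<notin> lin_hull {}" if "j < length nus" for j
    proof
      assume "nus ! j \<in> lin_hull {}"
      then have "nus ! j = (\<lambda>_. 0)" by (simp add: lin_hull_def)
      then have "ip r (nus ! j) x = 0" by (simp add: ip_def)
      then show False using False that nus nth_mem by blast
    qed
    then show "{{}} \<subseteq> {S \<in> nbc_sets r nus. \<forall>\<beta>\<in>S. ip r \<beta> x = 0}" by (simp add: nbc_sets_def)
  qed
  then show ?thesis using False by simp
next
  case True
  let ?N = "{S \<in> nbc_sets r nus. \<forall>\<beta>\<in>S. ip r \<beta> x = 0}"
  define I where "I = {j. j < length nus \<and> ip r (nus ! j) x = 0}"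
  have "I \<noteq> {}" using True nus unfolding I_def by (metis (mono_tags, lifting) empty_iff in_set_conv_nth mem_Collect_eq)
  define l where "l = Max I"
  have finI: "finite I" by (simp add: I_def)
  have lI: "l \<in> I" unfolding l_def using finI \<open>I \<noteq> {}\<close> by (rule Max_in)
  define \<nu> where "\<nu> = nus ! l"
  have l: "l < length nus" "ip r \<nu> x = 0" using lI by (auto simp: I_def \<nu>_def)
  have later: "ip r (nus ! j) x \<noteq> 0" if "l < j" "j < length nus" for j
  proof
    assume "ip r (nus ! j) x = 0"
    then have "j \<in> I" using that by (simp add: I_def)
    then have "j \<le> l" unfolding l_def using finI by (rule Max_ge[rotated])
    then show False using that by simp
  qed
  have \<nu>A: "\<nu> \<in> long_posroots_B r" unfolding \<nu>_def nus[symmetric] using l(1) by (rule nth_mem)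
  define T where "T S = (if \<nu> \<in> S then S - {\<nu>} else insert \<nu> S)" for S
  have TT: "T (T S) = S" for S by (auto simp: T_def)
  have TN: "T S \<in> ?N" if S: "S \<in> ?N" for S
  proof -
    have perp: "\<forall>\<beta>\<in>T S. ip r \<beta> x = 0" using S l(2) by (auto simp: T_def)
    have "nus ! j \<notin> lin_hull (T S \<inter> set (take j nus))" if j: "j < length nus" for j
    proof (cases "j \<le> l")
      case True
      \<comment> \<open>By distinctness \<nu> does not occur before position \<open>l\<close>, so
        toggling it leaves the spans tested there unchanged.\<close>
      have "\<nu> \<notin> set (take j nus)"
      proof
        assume "\<nu> \<in> set (take j nus)"
        then obtain i where "i < j" "nus ! i = nus ! l" by (auto simp: in_set_conv_nth \<nu>_def)
        then show False using dist True l(1) by (simp add: nth_eq_iff_index_eq)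
      qed
      then have "T S \<inter> set (take j nus) = S \<inter> set (take j nus)" by (auto simp: T_def)
      then show ?thesis using S j by (simp add: nbc_sets_def)
    next
      case False
      show ?thesis
      proof
        assume a: "nus ! j \<in> lin_hull (T S \<inter> set (take j nus))"
        have "ip r (nus ! j) x = 0" by (rule lin_hull_orthogonal[OF a]) (use perp in auto)
        then show False using later False j by auto
      qed
    qed
    then show ?thesis using S perp \<nu>A by (auto simp: nbc_sets_def T_def)
  qed
  have card: "(-1 :: complex) ^ card (T S) = - ((-1) ^ card S)" if S: "S \<in> ?N" for S
  proof -
    have "finite S" using S finite_long_posroots by (auto simp: nbc_sets_def intro: finite_subset)
    then show ?thesis
    proof (cases "\<nu> \<in> S")
      case True
      then have "card S = Suc (card (S - {\<nu>}))" using \<open>finite S\<close> by (rule card.remove[rotated])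
      then have "(-1 :: complex) ^ card S = - ((-1) ^ card (S - {\<nu>}))" by (metis mult_minus1 power_Suc)
      then show ?thesis using True by (simp add: T_def del: card_Diff_insert card_Diff_singleton)
    next
      case False
      then show ?thesis using \<open>finite S\<close> by (simp add: T_def)
    qed
  qed
  have "(\<Sum>S\<in>?N. - ((-1 :: complex) ^ card S)) = (\<Sum>S\<in>?N. (-1) ^ card S)"
    by (rule sum.reindex_bij_witness[where i = T and j = T]) (use TT TN card in simp_all)
  then show ?thesis using True by (simp add: sum_negf)
qed

section \<open>Sums over integer points of equal parity\<close>

definition recip_monomial :: "nat \<Rightarrow> (nat \<Rightarrow> nat) \<Rightarrow> (nat \<Rightarrow> int) \<Rightarrow> complex" where
  "recip_monomial r k n = (\<Prod>i<r. 1 / (2 * of_real pi * \<i> * of_int (n i)) ^ k i)"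

definition parity_points :: "nat \<Rightarrow> bool \<Rightarrow> (nat \<Rightarrow> int) set" where
  "parity_points r e = {n \<in> supp_in {..<r}. \<forall>i<r. n i \<noteq> 0 \<and> (even (n i) \<longleftrightarrow> e)}"

text \<open>Injectivity of the absolute values says that the point avoids all hyperplanes x_i = x_j
  and x_i = -x_j.\<close>

definition regular_points :: "nat \<Rightarrow> (nat \<Rightarrow> int) set" where
  "regular_points r = {n \<in> supp_in {..<r}. (\<forall>i<r. n i \<noteq> 0) \<and> (\<forall>i<r. \<forall>j<r. even (n i) \<longleftrightarrow> even (n j)) \<and>
     inj_on (\<lambda>i. \<bar>n i\<bar>) {..<r}}"

definition parity_coeff :: "bool \<Rightarrow> nat \<Rightarrow> complex" where
  "parity_coeff e = (if e then half_coeff else odd_coeff)"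

text \<open>Even integers are doubles, which contributes the factor 2^(-m) of
  \<open>half_coeff\<close>; odd ones are the complement. So the two product terms of the lattice
  average correspond to the two parities of the points.\<close>

lemma parity_coeff_has_sum:
  assumes m: "even m" "2 \<le> m"
  shows "((\<lambda>x. if x \<noteq> 0 \<and> (even x \<longleftrightarrow> e) then 1 / (2 * of_real pi * \<i> * of_int x) ^ m else 0) has_sum (- parity_coeff e m)) UNIV"
proof -
  define f where "f x = 1 / (2 * of_real pi * \<i> * of_int x :: complex) ^ m" for x :: int
  have all: "(f has_sum (- bern_coeff m)) (UNIV - {0})" unfolding f_def by (rule bern_coeff_even_has_sum[OF m])
  have f2: "f (2 * x) = 1 / 2 ^ m * f x" for x
  proof -
    have "2 * complex_of_real pi * \<i> * of_int (2 * x) = 2 * (2 * of_real pi * \<i> * of_int x)" by simp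
    then show ?thesis unfolding f_def by (simp only: power_mult_distrib) simp
  qed
  have ev: "(f has_sum (- half_coeff m)) {x. x \<noteq> 0 \<and> even x}"
  proof -
    have "((\<lambda>x. 1 / 2 ^ m * f x) has_sum (1 / 2 ^ m * - bern_coeff m)) (UNIV - {0})"
      by (rule has_sum_cmult_right[OF all])
    also have "?this \<longleftrightarrow> (f has_sum (- half_coeff m)) {x. x \<noteq> 0 \<and> even x}"
      by (rule has_sum_reindex_bij_witness[where j = "\<lambda>x. 2 * x" and i = "\<lambda>x. x div 2"])
         (auto simp: f2 half_coeff_def)
    finally show ?thesis .
  qed
  have od: "(f has_sum (- odd_coeff m)) {x. x \<noteq> 0 \<and> odd x}"
  proof -
    have "(f has_sum (- bern_coeff m - - half_coeff m)) (UNIV - {0} - {x. x \<noteq> 0 \<and> even x})"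
      by (rule has_sum_Diff[OF all ev]) auto
    moreover have "UNIV - {0} - {x. x \<noteq> 0 \<and> even x} = {x :: int. x \<noteq> 0 \<and> odd x}" by auto
    ultimately show ?thesis by (simp add: odd_coeff_def)
  qed
  have "(f has_sum (- parity_coeff e m)) {x. x \<noteq> 0 \<and> (even x \<longleftrightarrow> e)}"
    using ev od by (cases e) (simp_all add: parity_coeff_def)
  then show ?thesis
    by (rule iffD1[OF has_sum_cong_neutral, rotated -1]) (auto simp: f_def)
qed

definition int_sign :: "nat \<Rightarrow> (nat \<Rightarrow> real) set \<Rightarrow> nat \<Rightarrow> int" where
  "int_sign r S i = (if class_sign r S i = 1 then 1 else -1)"

lemma int_sign_real:
  assumes "i < r" "i \<notin> perp_zeros r S"
  shows "real_of_int (int_sign r S i) = class_sign r S i"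
  using class_sign_in[of r S i] class_sign_nz[OF assms(1), of S] assms(2) by (auto simp: int_sign_def)

text \<open>A point of \<open>perp r S\<close> is determined by its values at the class
  representatives, which its other coordinates repeat up to sign. Signs change neither parity nor,
  the exponents being even, the monomial; so the sum factors into one-dimensional sums with the
  added exponents of each class.\<close>

lemma perp_points_has_sum:
  assumes S: "S \<subseteq> long_posroots_B r" and Z: "perp_zeros r S = {}"
    and k: "\<And>i. i < r \<Longrightarrow> even (k i) \<and> 2 \<le> k i"
  shows "(recip_monomial r k has_sum (\<Prod>\<rho>\<in>class_reps r S. - parity_coeff e (sum k (class_of r S \<rho>))))
    {n \<in> parity_points r e. (\<lambda>i. real_of_int (n i)) \<in> perp r S}"
proof -
  let ?R = "class_reps r S" and ?K = "\<lambda>\<rho>. sum k (class_of r S \<rho>)"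
  let ?c = "class_rep r S" and ?s = "int_sign r S"
  define g where "g \<rho> x = (if x \<noteq> 0 \<and> (even x \<longleftrightarrow> e) then 1 / (2 * of_real pi * \<i> * of_int x :: complex) ^ ?K \<rho> else 0)" for \<rho> and x :: int
  have K: "even (?K \<rho>)" "2 \<le> ?K \<rho>" if r: "\<rho> \<in> ?R" for \<rho>
  proof -
    show "even (?K \<rho>)" using k by (intro dvd_sum) (auto simp: class_of_def)
    have "k \<rho> \<le> ?K \<rho>" using rep_in_class_of[OF r] by (intro member_le_sum) (auto simp: finite_class_of)
    moreover have "2 \<le> k \<rho>" using k[of \<rho>] r by (simp add: class_reps_def)
    ultimately show "2 \<le> ?K \<rho>" by simp
  qed
  have U: "(\<Union>\<rho>\<in>?R. class_of r S \<rho>) = {..<r}" using union_classes[of r S] Z by simp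
  have cR: "?c i \<in> ?R" if "i < r" for i using that Z by (intro class_rep_in_reps) auto
  have Rc: "?c \<rho> = \<rho>" "\<rho> < r" if "\<rho> \<in> ?R" for \<rho> using that by (auto simp: class_reps_def)
  have sR: "?s \<rho> = 1" if "\<rho> \<in> ?R" for \<rho> using class_sign_rep[OF that] by (simp add: int_sign_def)
  have s1: "?s i = 1 \<or> ?s i = -1" for i by (simp add: int_sign_def)
  have sreal: "real_of_int (?s i) = class_sign r S i" if "i < r" for i using that Z by (intro int_sign_real) auto
  have "((\<lambda>m. \<Prod>\<rho>\<in>?R. g \<rho> (m \<rho>)) has_sum (\<Prod>\<rho>\<in>?R. - parity_coeff e (?K \<rho>))) (supp_in ?R)"
    unfolding g_def by (rule has_sum_prod_coords[OF finite_class_reps parity_coeff_has_sum]) (use K in auto)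
  then have "((\<lambda>m. \<Prod>\<rho>\<in>?R. g \<rho> (m \<rho>)) has_sum (\<Prod>\<rho>\<in>?R. - parity_coeff e (?K \<rho>)))
     {m \<in> supp_in ?R. \<forall>\<rho>\<in>?R. m \<rho> \<noteq> 0 \<and> (even (m \<rho>) \<longleftrightarrow> e)}"
  \<comment> \<open>\<open>g\<close> vanishes at inadmissible values, so restricting the index set
    does not change the sum.\<close>
  proof (rule iffD1[OF has_sum_cong_neutral, rotated -1])
    fix m :: "nat \<Rightarrow> int" assume "m \<in> supp_in ?R - {m \<in> supp_in ?R. \<forall>\<rho>\<in>?R. m \<rho> \<noteq> 0 \<and> (even (m \<rho>) \<longleftrightarrow> e)}"
    then obtain \<rho> where "\<rho> \<in> ?R" "\<not> (m \<rho> \<noteq> 0 \<and> (even (m \<rho>) \<longleftrightarrow> e))" by blast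
    then have "g \<rho> (m \<rho>) = 0" unfolding g_def by (simp only: if_False)
    then show "(\<Prod>\<rho>\<in>?R. g \<rho> (m \<rho>)) = 0" using \<open>\<rho> \<in> ?R\<close> finite_class_reps by (auto intro: prod_zero)
  qed auto
  also have "?this \<longleftrightarrow> ?thesis"
  proof (rule has_sum_reindex_bij_witness[where j = "\<lambda>m i. if i < r then ?s i * m (?c i) else 0"
      and i = "\<lambda>n \<rho>. if \<rho> \<in> ?R then n \<rho> else 0"])
    fix m :: "nat \<Rightarrow> int" assume m: "m \<in> {m \<in> supp_in ?R. \<forall>\<rho>\<in>?R. m \<rho> \<noteq> 0 \<and> (even (m \<rho>) \<longleftrightarrow> e)}"
    let ?n = "\<lambda>i. if i < r then ?s i * m (?c i) else 0"
    show "(\<lambda>\<rho>. if \<rho> \<in> ?R then ?n \<rho> else 0) = m"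
      using m Rc sR by (auto simp: supp_in_def)
    have "(\<lambda>i. real_of_int (?n i)) \<in> perp r S"
    proof -
      have "(\<lambda>i. real_of_int (?n i)) = (\<lambda>i. \<Sum>\<rho>\<in>?R. real_of_int (m \<rho>) * class_vec r S \<rho> i)"
      proof
        fix i
        show "real_of_int (?n i) = (\<Sum>\<rho>\<in>?R. real_of_int (m \<rho>) * class_vec r S \<rho> i)"
        proof (cases "i < r")
          case True
          have "(\<Sum>\<rho>\<in>?R. real_of_int (m \<rho>) * class_vec r S \<rho> i) = (\<Sum>\<rho>\<in>?R. if \<rho> = ?c i then real_of_int (m (?c i)) * class_sign r S i else 0)"
            by (rule sum.cong) (auto simp: class_vec_def True)
          also have "\<dots> = real_of_int (m (?c i)) * class_sign r S i" using cR[OF True] finite_class_reps by simp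
          finally show ?thesis using True sreal[OF True] by simp
        next
          case False then show ?thesis by (simp add: class_vec_def)
        qed
      qed
      moreover have "(\<lambda>i. \<Sum>\<rho>\<in>?R. real_of_int (m \<rho>) * class_vec r S \<rho> i) \<in> perp r S"
      proof -
        have "inV r (\<lambda>i. \<Sum>\<rho>\<in>?R. real_of_int (m \<rho>) * class_vec r S \<rho> i)" by (simp add: inV_def class_vec_def)
        moreover have "ip r \<beta> (\<lambda>i. \<Sum>\<rho>\<in>?R. real_of_int (m \<rho>) * class_vec r S \<rho> i) = 0" if "\<beta> \<in> S" for \<beta>
          using class_vec_perp[OF S] that by (simp add: ip_sum_right perp_def)
        ultimately show ?thesis by (simp add: perp_def)
      qed
      ultimately show ?thesis by simp
    qed
    moreover have "?n \<in> parity_points r e"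
    proof -
      have "?s i * m (?c i) \<noteq> 0 \<and> (even (?s i * m (?c i)) \<longleftrightarrow> e)" if "i < r" for i
        using m cR[OF that] s1[of i] by auto
      then show ?thesis by (simp add: parity_points_def supp_in_def)
    qed
    ultimately show "?n \<in> {n \<in> parity_points r e. (\<lambda>i. real_of_int (n i)) \<in> perp r S}" by simp
    have "recip_monomial r k ?n = (\<Prod>i<r. 1 / (2 * of_real pi * \<i> * of_int (m (?c i))) ^ k i)"
      unfolding recip_monomial_def
    proof (rule prod.cong[OF refl])
      fix i assume "i \<in> {..<r}"
      then have "even (k i)" using k by simp
      then show "1 / (2 * complex_of_real pi * \<i> * of_int (?n i)) ^ k i = 1 / (2 * of_real pi * \<i> * of_int (m (?c i))) ^ k i"
        using s1[of i] \<open>i \<in> {..<r}\<close> by (auto simp: power_minus_even)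
    qed
    also have "\<dots> = (\<Prod>\<rho>\<in>?R. \<Prod>i\<in>class_of r S \<rho>. 1 / (2 * of_real pi * \<i> * of_int (m (?c i))) ^ k i)"
      unfolding U[symmetric] by (rule prod.UNION_disjoint) (auto simp: finite_class_reps finite_class_of class_of_def)
    also have "\<dots> = (\<Prod>\<rho>\<in>?R. g \<rho> (m \<rho>))"
    proof (rule prod.cong[OF refl])
      fix \<rho> assume r: "\<rho> \<in> ?R"
      have "(\<Prod>i\<in>class_of r S \<rho>. 1 / (2 * of_real pi * \<i> * of_int (m (?c i))) ^ k i) =
         (\<Prod>i\<in>class_of r S \<rho>. (1 / (2 * complex_of_real pi * \<i> * of_int (m \<rho>))) ^ k i)"
        by (rule prod.cong) (auto simp: class_of_def power_divide)
      also have "\<dots> = (1 / (2 * of_real pi * \<i> * of_int (m \<rho>))) ^ ?K \<rho>" by (rule power_sum[symmetric])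
      also have "\<dots> = g \<rho> (m \<rho>)" using m r by (auto simp: g_def power_divide)
      finally show "(\<Prod>i\<in>class_of r S \<rho>. 1 / (2 * of_real pi * \<i> * of_int (m (?c i))) ^ k i) = g \<rho> (m \<rho>)" .
    qed
    finally show "recip_monomial r k ?n = (\<Prod>\<rho>\<in>?R. g \<rho> (m \<rho>))" .
  next
    fix n :: "nat \<Rightarrow> int" assume n: "n \<in> {n \<in> parity_points r e. (\<lambda>i. real_of_int (n i)) \<in> perp r S}"
    let ?m = "\<lambda>\<rho>. if \<rho> \<in> ?R then n \<rho> else 0"
    have "n i = ?s i * n (?c i)" if "i < r" for i
    proof -
      have "real_of_int (n i) = class_sign r S i * real_of_int (n (?c i))"
        using n perp_eq_sign[of "\<lambda>i. real_of_int (n i)" r S i] by simp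
      then have "real_of_int (n i) = real_of_int (?s i * n (?c i))" using sreal[OF that] by simp
      then show ?thesis by (simp only: of_int_eq_iff)
    qed
    then have "?s i * n (?c i) = n i" if "i < r" for i using that by simp
    then show "(\<lambda>i. if i < r then ?s i * ?m (?c i) else 0) = n"
      using n cR by (auto simp: parity_points_def supp_in_def)
    show "?m \<in> {m \<in> supp_in ?R. \<forall>\<rho>\<in>?R. m \<rho> \<noteq> 0 \<and> (even (m \<rho>) \<longleftrightarrow> e)}"
      using n Rc by (auto simp: parity_points_def supp_in_def)
  qed simp
  finally show ?thesis .
qed

text \<open>Exponents of at least 2 put every block into the all-positive case and kill the sets S
  with identically vanishing coordinates; even exponents remove \<open>class_scale\<close>, and with
  it \<phi>. The class signs (-1)^(|K| - 1) multiply to (-1)^(r - |R|) = (-1)^|S| and cancel the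
  outer sign.\<close>

lemma series_coeff_even:
  assumes nus: "set nus = long_posroots_B r" and k: "\<And>i. i < r \<Longrightarrow> even (k i) \<and> 2 \<le> k i"
  shows "series_coeff r \<phi> nus k = (\<Sum>S\<in>nbc_sets r nus. if perp_zeros r S = {} then
     (\<Prod>\<rho>\<in>class_reps r S. half_coeff (sum k (class_of r S \<rho>))) +
     (\<Prod>\<rho>\<in>class_reps r S. odd_coeff (sum k (class_of r S \<rho>))) else 0)"
  unfolding series_coeff_def
proof (rule sum.cong[OF refl])
  fix S assume S: "S \<in> nbc_sets r nus"
  let ?R = "class_reps r S"
  show "(-1) ^ card S * nbc_coeff r \<phi> S k = (if perp_zeros r S = {} then
     (\<Prod>\<rho>\<in>?R. half_coeff (sum k (class_of r S \<rho>))) + (\<Prod>\<rho>\<in>?R. odd_coeff (sum k (class_of r S \<rho>))) else 0)"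
  proof (cases "perp_zeros r S = {}")
    case False
    then obtain i where i: "i \<in> perp_zeros r S" by blast
    have "k i \<noteq> 0" using k[of i] i perp_zeros_subset[of r S] by force
    then have "\<not> (\<forall>i\<in>perp_zeros r S. k i = 0)" using i by auto
    then show ?thesis using False by (simp only: nbc_coeff_def if_False mult_zero_right)
  next
    case True
    have U: "(\<Union>\<rho>\<in>?R. class_of r S \<rho>) = {..<r}" using union_classes[of r S] True by simp
    have sc: "(\<Prod>i\<in>{..<r} - perp_zeros r S. class_scale r \<phi> S i ^ k i) = 1"
    proof (rule prod.neutral, rule ballI)
      fix i assume i: "i \<in> {..<r} - perp_zeros r S"
      then have "class_scale r \<phi> S i \<in> {1, -1}" by (intro class_scale_in) auto
      moreover have "even (k i)" using k i by simp
      ultimately show "class_scale r \<phi> S i ^ k i = 1" by auto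
    qed
    have sc: "(\<Prod>i<r. class_scale r \<phi> S i ^ k i) = 1" using sc unfolding True by simp
    have bc: "block_coeff (class_of r S \<rho>) h k = (-1) ^ (card (class_of r S \<rho>) - 1) * h (sum k (class_of r S \<rho>))"
      if r: "\<rho> \<in> ?R" for \<rho> h
    proof -
      have "k \<rho> \<noteq> 0" using k[of \<rho>] r by (simp add: class_reps_def)
      then have a: "\<not> (\<forall>i\<in>class_of r S \<rho>. k i = 0)" using rep_in_class_of[OF r] by auto
      have b: "\<forall>i\<in>class_of r S \<rho>. 1 \<le> k i" using k by (force simp: class_of_def)
      show ?thesis unfolding block_coeff_def if_not_P[OF a] if_P[OF b] ..
    qed
    have "(\<Sum>\<rho>\<in>?R. card (class_of r S \<rho>)) = r"
    proof -
      have "card (\<Union>\<rho>\<in>?R. class_of r S \<rho>) = (\<Sum>\<rho>\<in>?R. card (class_of r S \<rho>))"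
        by (rule card_UN_disjoint) (auto simp: finite_class_reps finite_class_of class_of_def)
      then show ?thesis unfolding U by simp
    qed
    moreover have "(\<Sum>\<rho>\<in>?R. card (class_of r S \<rho>)) = (\<Sum>\<rho>\<in>?R. (card (class_of r S \<rho>) - 1) + 1)"
    proof (rule sum.cong[OF refl])
      fix \<rho> assume r: "\<rho> \<in> ?R"
      have "0 < card (class_of r S \<rho>)" using rep_in_class_of[OF r] finite_class_of[of r S \<rho>] by (auto simp: card_gt_0_iff)
      then show "card (class_of r S \<rho>) = (card (class_of r S \<rho>) - 1) + 1" by simp
    qed
    ultimately have "(\<Sum>\<rho>\<in>?R. card (class_of r S \<rho>) - 1) + card ?R = r" by (simp only: sum.distrib card_eq_sum)
    then have "(\<Sum>\<rho>\<in>?R. card (class_of r S \<rho>) - 1) = card S" using card_nbc_class_reps[OF nus S] by simp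
    then have sg: "(\<Prod>\<rho>\<in>?R. (-1 :: complex) ^ (card (class_of r S \<rho>) - 1)) = (-1) ^ card S"
      by (simp flip: power_sum)
    have pr: "(\<Prod>\<rho>\<in>?R. block_coeff (class_of r S \<rho>) h k) = (-1) ^ card S * (\<Prod>\<rho>\<in>?R. h (sum k (class_of r S \<rho>)))" for h
    proof -
      have "(\<Prod>\<rho>\<in>?R. block_coeff (class_of r S \<rho>) h k) =
          (\<Prod>\<rho>\<in>?R. (-1) ^ (card (class_of r S \<rho>) - 1) * h (sum k (class_of r S \<rho>)))"
        by (rule prod.cong[OF refl]) (rule bc)
      then show ?thesis unfolding prod.distrib sg .
    qed
    have "(-1 :: complex) ^ card S * (-1) ^ card S = 1" by (simp flip: power_add mult_2)
    then show ?thesis using True by (simp add: nbc_coeff_def sc pr flip: distrib_left mult.assoc)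
  qed
qed

lemma regular_iff:
  assumes "n \<in> parity_points r e"
  shows "(\<exists>\<beta>\<in>long_posroots_B r. ip r \<beta> (\<lambda>i. real_of_int (n i)) = 0) \<longleftrightarrow> \<not> inj_on (\<lambda>i. \<bar>n i\<bar>) {..<r}"
proof
  assume "\<exists>\<beta>\<in>long_posroots_B r. ip r \<beta> (\<lambda>i. real_of_int (n i)) = 0"
  then obtain \<beta> where "\<beta> \<in> long_posroots_B r" and z: "ip r \<beta> (\<lambda>i. real_of_int (n i)) = 0" by blast
  then obtain i j \<sigma> where b: "\<beta> = (\<lambda>k. unitv i k + \<sigma> * unitv j k)" "i < j" "j < r" "\<sigma> \<in> {1, -1}"
    by (elim long_posroots_cases)
  have "real_of_int (n i) + \<sigma> * real_of_int (n j) = 0" using z b by (simp add: ip_long_root)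
  then have "real_of_int (n i) = - real_of_int (n j) \<or> real_of_int (n i) = real_of_int (n j)" using b(4) by auto
  then have "n i = - n j \<or> n i = n j" by linarith
  then have "\<bar>n i\<bar> = \<bar>n j\<bar>" by auto
  then show "\<not> inj_on (\<lambda>i. \<bar>n i\<bar>) {..<r}" using b(2,3) unfolding inj_on_def by (metis lessThan_iff less_trans nat_less_le)
next
  assume "\<not> inj_on (\<lambda>i. \<bar>n i\<bar>) {..<r}"
  then obtain i j where ij: "i < j" "j < r" "\<bar>n i\<bar> = \<bar>n j\<bar>"
    unfolding inj_on_def by (metis lessThan_iff linorder_neqE_nat)
  then have "n i = n j \<or> n i = - n j" by (simp add: abs_eq_iff)
  then obtain \<sigma> :: real where s: "\<sigma> \<in> {1, -1}" "real_of_int (n i) + \<sigma> * real_of_int (n j) = 0"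
    by (metis (no_types, opaque_lifting) add.right_inverse insertI1 insertI2 mult.left_neutral mult_minus1 of_int_minus add.left_inverse)
  have "(\<lambda>k. unitv i k + \<sigma> * unitv j k) \<in> long_posroots_B r"
    unfolding long_posroots_B_def using ij s(1) by blast
  moreover have "ip r (\<lambda>k. unitv i k + \<sigma> * unitv j k) (\<lambda>i. real_of_int (n i)) = 0"
    using ij s(2) by (simp add: ip_long_root)
  ultimately show "\<exists>\<beta>\<in>long_posroots_B r. ip r \<beta> (\<lambda>i. real_of_int (n i)) = 0" by blast
qed

text \<open>In \<open>series_coeff_even\<close> the term of S carries no sign. As a sum over points
  it acquires (-1)^|R|, one minus sign for each class, so weighting it by (-1)^|S| yields (-1)^r for
  every S. After interchanging the sums, a point is weighted by the alternating sum over the sets S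
  orthogonal to it, which is 1 at regular points and 0 elsewhere.\<close>

lemma series_coeff_regular_sum:
  assumes dist: "distinct nus" and nus: "set nus = long_posroots_B r" and r0: "1 \<le> r"
    and k: "\<And>i. i < r \<Longrightarrow> even (k i) \<and> 2 \<le> k i"
  shows "(recip_monomial r k has_sum ((-1) ^ r * series_coeff r \<phi> nus k)) (regular_points r)"
proof -
  let ?N = "nbc_sets r nus"
  let ?P = "\<lambda>S n. (\<lambda>i. real_of_int (n i)) \<in> perp r S"
  let ?c = "\<lambda>e S. if perp_zeros r S = {} then \<Prod>\<rho>\<in>class_reps r S. parity_coeff e (sum k (class_of r S \<rho>)) else 0"
  have each: "((\<lambda>n. if ?P S n then recip_monomial r k n else 0) has_sum ((-1) ^ card (class_reps r S) * ?c e S)) (parity_points r e)"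
    if S: "S \<in> ?N" for S e
  proof (cases "perp_zeros r S = {}")
    case True
    have SA: "S \<subseteq> long_posroots_B r" using S by (auto simp: nbc_sets_def)
    have "(recip_monomial r k has_sum ((-1) ^ card (class_reps r S) * ?c e S)) {n \<in> parity_points r e. ?P S n}"
      using perp_points_has_sum[OF SA True k, where e = e] True
      by (simp add: prod_uminus)
    then show ?thesis
      by (rule iffD1[OF has_sum_cong_neutral, rotated -1]) auto
  next
    case False
    \<comment> \<open>A set S that forces a coordinate to vanish has no point with nonzero
      coordinates in its complement, so both sides are 0.\<close>
    have "\<not> ?P S n" if n: "n \<in> parity_points r e" for n
    proof
      assume p: "?P S n"
      obtain i where i: "i \<in> perp_zeros r S" using False by blast
      then have "real_of_int (n i) = 0" using p by (auto simp: perp_zeros_def)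
      moreover have "i < r" using i by (simp add: perp_zeros_def)
      ultimately show False using n by (simp add: parity_points_def)
    qed
    then show ?thesis using False by (auto intro!: has_sum_0)
  qed
  have par: "((\<lambda>n. if inj_on (\<lambda>i. \<bar>n i\<bar>) {..<r} then recip_monomial r k n else 0) has_sum
      (\<Sum>S\<in>?N. (-1) ^ card S * ((-1) ^ card (class_reps r S) * ?c e S))) (parity_points r e)" for e
  proof -
    have "((\<lambda>n. \<Sum>S\<in>?N. (-1) ^ card S * (if ?P S n then recip_monomial r k n else 0)) has_sum
      (\<Sum>S\<in>?N. (-1) ^ card S * ((-1) ^ card (class_reps r S) * ?c e S))) (parity_points r e)"
      by (intro has_sum_finite_sum[OF finite_nbc_sets] has_sum_cmult_right each)
    then show ?thesis
    proof (rule iffD1[OF has_sum_cong, rotated])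
      fix n assume n: "n \<in> parity_points r e"
      have inV: "inV r (\<lambda>i. real_of_int (n i))" using n by (simp add: parity_points_def supp_in_def inV_def)
      have "(\<Sum>S\<in>?N. (-1) ^ card S * (if ?P S n then recip_monomial r k n else 0)) =
         (\<Sum>S\<in>{S \<in> ?N. \<forall>\<beta>\<in>S. ip r \<beta> (\<lambda>i. real_of_int (n i)) = 0}. (-1) ^ card S * recip_monomial r k n)"
        by (rule sum.mono_neutral_cong_right) (auto simp: finite_nbc_sets perp_def inV)
      also have "\<dots> = (\<Sum>S\<in>{S \<in> ?N. \<forall>\<beta>\<in>S. ip r \<beta> (\<lambda>i. real_of_int (n i)) = 0}. (-1) ^ card S) * recip_monomial r k n"
        by (simp only: sum_distrib_right)
      also have "\<dots> = (if inj_on (\<lambda>i. \<bar>n i\<bar>) {..<r} then recip_monomial r k n else 0)"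
        unfolding nbc_alternating_sum[OF dist nus] regular_iff[OF n] by simp
      finally show "(\<Sum>S\<in>?N. (-1) ^ card S * (if ?P S n then recip_monomial r k n else 0)) =
         (if inj_on (\<lambda>i. \<bar>n i\<bar>) {..<r} then recip_monomial r k n else 0)" .
    qed
  qed
  have sg: "(-1 :: complex) ^ card S * ((-1) ^ card (class_reps r S) * x) = (-1) ^ r * x" if "S \<in> ?N" for S x
    unfolding mult.assoc[symmetric] power_add[symmetric] card_nbc_class_reps[OF nus that] ..
  have par': "((\<lambda>n. if inj_on (\<lambda>i. \<bar>n i\<bar>) {..<r} then recip_monomial r k n else 0) has_sum
      (-1) ^ r * (\<Sum>S\<in>?N. ?c e S)) (parity_points r e)" for e
    using par[of e] sg by (simp add: sum_distrib_left cong: sum.cong)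
  \<comment> \<open>Disjointness is seen at coordinate 0, which exists because r is
    positive.\<close>
  have disj: "parity_points r True \<inter> parity_points r False = {}"
  proof -
    have "0 < r" using r0 by simp
    then show ?thesis by (auto simp: parity_points_def)
  qed
  have sub: "regular_points r \<subseteq> parity_points r True \<union> parity_points r False"
  proof
    fix n assume n: "n \<in> regular_points r"
    have "0 < r" using r0 by simp
    then have "\<forall>i<r. even (n i) \<longleftrightarrow> even (n 0)" using n unfolding regular_points_def by blast
    then show "n \<in> parity_points r True \<union> parity_points r False"
      using n by (cases "even (n 0)") (auto simp: regular_points_def parity_points_def)
  qed
  have "((\<lambda>n. if inj_on (\<lambda>i. \<bar>n i\<bar>) {..<r} then recip_monomial r k n else 0) has_sum
      ((-1) ^ r * (\<Sum>S\<in>?N. ?c True S) + (-1) ^ r * (\<Sum>S\<in>?N. ?c False S))) (parity_points r True \<union> parity_points r False)"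
    by (rule has_sum_Un_disjoint[OF par' par' disj])
  also have "(-1) ^ r * (\<Sum>S\<in>?N. ?c True S) + (-1) ^ r * (\<Sum>S\<in>?N. ?c False S) = (-1) ^ r * (\<Sum>S\<in>?N. ?c True S + ?c False S)"
    by (simp only: distrib_left sum.distrib)
  also have "(\<Sum>S\<in>?N. ?c True S + ?c False S) = series_coeff r \<phi> nus k"
    by (subst series_coeff_even[OF nus], erule k, rule sum.cong) (auto simp: parity_coeff_def)
  finally show ?thesis
  proof (rule iffD1[OF has_sum_cong_neutral, rotated -1])
    fix n assume "n \<in> regular_points r - (parity_points r True \<union> parity_points r False)"
    then have False using sub by auto
    then show "recip_monomial r k n = 0" ..
  qed (auto simp: regular_points_def parity_points_def)
qed


section \<open>Multiplicities and reordering\<close>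

text \<open>Run-length decoding as it appears inside \<open>Aset\<close>, isolated so that it can be
  inverted.\<close>

definition run_list :: "'a list \<Rightarrow> nat list \<Rightarrow> 'a list" where
  "run_list hs J = concat (map (\<lambda>(h, j). replicate j h) (zip hs J))"

lemma run_list_Nil [simp]: "run_list [] J = []"
  by (simp add: run_list_def)

lemma run_list_Cons [simp]: "run_list (h # hs) (j # J) = replicate j h @ run_list hs J"
  by (simp add: run_list_def)

lemma set_run_list_subset: "set (run_list hs J) \<subseteq> set hs"
  by (auto simp: run_list_def dest: set_zip_leftD)

lemma length_run_list: "length hs = length J \<Longrightarrow> length (run_list hs J) = sum_list J"
  by (induction hs J rule: list_induct2) auto

lemma set_run_list: "length hs = length J \<Longrightarrow> \<forall>j\<in>set J. 0 < j \<Longrightarrow> set (run_list hs J) = set hs"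
  by (induction hs J rule: list_induct2) auto

lemma sorted_run_list:
  "length hs = length J \<Longrightarrow> sorted_wrt (<) hs \<Longrightarrow> sorted (run_list hs (J :: nat list) :: nat list)"
proof (induction hs J rule: list_induct2)
  case (Cons h hs j J)
  then show ?case using set_run_list_subset[of hs J]
    by (auto simp: sorted_append sorted_replicate intro: less_imp_le)
qed simp

lemma count_run_list:
  "length hs = length J \<Longrightarrow> distinct hs \<Longrightarrow> map (count_list (run_list hs J)) hs = J"
proof (induction hs J rule: list_induct2)
  case (Cons h hs j J)
  have rep: "count_list (replicate j h) x = (if x = h then j else 0)" for x
    by (induction j) auto
  have "h \<notin> set (run_list hs J)" using set_run_list_subset[of hs J] Cons.prems by auto
  then have 0: "count_list (run_list hs J) h = 0" by (simp add: count_list_0_iff)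
  have "map (count_list (replicate j h @ run_list hs J)) hs = map (count_list (run_list hs J)) hs"
    using Cons.prems by (intro map_cong) (auto simp: rep)
  also have "\<dots> = J" using Cons by simp
  finally have m: "map (count_list (replicate j h @ run_list hs J)) hs = J" .
  show ?case unfolding run_list_Cons list.map m by (simp add: rep 0)
qed simp

text \<open>Both lists have the same counts, hence the same multiset, and a sorted list is
  determined by its multiset.\<close>

lemma run_list_counts:
  assumes "sorted (k :: nat list)"
  shows "run_list (sorted_list_of_set (set k)) (map (count_list k) (sorted_list_of_set (set k))) = k"
proof -
  let ?hs = "sorted_list_of_set (set k)"
  let ?J = "map (count_list k) ?hs"
  have hs: "sorted_wrt (<) ?hs" "distinct ?hs" "set ?hs = set k" by simp_all
  have J: "\<forall>j\<in>set ?J. 0 < j" by (auto simp: count_list_0_iff intro!: gr0I)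
  have "count_list (run_list ?hs ?J) x = count_list k x" for x
  proof (cases "x \<in> set k")
    case True
    have "map (count_list (run_list ?hs ?J)) ?hs = ?J" by (rule count_run_list) (use hs in simp_all)
    then show ?thesis using True hs(3) by (simp add: map_eq_conv)
  next
    case False
    then have "x \<notin> set (run_list ?hs ?J)" using set_run_list_subset[of ?hs ?J] hs(3) by auto
    then show ?thesis using False by (simp add: count_list_0_iff)
  qed
  then have "mset (run_list ?hs ?J) = mset k" by (intro multiset_eqI) (simp add: count_mset)
  moreover have "sorted (run_list ?hs ?J)" by (rule sorted_run_list) (use hs in simp_all)
  ultimately show ?thesis using assms by (metis properties_for_sort)
qed

lemma finite_compositions: "finite (compositions r)"
proof (rule finite_subset)
  show "compositions r \<subseteq> {J. set J \<subseteq> {..r} \<and> length J \<le> r}"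
  proof
    fix J assume J: "J \<in> compositions r"
    then have s: "sum_list J = r" and p: "\<forall>j\<in>set J. 0 < j" by (auto simp: compositions_def)
    have "length J \<le> sum_list J" using p by (induction J) auto
    moreover have "j \<le> sum_list J" if "j \<in> set J" for j by (rule member_le_sum_list) (use that in auto)
    ultimately show "J \<in> {J. set J \<subseteq> {..r} \<and> length J \<le> r}" using s by auto
  qed
  show "finite {J. set J \<subseteq> {..r} \<and> length J \<le> r}" by (rule finite_lists_length_le) simp
qed

definition part_lists :: "nat \<Rightarrow> nat \<Rightarrow> nat list set" where
  "part_lists r N = {a. length a = r \<and> (\<forall>x\<in>set a. 1 \<le> x) \<and> sum_list a = N}"

lemma finite_part_lists: "finite (part_lists r N)"
proof (rule finite_subset)
  show "part_lists r N \<subseteq> {a. set a \<subseteq> {..N} \<and> length a = r}"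
    using member_le_sum_list by (auto simp: part_lists_def)
  show "finite {a. set a \<subseteq> {..N} \<and> length a = r}" by (rule finite_lists_length_eq) simp
qed

text \<open>The composition is forced by the list: it records the multiplicities in increasing order
  of the values. So, as J runs through the compositions, the sets \<open>Aset N J\<close> partition
  the sorted lists.\<close>

lemma Aset_iff:
  assumes J: "J \<in> compositions r"
  shows "k \<in> Aset N J \<longleftrightarrow> k \<in> part_lists r N \<and> sorted k \<and> J = map (count_list k) (sorted_list_of_set (set k))"
proof
  assume "k \<in> Aset N J"
  then obtain hs where k: "k = run_list hs J" and hs: "length hs = length J" "sorted_wrt (<) hs" "\<forall>h\<in>set hs. 1 \<le> h"
    and N: "sum_list k = N" unfolding Aset_def run_list_def by blast
  have Jp: "\<forall>j\<in>set J. 0 < j" "sum_list J = r" using J by (auto simp: compositions_def)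
  have "set k = set hs" unfolding k by (rule set_run_list[OF hs(1) Jp(1)])
  moreover have "distinct hs" "sorted hs" using hs(2) by (auto simp: strict_sorted_iff)
  ultimately have "sorted_list_of_set (set k) = hs" by (simp add: sorted_list_of_set_sort_remdups distinct_remdups_id sorted_sort_id)
  moreover have "map (count_list k) hs = J" unfolding k by (rule count_run_list[OF hs(1) \<open>distinct hs\<close>])
  moreover have "sorted k" unfolding k by (rule sorted_run_list[OF hs(1,2)])
  moreover have "length k = r" unfolding k using length_run_list[OF hs(1)] Jp(2) by simp
  ultimately show "k \<in> part_lists r N \<and> sorted k \<and> J = map (count_list k) (sorted_list_of_set (set k))"
    using N hs(3) \<open>set k = set hs\<close> by (simp add: part_lists_def)
next
  assume k: "k \<in> part_lists r N \<and> sorted k \<and> J = map (count_list k) (sorted_list_of_set (set k))"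
  let ?hs = "sorted_list_of_set (set k)"
  have e: "k = run_list ?hs J" using run_list_counts[of k] k by simp
  have "length ?hs = length J" using k by (metis length_map)
  moreover have "sorted_wrt (<) ?hs" by simp
  moreover have "\<forall>h\<in>set ?hs. 1 \<le> h" "sum_list k = N" using k by (auto simp: part_lists_def)
  ultimately show "k \<in> Aset N J"
    unfolding Aset_def run_list_def[symmetric] using e by (intro CollectI exI[of _ ?hs]) simp
qed

lemma counts_composition:
  assumes "k \<in> part_lists r N" "sorted k"
  shows "map (count_list k) (sorted_list_of_set (set k)) \<in> compositions r"
proof -
  let ?hs = "sorted_list_of_set (set k)"
  let ?J = "map (count_list k) ?hs"
  have "\<forall>j\<in>set ?J. 0 < j" by (auto simp: count_list_0_iff intro!: gr0I)
  moreover have "sum_list ?J = r"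
    using length_run_list[of ?hs ?J] run_list_counts[OF assms(2)] assms(1) by (simp add: part_lists_def)
  ultimately show ?thesis by (simp add: compositions_def)
qed

text \<open>A symmetric term is constant on the rearrangements of a sorted list. Their number is the
  multinomial coefficient whose denominator is the product of the factorials of the parts of
  J.\<close>

lemma sum_part_lists_symmetric:
  fixes T :: "nat list \<Rightarrow> complex"
  assumes sym: "\<And>a b. a \<in> part_lists r N \<Longrightarrow> mset a = mset b \<Longrightarrow> T a = T b"
  shows "(\<Sum>a\<in>part_lists r N. T a) =
    fact r * (\<Sum>J\<in>compositions r. 1 / (\<Prod>j\<leftarrow>J. fact j) * (\<Sum>k\<in>Aset N J. T k))"
proof -
  let ?L = "part_lists r N"
  define S where "S = {k \<in> ?L. sorted k}"
  let ?p = "\<lambda>k. \<Prod>x\<in>set k. fact (count_list k x) :: complex"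
  have sL: "sort a \<in> ?L" if "a \<in> ?L" for a
    using that by (simp add: part_lists_def flip: sum_mset_sum_list)
  have im: "sort ` ?L = S"
    using sL by (force simp: S_def image_iff sorted_sort_id)
  have fiber: "(\<Sum>a\<in>{a \<in> ?L. sort a = k}. T a) = fact r * (1 / ?p k * T k)" if k: "k \<in> S" for k
  proof -
    have kL: "k \<in> ?L" "sorted k" using k by (auto simp: S_def)
    have "{a \<in> ?L. sort a = k} = permutations_of_multiset (mset k)"
    proof
      show "{a \<in> ?L. sort a = k} \<subseteq> permutations_of_multiset (mset k)"
        by (auto simp: permutations_of_multiset_def)
      show "permutations_of_multiset (mset k) \<subseteq> {a \<in> ?L. sort a = k}"
      proof
        fix a assume "a \<in> permutations_of_multiset (mset k)"
        then have m: "mset a = mset k" by (simp add: permutations_of_multiset_def)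
        have "set a = set k" "length a = length k" "sum_list a = sum_list k"
          using m by (auto dest: mset_eq_setD mset_eq_length) (metis sum_mset_sum_list)
        moreover have "sort a = k" using m kL(2) by (metis properties_for_sort)
        ultimately show "a \<in> {a \<in> ?L. sort a = k}" using kL by (simp add: part_lists_def)
      qed
    qed
    then have "(\<Sum>a\<in>{a \<in> ?L. sort a = k}. T a) = (\<Sum>a\<in>permutations_of_multiset (mset k). T k)"
    proof (rule sum.cong)
      fix a assume "a \<in> permutations_of_multiset (mset k)"
      then have "mset k = mset a" by (simp add: permutations_of_multiset_def)
      from sym[OF kL(1) this] show "T a = T k" ..
    qed
    also have "\<dots> = of_nat (card (permutations_of_multiset (mset k))) * T k" by simp
    also have "of_nat (card (permutations_of_multiset (mset k))) = fact r / ?p k"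
    proof -
      have "of_nat (card (permutations_of_multiset (mset k)) * (\<Prod>x\<in>set k. fact (count_list k x))) = (of_nat (fact r) :: complex)"
        using card_permutations_of_multiset_aux[of "mset k"] kL(1) by (simp add: count_mset part_lists_def)
      then have "of_nat (card (permutations_of_multiset (mset k))) * ?p k = fact r" by simp
      moreover have "?p k \<noteq> 0" by simp
      ultimately show ?thesis by (simp add: nonzero_eq_divide_eq)
    qed
    finally show ?thesis by simp
  qed
  have "(\<Sum>a\<in>?L. T a) = (\<Sum>k\<in>sort ` ?L. \<Sum>a\<in>{a \<in> ?L. sort a = k}. T a)"
    by (rule sum.image_gen[OF finite_part_lists])
  also have "\<dots> = fact r * (\<Sum>k\<in>S. 1 / ?p k * T k)"
    unfolding im by (simp add: fiber sum_distrib_left)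
  also have "(\<Sum>k\<in>S. 1 / ?p k * T k) = (\<Sum>(J, k)\<in>Sigma (compositions r) (Aset N). 1 / (\<Prod>j\<leftarrow>J. fact j) * T k)"
  proof (rule sum.reindex_bij_witness[where i = snd and j = "\<lambda>k. (map (count_list k) (sorted_list_of_set (set k)), k)"])
    fix k assume k: "k \<in> S"
    then show "(map (count_list k) (sorted_list_of_set (set k)), k) \<in> Sigma (compositions r) (Aset N)"
      using counts_composition[of k r N] Aset_iff[of _ r k N] by (auto simp: S_def)
    have "(\<Prod>j\<leftarrow>map (count_list k) (sorted_list_of_set (set k)). fact j :: complex) =
       (\<Prod>x\<leftarrow>sorted_list_of_set (set k). fact (count_list k x))" by (simp add: o_def)
    also have "\<dots> = ?p k" using prod.distinct_set_conv_list[of "sorted_list_of_set (set k)" "\<lambda>x. fact (count_list k x) :: complex"] by simp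
    finally show "(case (map (count_list k) (sorted_list_of_set (set k)), k) of (J, k) \<Rightarrow> 1 / (\<Prod>j\<leftarrow>J. fact j) * T k) = 1 / ?p k * T k"
      by simp
  next
    fix b assume "b \<in> Sigma (compositions r) (Aset N)"
    then obtain J k where b: "b = (J, k)" "J \<in> compositions r" "k \<in> Aset N J" by blast
    then show "snd b \<in> S" "(map (count_list (snd b)) (sorted_list_of_set (set (snd b))), snd b) = b"
      using Aset_iff[OF b(2), of k N] by (auto simp: S_def)
  qed simp
  also have "\<dots> = (\<Sum>J\<in>compositions r. \<Sum>k\<in>Aset N J. 1 / (\<Prod>j\<leftarrow>J. fact j) * T k)"
  proof (rule sum.Sigma[symmetric])
    show "\<forall>J\<in>compositions r. finite (Aset N J)"
    proof
      fix J assume "J \<in> compositions r"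
      then have "Aset N J \<subseteq> part_lists r N" using Aset_iff by blast
      then show "finite (Aset N J)" using finite_part_lists by (rule finite_subset)
    qed
  qed (rule finite_compositions)
  finally show ?thesis by (simp add: sum_distrib_left)
qed

section \<open>Signed permutations of the summation points\<close>

text \<open>A fundamental domain for the signed permutations acting on
  \<open>regular_points\<close>. By \<open>sharp_points_has_sum\<close> it is also the set of
  vectors formed by the bases of the powers in \<open>zeta_sharp\<close>.\<close>

definition increasing_points :: "nat \<Rightarrow> (nat \<Rightarrow> int) set" where
  "increasing_points r = {n \<in> supp_in {..<r}. (\<forall>i<r. 0 < n i) \<and> strict_mono_on {..<r} n \<and>
     (\<forall>i<r. \<forall>j<r. even (n i) \<longleftrightarrow> even (n j))}"

lemma increasing_pointsD:
  assumes n: "n \<in> increasing_points r"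
  shows "i < r \<Longrightarrow> 0 < n i" and "\<not> i < r \<Longrightarrow> n i = 0" and "strict_mono_on {..<r} n"
    and "i < r \<Longrightarrow> j < r \<Longrightarrow> even (n i) \<longleftrightarrow> even (n j)" and "inj_on n {..<r}"
proof -
  show "i < r \<Longrightarrow> 0 < n i" "\<not> i < r \<Longrightarrow> n i = 0" "strict_mono_on {..<r} n"
    using n by (simp_all add: increasing_points_def supp_in_def)
  then show "inj_on n {..<r}" by (intro strict_mono_on_imp_inj_on)
  show "i < r \<Longrightarrow> j < r \<Longrightarrow> even (n i) \<longleftrightarrow> even (n j)"
    using n unfolding increasing_points_def by blast
qed

lemma regular_pointsD:
  assumes n: "n \<in> regular_points r"
  shows "i < r \<Longrightarrow> n i \<noteq> 0" and "\<not> i < r \<Longrightarrow> n i = 0" and "inj_on (\<lambda>i. \<bar>n i\<bar>) {..<r}"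
    and "i < r \<Longrightarrow> j < r \<Longrightarrow> even (n i) \<longleftrightarrow> even (n j)"
proof -
  show "i < r \<Longrightarrow> n i \<noteq> 0" "\<not> i < r \<Longrightarrow> n i = 0" "inj_on (\<lambda>i. \<bar>n i\<bar>) {..<r}"
    using n by (simp_all add: regular_points_def supp_in_def)
  show "i < r \<Longrightarrow> j < r \<Longrightarrow> even (n i) \<longleftrightarrow> even (n j)"
    using n unfolding regular_points_def by blast
qed

lemma regular_pointsI:
  assumes "\<And>i. i < r \<Longrightarrow> n i \<noteq> 0" "\<And>i. \<not> i < r \<Longrightarrow> n i = 0" "inj_on (\<lambda>i. \<bar>n i\<bar>) {..<r}"
    "\<And>i j. i < r \<Longrightarrow> j < r \<Longrightarrow> even (n i) \<longleftrightarrow> even (n j)"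
  shows "n \<in> regular_points r"
  unfolding regular_points_def supp_in_def using assms by blast

lemma increasing_regular: "increasing_points r \<subseteq> regular_points r"
proof
  fix n assume n: "n \<in> increasing_points r"
  have inj: "inj_on (\<lambda>i. \<bar>n i\<bar>) {..<r}"
  proof (rule inj_onI)
    fix i j assume ij: "i \<in> {..<r}" "j \<in> {..<r}" "\<bar>n i\<bar> = \<bar>n j\<bar>"
    then have "n i = n j" using increasing_pointsD(1)[OF n, of i] increasing_pointsD(1)[OF n, of j] by simp
    then show "i = j" using increasing_pointsD(5)[OF n] ij by (auto dest: inj_onD)
  qed
  have "n i \<noteq> 0" if "i < r" for i using increasing_pointsD(1)[OF n that] by simp
  then show "n \<in> regular_points r"
    by (rule regular_pointsI[OF _ increasing_pointsD(2)[OF n] inj increasing_pointsD(4)[OF n]])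
qed

lemma strict_mono_on_image_unique:
  fixes f g :: "nat \<Rightarrow> int"
  assumes f: "strict_mono_on {..<r} f" and g: "strict_mono_on {..<r} g" and im: "f ` {..<r} = g ` {..<r}" and i: "i < r"
  shows "f i = g i"
proof -
  have s: "sorted (map h [0..<r]) \<and> distinct (map h [0..<r])" if "strict_mono_on {..<r} h" for h :: "nat \<Rightarrow> int"
    using that by (auto simp: sorted_iff_nth_mono distinct_map strict_mono_on_imp_inj_on atLeast0LessThan strict_mono_on_leD)
  have "map f [0..<r] = map g [0..<r]"
    using s[OF f] s[OF g] im by (intro sorted_distinct_set_unique) (auto simp: atLeast0LessThan)
  then show ?thesis using i by (simp add: map_eq_conv)
qed

definition signed_perm :: "nat \<Rightarrow> (nat \<Rightarrow> int) \<Rightarrow> (nat \<Rightarrow> nat) \<Rightarrow> (nat \<Rightarrow> int) \<Rightarrow> nat \<Rightarrow> int" where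
  "signed_perm r n p s = (\<lambda>i. if i < r then s i * n (p i) else 0)"

text \<open>The hyperoctahedral group acts freely here: absolute values are nonzero and distinct, so
  a regular point determines their increasing enumeration \<open>n\<close>, the rank of each
  coordinate as \<open>p\<close>, and its sign as \<open>s\<close>.\<close>

lemma regular_points_bij:
  "bij_betw (\<lambda>(n, p, s). signed_perm r n p s)
     (increasing_points r \<times> ({p. p permutes {..<r}} \<times> PiE {..<r} (\<lambda>_. {1, -1}))) (regular_points r)"
proof (rule bij_betw_imageI)
  let ?D = "increasing_points r \<times> ({p. p permutes {..<r}} \<times> PiE {..<r} (\<lambda>_. {1, -1 :: int}))"
  have pl: "p i < r" if "p permutes {..<r}" "i < r" for p i using permutes_in_image[OF that(1), of i] that(2) by simp
  have sv: "s i = 1 \<or> s i = -1" if "s \<in> PiE {..<r} (\<lambda>_. {1, -1 :: int})" "i < r" for s i using PiE_mem[OF that(1), of i] that(2) by simp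
  show "inj_on (\<lambda>(n, p, s). signed_perm r n p s) ?D"
  proof (rule inj_onI)
    fix x y assume x: "x \<in> ?D" and y: "y \<in> ?D" and e: "(\<lambda>(n, p, s). signed_perm r n p s) x = (\<lambda>(n, p, s). signed_perm r n p s) y"
    obtain n p s n' p' s' where xy: "x = (n, p, s)" "y = (n', p', s')" by (cases x; cases y) blast
    have n: "n \<in> increasing_points r" "n' \<in> increasing_points r" and p: "p permutes {..<r}" "p' permutes {..<r}"
      and s: "s \<in> PiE {..<r} (\<lambda>_. {1, -1})" "s' \<in> PiE {..<r} (\<lambda>_. {1, -1})" using x y unfolding xy by auto
    have eq: "s i * n (p i) = s' i * n' (p' i)" if "i < r" for i
      using fun_cong[OF e, of i] that by (simp add: xy signed_perm_def)
    have pos: "0 < n (p i)" "0 < n' (p' i)" if "i < r" for i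
      using increasing_pointsD(1)[OF n(1) pl[OF p(1) that]] increasing_pointsD(1)[OF n(2) pl[OF p(2) that]] by auto
    have abs: "n (p i) = n' (p' i)" if "i < r" for i
      using eq[OF that] pos[OF that] sv[OF s(1) that] sv[OF s(2) that] by auto
    have "n ` {..<r} = (\<lambda>i. n (p i)) ` {..<r}" using permutes_image[OF p(1)] by (metis image_image)
    also have "\<dots> = (\<lambda>i. n' (p' i)) ` {..<r}" using abs by (intro image_cong) auto
    also have "\<dots> = n' ` {..<r}" using permutes_image[OF p(2)] by (metis image_image)
    finally have im: "n ` {..<r} = n' ` {..<r}" .
    have nn: "n = n'"
    proof
      fix i
      show "n i = n' i"
      proof (cases "i < r")
        case True
        then show ?thesis
          by (rule strict_mono_on_image_unique[OF increasing_pointsD(3)[OF n(1)] increasing_pointsD(3)[OF n(2)] im])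
      next
        case False then show ?thesis using increasing_pointsD(2)[OF n(1)] increasing_pointsD(2)[OF n(2)] by simp
      qed
    qed
    have inj: "inj_on n {..<r}" by (rule increasing_pointsD(5)[OF n(1)])
    have "p = p'"
    proof
      fix i
      show "p i = p' i"
      proof (cases "i < r")
        case True
        then show ?thesis using abs[OF True] pl[OF p(1) True] pl[OF p(2) True] inj nn by (auto dest: inj_onD)
      next
        case False then show ?thesis using p by (simp add: permutes_not_in)
      qed
    qed
    moreover have "s = s'"
    proof (rule PiE_ext[OF s])
      fix i assume "i \<in> {..<r}"
      then show "s i = s' i" using eq[of i] pos[of i] abs[of i] by simp
    qed
    ultimately show "x = y" using nn xy by simp
  qed
  show "(\<lambda>(n, p, s). signed_perm r n p s) ` ?D = regular_points r"
  proof
    show "(\<lambda>(n, p, s). signed_perm r n p s) ` ?D \<subseteq> regular_points r"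
    proof
      fix m assume "m \<in> (\<lambda>(n, p, s). signed_perm r n p s) ` ?D"
      then obtain n p s where m: "m = signed_perm r n p s" and n: "n \<in> increasing_points r" and p: "p permutes {..<r}"
        and s: "s \<in> PiE {..<r} (\<lambda>_. {1, -1})" by auto
      have mi: "m i = s i * n (p i)" if "i < r" for i using that by (simp add: m signed_perm_def)
      have mabs: "\<bar>m i\<bar> = n (p i)" "m i \<noteq> 0" "even (m i) \<longleftrightarrow> even (n (p i))" if "i < r" for i
        using mi[OF that] sv[OF s that] increasing_pointsD(1)[OF n pl[OF p that]] by auto
      show "m \<in> regular_points r"
      proof (rule regular_pointsI)
        show "inj_on (\<lambda>i. \<bar>m i\<bar>) {..<r}"
        proof (rule inj_onI)
          fix i j assume ij: "i \<in> {..<r}" "j \<in> {..<r}" "\<bar>m i\<bar> = \<bar>m j\<bar>"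
          then have "n (p i) = n (p j)" using mabs(1) by simp
          then have "p i = p j" using ij pl[OF p] increasing_pointsD(5)[OF n] by (auto dest: inj_onD)
          then show "i = j" using permutes_inj[OF p] by (auto dest: injD)
        qed
        show "even (m i) \<longleftrightarrow> even (m j)" if "i < r" "j < r" for i j
          unfolding mabs(3)[OF that(1)] mabs(3)[OF that(2)] by (rule increasing_pointsD(4)[OF n pl[OF p that(1)] pl[OF p that(2)]])
      qed (use mabs(2) in \<open>auto simp: m signed_perm_def\<close>)
    qed
    show "regular_points r \<subseteq> (\<lambda>(n, p, s). signed_perm r n p s) ` ?D"
    proof
      fix m assume m: "m \<in> regular_points r"
      let ?a = "\<lambda>i. \<bar>m i\<bar>"
      define M where "M = ?a ` {..<r}"
      define xs where "xs = sorted_list_of_set M"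
      have finM: "finite M" by (simp add: M_def)
      have inj: "inj_on ?a {..<r}" by (rule regular_pointsD(3)[OF m])
      have xs: "sorted_wrt (<) xs" "set xs = M" "length xs = r"
        using finM card_image[OF inj] by (auto simp: xs_def M_def)
      define n where "n i = (if i < r then xs ! i else 0)" for i
      have nmono: "strict_mono_on {..<r} n"
        using xs by (auto simp: strict_mono_on_def n_def sorted_wrt_iff_nth_less)
      have nim: "n ` {..<r} = M" using xs(2,3) by (auto simp: n_def set_conv_nth)
      \<comment> \<open>The identity beyond r is what \<open>permutes\<close> asks for.\<close>
      define p where "p i = (if i < r then inv_into {..<r} n (?a i) else i)" for i
      have np: "p i < r" "n (p i) = ?a i" if "i < r" for i
      proof -
        have "?a i \<in> n ` {..<r}" using nim that by (auto simp: M_def)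
        then show "p i < r" "n (p i) = ?a i" using that inv_into_into[of "?a i" n "{..<r}"] f_inv_into_f[of "?a i" n "{..<r}"]
          by (auto simp: p_def)
      qed
      have "inj_on p {..<r}"
      proof (rule inj_onI)
        fix i j assume "i \<in> {..<r}" "j \<in> {..<r}" "p i = p j"
        then have "?a i = ?a j" using np(2)[of i] np(2)[of j] by simp
        then show "i = j" using inj \<open>i \<in> {..<r}\<close> \<open>j \<in> {..<r}\<close> by (auto dest: inj_onD)
      qed
      moreover have "p ` {..<r} \<subseteq> {..<r}" using np by auto
      ultimately have "bij_betw p {..<r} {..<r}" by (simp add: bij_betw_def endo_inj_surj)
      then have pp: "p permutes {..<r}" by (rule bij_imp_permutes) (simp add: p_def)
      define s where "s = (\<lambda>i\<in>{..<r}. sgn (m i))"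
      have sP: "s \<in> PiE {..<r} (\<lambda>_. {1, -1})"
        using regular_pointsD(1)[OF m] by (auto simp: s_def sgn_if)
      have inM: "\<exists>j<r. n i = ?a j" if "i < r" for i using nim that unfolding M_def by (metis imageE imageI lessThan_iff)
      have "n \<in> increasing_points r"
        unfolding increasing_points_def
      proof (intro CollectI conjI allI impI nmono)
        show "n \<in> supp_in {..<r}" by (simp add: supp_in_def n_def)
        show "0 < n i" if "i < r" for i using inM[OF that] regular_pointsD(1)[OF m] by auto
        show "even (n i) \<longleftrightarrow> even (n j)" if ij: "i < r" "j < r" for i j
        proof -
          obtain i' j' where "i' < r" "n i = ?a i'" "j' < r" "n j = ?a j'" using inM[OF ij(1)] inM[OF ij(2)] by blast
          then show ?thesis using regular_pointsD(4)[OF m, of i' j'] by simp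
        qed
      qed
      moreover have "signed_perm r n p s = m"
      proof
        fix i
        show "signed_perm r n p s i = m i"
          using regular_pointsD(2)[OF m, of i] np(2)[of i] by (auto simp: signed_perm_def s_def sgn_mult_abs)
      qed
      ultimately show "m \<in> (\<lambda>(n, p, s). signed_perm r n p s) ` ?D"
        using pp sP by (intro image_eqI[of _ _ "(n, p, s)"]) auto
    qed
  qed
qed

text \<open>Orbit counting. The 2^r of the theorem originates here, while r! will cancel against the
  multinomial coefficients.\<close>

lemma regular_sum_symmetric:
  fixes G :: "(nat \<Rightarrow> int) \<Rightarrow> complex"
  assumes G: "(G has_sum A) (regular_points r)" and B: "(G has_sum B) (increasing_points r)"
    and sym: "\<And>n p s. p permutes {..<r} \<Longrightarrow> s \<in> PiE {..<r} (\<lambda>_. {1, -1}) \<Longrightarrow> n \<in> increasing_points r \<Longrightarrow>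
      G (signed_perm r n p s) = G n"
  shows "A = fact r * 2 ^ r * B"
proof -
  let ?E = "{p. p permutes {..<r}} \<times> PiE {..<r} (\<lambda>_. {1, -1 :: int})"
  have finE: "finite ?E" by (intro finite_cartesian_product finite_permutations finite_PiE) auto
  have cardE: "card ?E = fact r * 2 ^ r"
  proof -
    have "card {1, -1 :: int} = 2" by simp
    then have "card (PiE {..<r} (\<lambda>_. {1, -1 :: int})) = 2 ^ r" by (simp only: card_PiE finite_lessThan prod_constant card_lessThan)
    moreover have "card {p. p permutes {..<r}} = fact r" by (rule card_permutations) auto
    ultimately show ?thesis by (simp only: card_cartesian_product)
  qed
  have "((\<lambda>x. G ((\<lambda>(n, p, s). signed_perm r n p s) x)) has_sum A) (increasing_points r \<times> ?E)"
    using G has_sum_reindex_bij_betw[OF regular_points_bij, where f = G] by simp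
  then have "((\<lambda>(n, x). G n) has_sum A) (increasing_points r \<times> ?E)"
  proof (rule iffD1[OF has_sum_cong, rotated])
    fix x assume x: "x \<in> increasing_points r \<times> ?E"
    obtain n p s where e: "x = (n, p, s)" by (metis prod_cases3)
    have "G (signed_perm r n p s) = G n" using x unfolding e by (intro sym) auto
    then show "G ((\<lambda>(n, p, s). signed_perm r n p s) x) = (\<lambda>(n, x). G n) x" by (simp add: e)
  qed
  then have "((\<lambda>n. of_nat (card ?E) * G n) has_sum A) (increasing_points r)"
    by (rule has_sum_Sigma') (use finE in simp)
  moreover have "((\<lambda>n. of_nat (card ?E) * G n) has_sum (of_nat (card ?E) * B)) (increasing_points r)"
    by (rule has_sum_cmult_right[OF B])
  ultimately have "A = of_nat (card ?E) * B" by (rule has_sum_unique)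
  then show ?thesis unfolding cardE by simp
qed


section \<open>Monomials attached to lists of exponents\<close>

definition list_monomial :: "nat \<Rightarrow> nat \<Rightarrow> nat list \<Rightarrow> (nat \<Rightarrow> int) \<Rightarrow> complex" where
  "list_monomial r d a n = (\<Prod>i<r. 1 / of_int (n i) ^ (2 * d * a ! i))"

definition list_exponent :: "nat \<Rightarrow> nat \<Rightarrow> nat list \<Rightarrow> nat \<Rightarrow> nat" where
  "list_exponent r d a = (\<lambda>i. if i < r then 2 * d * a ! i else 0)"

lemma sum_list_exponent: "length a = r \<Longrightarrow> (\<Sum>i<r. list_exponent r d a i) = 2 * d * sum_list a"
  by (simp add: list_exponent_def sum_list_sum_nth atLeast0LessThan sum_distrib_left)

lemma list_exponent_even:
  assumes "a \<in> part_lists r N" "1 \<le> d" "i < r"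
  shows "even (list_exponent r d a i) \<and> 2 \<le> list_exponent r d a i"
proof -
  have "1 \<le> a ! i" using assms by (auto simp: part_lists_def)
  then have "1 * 1 \<le> d * a ! i" using assms by (intro mult_le_mono)
  then show ?thesis using assms(3) by (simp add: list_exponent_def)
qed

text \<open>The exponents add up to 2dN for every list, so clearing the factors 2 pi i costs the
  same constant for all of them.\<close>

lemma list_monomial_has_sum:
  assumes dist: "distinct nus" and nus: "set nus = long_posroots_B r" and r0: "1 \<le> r" and d: "1 \<le> d"
    and a: "a \<in> part_lists r N"
  shows "(list_monomial r d a has_sum
      ((2 * of_real pi * \<i>) ^ (2 * d * N) * ((-1) ^ r * series_coeff r \<phi> nus (list_exponent r d a)))) (regular_points r)"
proof -
  have len: "length a = r" "sum_list a = N" using a by (auto simp: part_lists_def)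
  have "((\<lambda>n. (2 * of_real pi * \<i>) ^ (2 * d * N) * recip_monomial r (list_exponent r d a) n) has_sum
      ((2 * of_real pi * \<i>) ^ (2 * d * N) * ((-1) ^ r * series_coeff r \<phi> nus (list_exponent r d a)))) (regular_points r)"
    by (intro has_sum_cmult_right series_coeff_regular_sum dist nus r0 list_exponent_even[OF a d])
  moreover have "(2 * of_real pi * \<i>) ^ (2 * d * N) * recip_monomial r (list_exponent r d a) n = list_monomial r d a n" for n
  proof -
    have "(2 * of_real pi * \<i> :: complex) ^ (2 * d * N) = (\<Prod>i<r. (2 * of_real pi * \<i>) ^ list_exponent r d a i)"
      using sum_list_exponent[OF len(1), of d] by (simp add: len(2) flip: power_sum)
    then show ?thesis
      unfolding recip_monomial_def list_monomial_def prod.distrib[symmetric]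
      by (simp add: prod.distrib[symmetric] list_exponent_def power_mult_distrib) 
  qed
  ultimately show ?thesis by simp
qed

lemma list_monomial_permute:
  assumes p: "p permutes {..<r}" and len: "length a = r"
  shows "list_monomial r d (permute_list p a) (\<lambda>i. n (p i)) = list_monomial r d a n"
proof -
  have "list_monomial r d (permute_list p a) (\<lambda>i. n (p i)) = (\<Prod>i<r. 1 / of_int (n (p i)) ^ (2 * d * a ! p i))"
    unfolding list_monomial_def by (rule prod.cong) (auto simp: permute_list_def len)
  also have "\<dots> = list_monomial r d a n"
    unfolding list_monomial_def
    by (rule prod.permute[OF p, of "\<lambda>i. 1 / complex_of_int (n i) ^ (2 * d * a ! i)", unfolded o_def, symmetric])
  finally show ?thesis .
qed

lemma regular_points_permute:
  assumes p: "p permutes {..<r}" and n: "n \<in> regular_points r"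
  shows "(\<lambda>i. n (p i)) \<in> regular_points r"
proof (rule regular_pointsI)
  have pl: "p i < r \<longleftrightarrow> i < r" for i using permutes_in_image[OF p, of i] by simp
  show "n (p i) \<noteq> 0" if "i < r" for i using regular_pointsD(1)[OF n] that pl by simp
  show "n (p i) = 0" if "\<not> i < r" for i using regular_pointsD(2)[OF n] that pl by simp
  show "even (n (p i)) \<longleftrightarrow> even (n (p j))" if "i < r" "j < r" for i j
    using regular_pointsD(4)[OF n, of "p i" "p j"] that pl by simp
  show "inj_on (\<lambda>i. \<bar>n (p i)\<bar>) {..<r}"
  proof (rule inj_onI)
    fix i j assume "i \<in> {..<r}" "j \<in> {..<r}" "\<bar>n (p i)\<bar> = \<bar>n (p j)\<bar>"
    then have "p i = p j" using regular_pointsD(3)[OF n] pl by (auto dest: inj_onD)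
    then show "i = j" using permutes_inj[OF p] by (auto dest: injD)
  qed
qed

text \<open>Reordering the exponents permutes coordinates, and \<open>regular_points\<close> is
  stable under that. Symmetry is obtained from the lattice sum because \<open>series_coeff\<close>
  is defined through the order \<open>nus\<close> and shows no symmetry by itself.\<close>

lemma list_monomial_sum_mset:
  assumes a: "length a = r" and m: "mset a = mset b"
  shows "(list_monomial r d a has_sum x) (regular_points r) \<longleftrightarrow> (list_monomial r d b has_sum x) (regular_points r)"
proof -
  obtain p where p0: "p permutes {..<length a}" "permute_list p a = b" using mset_eq_permutation[OF m[symmetric]] by blast
  then have p: "p permutes {..<r}" using a by simp
  show ?thesis
  proof (rule has_sum_reindex_bij_witness[where j = "\<lambda>n i. n (p i)" and i = "\<lambda>n i. n (inv p i)"])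
    fix n assume n: "n \<in> regular_points r"
    show "(\<lambda>i. n (p (inv p i))) = n" by (simp add: permutes_inverses[OF p])
    show "(\<lambda>i. n (inv p (p i))) = n" by (simp add: permutes_inverses[OF p])
    show "(\<lambda>i. n (p i)) \<in> regular_points r" by (rule regular_points_permute[OF p n])
    show "(\<lambda>i. n (inv p i)) \<in> regular_points r" by (rule regular_points_permute[OF permutes_inv[OF p] n])
    show "list_monomial r d b (\<lambda>i. n (p i)) = list_monomial r d a n"
      using list_monomial_permute[OF p a] p0(2) by simp
  qed simp
qed

text \<open>Permuting the coordinates of a point can be traded for permuting the exponents, which
  only reorders the sum over all lists; signs disappear in even powers. A single monomial has no
  such invariance, which is why the theorem concerns the total over all lists.\<close>

lemma part_lists_sum_signed_perm:
  assumes p: "p permutes {..<r}" and s: "s \<in> PiE {..<r} (\<lambda>_. {1, -1})"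
  shows "(\<Sum>a\<in>part_lists r N. list_monomial r d a (signed_perm r n p s)) = (\<Sum>a\<in>part_lists r N. list_monomial r d a n)"
proof -
  have e: "list_monomial r d a (signed_perm r n p s) = list_monomial r d a (\<lambda>i. n (p i))" for a
    unfolding list_monomial_def
  proof (rule prod.cong[OF refl])
    fix i assume i: "i \<in> {..<r}"
    have "s i = 1 \<or> s i = -1" using PiE_mem[OF s i] by simp
    then show "1 / complex_of_int (signed_perm r n p s i) ^ (2 * d * a ! i) = 1 / of_int (n (p i)) ^ (2 * d * a ! i)"
      using i by (auto simp: signed_perm_def power_minus_even)
  qed
  have L: "permute_list q a \<in> part_lists r N" if "q permutes {..<r}" "a \<in> part_lists r N" for q a
  proof -
    have q: "q permutes {..<length a}" using that by (simp add: part_lists_def)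
    have "mset (permute_list q a) = mset a" by (rule mset_permute_list[OF q])
    then have "set (permute_list q a) = set a" "sum_list (permute_list q a) = sum_list a"
      by (metis mset_eq_setD, metis sum_mset_sum_list)
    then show ?thesis using that by (simp add: part_lists_def)
  qed
  have pp: "permute_list q (permute_list q' a) = a" if "q permutes {..<r}" "a \<in> part_lists r N" "q' \<circ> q = id" for q q' a
  proof (rule nth_equalityI)
    have l: "length a = r" using that by (simp add: part_lists_def)
    show "length (permute_list q (permute_list q' a)) = length a" by simp
    fix i assume "i < length (permute_list q (permute_list q' a))"
    then have i: "i < r" using l by simp
    then have "q i < r" using permutes_in_image[OF that(1), of i] by simp
    then show "permute_list q (permute_list q' a) ! i = a ! i"
      using i l fun_cong[OF that(3), of i] by (simp add: permute_list_def)
  qed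
  have "(\<Sum>a\<in>part_lists r N. list_monomial r d a (signed_perm r n p s)) = (\<Sum>a\<in>part_lists r N. list_monomial r d a (\<lambda>i. n (p i)))"
    by (simp add: e)
  also have "\<dots> = (\<Sum>a\<in>part_lists r N. list_monomial r d a n)"
  proof (rule sum.reindex_bij_witness[where i = "permute_list p" and j = "permute_list (inv p)"])
    fix a assume a: "a \<in> part_lists r N"
    show "permute_list p (permute_list (inv p) a) = a" by (rule pp[OF p a]) (simp add: permutes_inv_o[OF p])
    show "permute_list (inv p) (permute_list p a) = a" by (rule pp[OF permutes_inv[OF p] a]) (simp add: permutes_inv_o[OF p])
    show "permute_list (inv p) a \<in> part_lists r N" by (rule L[OF permutes_inv[OF p] a])
    show "permute_list p a \<in> part_lists r N" by (rule L[OF p a])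
    have "length (permute_list (inv p) a) = r" using a by (simp add: part_lists_def)
    from list_monomial_permute[OF p this, of d n]
    show "list_monomial r d (permute_list (inv p) a) n = list_monomial r d a (\<lambda>i. n (p i))"
      using pp[OF p a, of "inv p"] by (simp add: permutes_inv_o[OF p])
  qed
  finally show ?thesis .
qed

section \<open>The summation points of \<open>zeta_sharp\<close>\<close>

definition sharp_points :: "nat \<Rightarrow> (nat \<Rightarrow> nat) set" where
  "sharp_points r = {m. (\<forall>i\<in>{1..r}. 1 \<le> m i) \<and> (\<forall>i. i \<notin> {1..r} \<longrightarrow> m i = 0)}"

text \<open>The bases of the powers in \<open>zeta_sharp\<close>, with \<open>i\<close> counted from \<open>0\<close>.\<close>

definition sharp_base :: "nat \<Rightarrow> (nat \<Rightarrow> nat) \<Rightarrow> nat \<Rightarrow> nat" where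
  "sharp_base r m i = 2 * (\<Sum>j\<in>{r - i..r - 1}. m j) + m r"

lemma sharp_base_0: "1 \<le> r \<Longrightarrow> sharp_base r m 0 = m r"
  by (simp add: sharp_base_def)

lemma sharp_base_Suc:
  assumes "Suc i < r"
  shows "sharp_base r m (Suc i) = sharp_base r m i + 2 * m (r - Suc i)"
proof -
  have "{r - Suc i..r - 1} = insert (r - Suc i) {r - i..r - 1}" using assms by auto
  then show ?thesis using assms by (simp add: sharp_base_def)
qed

lemma strict_mono_on_lessThan_SucI:
  fixes n :: "nat \<Rightarrow> int"
  assumes "\<And>i. Suc i < r \<Longrightarrow> n i < n (Suc i)"
  shows "strict_mono_on {..<r} n"
proof (rule strict_mono_onI)
  fix i j assume "i \<in> {..<r}" "j \<in> {..<r}" "i < j"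
  then show "n i < n j"
  proof (induction j)
    case (Suc j)
    then have "n j < n (Suc j)" using assms by simp
    moreover have "n i \<le> n j" using Suc by (cases "i = j") auto
    ultimately show ?case by simp
  qed simp
qed

text \<open>Consecutive bases differ by twice an entry of m and the first one is \<open>m r\<close>,
  so they are positive, strictly increasing and of equal parity. Conversely, halved differences
  recover m.\<close>

lemma sharp_points_has_sum:
  assumes r0: "1 \<le> r"
  shows "((\<lambda>m. f (\<lambda>i. if i < r then int (sharp_base r m i) else 0)) has_sum x) (sharp_points r) \<longleftrightarrow>
    (f has_sum x) (increasing_points r)"
proof -
  let ?j = "\<lambda>m i. if i < r then int (sharp_base r m i) else 0"
  \<comment> \<open>The entry at \<open>l\<close> is half the difference of the bases at positions r
    - l and r - l - 1, counted from 0.\<close>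
  let ?i = "\<lambda>n j. if j = r then nat (n 0) else if 1 \<le> j \<and> j < r then nat ((n (r - j) - n (r - j - 1)) div 2) else 0"
  show ?thesis
  proof (rule has_sum_reindex_bij_witness[where j = ?j and i = ?i])
    fix m assume m: "m \<in> sharp_points r"
    show "?i (?j m) = m"
    proof
      fix l
      consider "l = r" | "1 \<le> l" "l < r" | "l \<notin> {1..r}" by fastforce
      then show "?i (?j m) l = m l"
      proof cases
        case 1 then show ?thesis using r0 by (simp add: sharp_base_0)
      next
        case 2
        define i where "i = r - l - 1"
        have i: "Suc i < r" "r - l = Suc i" "r - l - 1 = i" "r - Suc i = l" using 2 by (auto simp: i_def)
        show ?thesis using 2 i sharp_base_Suc[OF i(1), of m] by simp
      next
        case 3 then show ?thesis using m r0 by (auto simp: sharp_points_def)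
      qed
    qed
    have m1: "1 \<le> m l" if "l \<in> {1..r}" for l using m that by (simp add: sharp_points_def)
    have pos: "0 < sharp_base r m i" for i using m1[of r] r0 by (simp add: sharp_base_def)
    have par: "even (sharp_base r m i) \<longleftrightarrow> even (m r)" for i by (simp add: sharp_base_def)
    have "strict_mono_on {..<r} (?j m)"
    proof (rule strict_mono_on_lessThan_SucI)
      fix i assume i: "Suc i < r"
      have "1 \<le> m (r - Suc i)" using i by (intro m1) auto
      then show "?j m i < ?j m (Suc i)" using i by (simp add: sharp_base_Suc)
    qed
    then show "?j m \<in> increasing_points r"
      unfolding increasing_points_def using pos par by (simp add: supp_in_def)
  next
    fix n assume n: "n \<in> increasing_points r"
    note nD = increasing_pointsD[OF n]
    have step: "n i < n (Suc i)" "even (n (Suc i) - n i)" if "Suc i < r" for i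
    proof -
      show "n i < n (Suc i)" using strict_mono_onD[OF nD(3), of i "Suc i"] that by simp
      show "even (n (Suc i) - n i)" using nD(4)[of "Suc i" i] that by simp
    qed
    have sb: "int (sharp_base r (?i n) i) = n i" if "i < r" for i
      using that
    proof (induction i)
      case 0
      have "0 < n 0" using nD(1)[of 0] 0 by simp
      then show ?case using r0 by (simp add: sharp_base_0)
    next
      case (Suc i)
      have l: "r - Suc i \<noteq> r" "1 \<le> r - Suc i" "r - Suc i < r" "r - (r - Suc i) = Suc i" "r - (r - Suc i) - 1 = i"
        using Suc.prems by auto
      have "?i n (r - Suc i) = nat ((n (Suc i) - n i) div 2)" using l by simp
      then have "int (sharp_base r (?i n) (Suc i)) = n i + 2 * int (nat ((n (Suc i) - n i) div 2))"
        using Suc by (simp add: sharp_base_Suc)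
      also have "\<dots> = n i + 2 * ((n (Suc i) - n i) div 2)" using step[OF Suc.prems] by simp
      also have "\<dots> = n (Suc i)" using step(2)[OF Suc.prems] by (simp add: dvd_mult_div_cancel)
      finally show ?case .
    qed
    show "?j (?i n) = n"
    proof
      fix i
      show "?j (?i n) i = n i"
      proof (cases "i < r")
        case True then show ?thesis using sb[OF True] by simp
      next
        case False then show ?thesis using nD(2)[OF False] by simp
      qed
    qed
    show "?i n \<in> sharp_points r"
      unfolding sharp_points_def
    proof (intro CollectI conjI ballI allI impI)
      fix l assume l: "l \<in> {1..r}"
      show "1 \<le> ?i n l"
      proof (cases "l = r")
        case True
        have "0 < n 0" using nD(1)[of 0] r0 by simp
        then show ?thesis using True by simp
      next
        case False
        define i where "i = r - l - 1"
        have i: "Suc i < r" "r - l = Suc i" "r - l - 1 = i" using l False by (auto simp: i_def)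
        have "2 \<le> n (Suc i) - n i" using step[OF i(1)] by presburger
        then have "1 \<le> (n (Suc i) - n i) div 2" by simp
        then show ?thesis using l False i by simp
      qed
    next
      fix l assume "l \<notin> {1..r}"
      then show "?i n l = 0" using r0 by auto
    qed
  qed auto
qed

lemma zeta_sharp_has_sum:
  assumes r0: "1 \<le> r" and sum: "(list_monomial r d a has_sum x) (increasing_points r)"
  shows "zeta_sharp r (\<lambda>i. of_nat (2 * d * a ! (i - 1))) = x"
proof -
  have t: "(\<Prod>i\<in>{1..r}. (of_nat (2 * (\<Sum>j\<in>{r - i + 1..r - 1}. m j) + m r) :: complex) powr (- of_nat (2 * d * a ! (i - 1)))) =
     list_monomial r d a (\<lambda>i. if i < r then int (sharp_base r m i) else 0)" if m: "m \<in> sharp_points r" for m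
  proof -
    have "(\<Prod>i\<in>{1..r}. (of_nat (2 * (\<Sum>j\<in>{r - i + 1..r - 1}. m j) + m r) :: complex) powr (- of_nat (2 * d * a ! (i - 1)))) =
       (\<Prod>i<r. (of_nat (2 * (\<Sum>j\<in>{r - Suc i + 1..r - 1}. m j) + m r) :: complex) powr (- of_nat (2 * d * a ! i)))"
      by (rule prod.reindex_bij_witness[where i = Suc and j = "\<lambda>i. i - 1"]) auto
    also have "\<dots> = (\<Prod>i<r. 1 / of_int (if i < r then int (sharp_base r m i) else 0) ^ (2 * d * a ! i))"
    proof (rule prod.cong[OF refl])
      fix i assume i: "i \<in> {..<r}"
      have "r - Suc i + 1 = r - i" using i by auto
      then have b: "2 * (\<Sum>j\<in>{r - Suc i + 1..r - 1}. m j) + m r = sharp_base r m i" by (simp add: sharp_base_def)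
      \<comment> \<open>Every base is at least \<open>m r\<close>, hence nonzero, so the complex
        power is an ordinary one.\<close>
      have "1 \<le> m r" using m r0 by (simp add: sharp_points_def)
      then have "sharp_base r m i \<noteq> 0" by (simp add: sharp_base_def)
      then have "(of_nat (sharp_base r m i) :: complex) \<noteq> 0" by (simp only: of_nat_eq_0_iff not_False_eq_True)
      then have "(of_nat (sharp_base r m i) :: complex) powr (- of_nat (2 * d * a ! i)) = 1 / of_nat (sharp_base r m i) ^ (2 * d * a ! i)"
        by (simp only: powr_minus_divide powr_nat' simp_thms)
      then show "(of_nat (2 * (\<Sum>j\<in>{r - Suc i + 1..r - 1}. m j) + m r) :: complex) powr (- of_nat (2 * d * a ! i)) =
         1 / of_int (if i < r then int (sharp_base r m i) else 0) ^ (2 * d * a ! i)"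
        unfolding b using i by simp
    qed
    finally show ?thesis by (simp add: list_monomial_def)
  qed
  have "((\<lambda>m. list_monomial r d a (\<lambda>i. if i < r then int (sharp_base r m i) else 0)) has_sum x) (sharp_points r)"
    using sum sharp_points_has_sum[OF r0] by blast
  then have "((\<lambda>m. \<Prod>i\<in>{1..r}. (of_nat (2 * (\<Sum>j\<in>{r - i + 1..r - 1}. m j) + m r) :: complex) powr (- of_nat (2 * d * a ! (i - 1)))) has_sum x) (sharp_points r)"
    by (rule iffD1[OF has_sum_cong, rotated]) (simp only: t)
  then show ?thesis unfolding zeta_sharp_def sharp_points_def by (rule infsumI)
qed

text \<open>The reversal stems from the numbering gamma_i = e_(r-i+1): the i-th entry belongs to
  coordinate r - i, counted from 0.\<close>

lemma attach_eq_root_index: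
  assumes "length xs = r"
  shows "attach r (map (\<lambda>x. 2 * d * x) xs) = root_index r (list_exponent r d (rev xs))"
proof
  fix \<alpha>
  show "attach r (map (\<lambda>x. 2 * d * x) xs) \<alpha> = root_index r (list_exponent r d (rev xs)) \<alpha>"
  proof (cases "\<alpha> \<in> short_posroots_B r")
    case True
    then obtain j where j: "j < r" "\<alpha> = unitv j" by (auto simp: short_posroots_eq)
    have "attach r (map (\<lambda>x. 2 * d * x) xs) \<alpha> = (\<Sum>i\<in>{1..r}. if i = r - j then 2 * d * xs ! (r - j - 1) else 0)"
      unfolding attach_def
    proof (rule sum.cong[OF refl])
      fix i assume i: "i \<in> {1..r}"
      have "\<alpha> = gammaB r i \<longleftrightarrow> i = r - j" using i j by (auto simp: gammaB_def)
      then show "(if \<alpha> = gammaB r i then map (\<lambda>x. 2 * d * x) xs ! (i - 1) else 0) = (if i = r - j then 2 * d * xs ! (r - j - 1) else 0)"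
        using i assms by auto
    qed
    also have "\<dots> = 2 * d * xs ! (r - j - 1)" using j by simp
    also have "\<dots> = root_index r (list_exponent r d (rev xs)) \<alpha>"
      using j assms by (simp add: root_index_unitv list_exponent_def rev_nth)
    finally show ?thesis .
  next
    case False
    then have "\<alpha> \<noteq> gammaB r i" if "i \<in> {1..r}" for i using that by (auto simp: short_posroots_B_def)
    then show ?thesis using False by (auto simp: attach_def root_index_def intro!: sum.neutral)
  qed
qed

text \<open>For even exponents only products of the rational numbers \<open>half_coeff\<close> and
  \<open>odd_coeff\<close> remain.\<close>

lemma series_coeff_rational:
  assumes nus: "set nus = long_posroots_B r" and k: "\<And>i. i < r \<Longrightarrow> even (k i) \<and> 2 \<le> k i"
  shows "series_coeff r \<phi> nus k \<in> \<rat>"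
proof -
  have h: "half_coeff m \<in> \<rat>" for m unfolding half_coeff_def by (intro Rats_divide bern_coeff_rational Rats_power) auto
  have o: "odd_coeff m \<in> \<rat>" for m unfolding odd_coeff_def by (intro Rats_diff bern_coeff_rational h)
  show ?thesis
    by (subst series_coeff_even[OF nus], erule k, rule Rats_sum) (auto intro!: Rats_add Rats_prod h o)
qed

theorem theorem7p3:
  fixes r d N :: nat and \<phi> :: "nat \<Rightarrow> real" and nus :: "(nat \<Rightarrow> real) list"
  assumes "1 \<le> r" and "1 \<le> d" and "r \<le> N"
    and "inV r \<phi>"
    and "\<forall>Vb\<in>bases_B r. \<forall>\<beta>\<in>Vb. ip r \<phi> (mu r Vb \<beta>) \<noteq> 0"
    and "distinct nus" and "set nus = posroots_B r - short_posroots_B r"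
  shows "(\<Sum>a\<in>{a. length a = r \<and> (\<forall>x\<in>set a. 1 \<le> x) \<and> sum_list a = N}.
            zeta_sharp r (\<lambda>i. of_nat (2 * d * a ! (i - 1))))
         = (-1) ^ r / 2 ^ r *
           (\<Sum>J\<in>compositions r. 1 / (\<Prod>j\<leftarrow>J. fact j) *
              (\<Sum>k\<in>Aset N J.
                 Pcoef r (short_posroots_B r) nus \<phi> (\<lambda>_. 0) (attach r (map (\<lambda>x. 2 * d * x) k)) *
                 (\<Prod>\<rho>\<in>{1..r}. (2 * of_real pi * \<i>) ^ (2 * d * k ! (\<rho> - 1))
                                 / fact (2 * d * k ! (\<rho> - 1)))))
       \<and> (\<exists>q :: real. q \<in> \<rat> \<and>
            (\<Sum>a\<in>{a. length a = r \<and> (\<forall>x\<in>set a. 1 \<le> x) \<and> sum_list a = N}.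
               zeta_sharp r (\<lambda>i. of_nat (2 * d * a ! (i - 1))))
            = of_real q * of_real pi ^ (2 * d * N))"
proof -
  have nus: "set nus = long_posroots_B r" using assms(7) by (simp add: posroots_minus_short)
  note r0 = assms(1) and d0 = assms(2) and \<phi> = assms(5) and dist = assms(6)
  let ?L = "part_lists r N"
  let ?C = "(2 * of_real pi * \<i> :: complex) ^ (2 * d * N)"
  define sc where "sc a = series_coeff r \<phi> nus (list_exponent r d a)" for a
  \<comment> \<open>The sum of the monomial over all regular points; \<open>W\<close> below is the
    same sum over increasing points, that is, the zeta value.\<close>
  define T where "T a = ?C * ((-1) ^ r * sc a)" for a
  have T: "(list_monomial r d a has_sum T a) (regular_points r)" if "a \<in> ?L" for a
    unfolding T_def sc_def by (rule list_monomial_has_sum[OF dist nus r0 d0 that])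
  define W where "W a = infsum (list_monomial r d a) (increasing_points r)" for a
  have W: "(list_monomial r d a has_sum W a) (increasing_points r)" if "a \<in> ?L" for a
    unfolding W_def
    by (rule has_sum_infsum, rule summable_on_subset_banach[OF has_sum_imp_summable[OF T[OF that]] increasing_regular])
  have zeta: "zeta_sharp r (\<lambda>i. of_nat (2 * d * a ! (i - 1))) = W a" if "a \<in> ?L" for a
    by (rule zeta_sharp_has_sum[OF r0 W[OF that]])
  have mem: "b \<in> ?L" if "a \<in> ?L" "mset a = mset b" for a b
    using that mset_eq_setD[OF that(2)] mset_eq_length[OF that(2)] by (simp add: part_lists_def) (metis sum_mset_sum_list)
  have Tsym: "T a = T b" if a: "a \<in> ?L" and m: "mset a = mset b" for a b
  proof -
    have "length a = r" using a by (simp add: part_lists_def)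
    from iffD1[OF list_monomial_sum_mset[OF this m] T[OF a]] T[OF mem[OF a m]] show ?thesis by (rule has_sum_unique)
  qed
  \<comment> \<open>Invariance under signed permutations holds for the total over all lists, so the
    comparison is made after summation.\<close>
  have "(\<Sum>a\<in>?L. T a) = fact r * 2 ^ r * (\<Sum>a\<in>?L. W a)"
  proof (rule regular_sum_symmetric)
    show "((\<lambda>n. \<Sum>a\<in>?L. list_monomial r d a n) has_sum (\<Sum>a\<in>?L. T a)) (regular_points r)"
      by (rule has_sum_finite_sum[OF finite_part_lists T])
    show "((\<lambda>n. \<Sum>a\<in>?L. list_monomial r d a n) has_sum (\<Sum>a\<in>?L. W a)) (increasing_points r)"
      by (rule has_sum_finite_sum[OF finite_part_lists W])
  qed (rule part_lists_sum_signed_perm)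
  then have LW: "(\<Sum>a\<in>?L. W a) = (\<Sum>a\<in>?L. T a) / (fact r * 2 ^ r)" by (simp add: field_simps)
  have lhs: "(\<Sum>a\<in>{a. length a = r \<and> (\<forall>x\<in>set a. 1 \<le> x) \<and> sum_list a = N}.
      zeta_sharp r (\<lambda>i. of_nat (2 * d * a ! (i - 1)))) = (\<Sum>a\<in>?L. W a)"
    unfolding part_lists_def[symmetric] by (rule sum.cong[OF refl zeta])
  have P: "Pcoef r (short_posroots_B r) nus \<phi> (\<lambda>_. 0) (attach r (map (\<lambda>x. 2 * d * x) k)) *
     (\<Prod>\<rho>\<in>{1..r}. (2 * of_real pi * \<i>) ^ (2 * d * k ! (\<rho> - 1)) / fact (2 * d * k ! (\<rho> - 1))) = (-1) ^ r * T k"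
    if k: "k \<in> ?L" for k
  proof -
    have len: "length k = r" "sum_list k = N" using k by (auto simp: part_lists_def)
    let ?e = "list_exponent r d (rev k)"
    have "?e \<in> supp_in {..<r}" by (simp add: list_exponent_def supp_in_def)
    then have P: "Pcoef r (short_posroots_B r) nus \<phi> (\<lambda>_. 0) (attach r (map (\<lambda>x. 2 * d * x) k)) = sc (rev k) * (\<Prod>i<r. fact (?e i))"
      unfolding attach_eq_root_index[OF len(1)] sc_def by (rule Pcoef_root_index[OF nus r0 \<phi>])
    have "(\<Prod>\<rho>\<in>{1..r}. (2 * of_real pi * \<i> :: complex) ^ (2 * d * k ! (\<rho> - 1)) / fact (2 * d * k ! (\<rho> - 1))) =
       (\<Prod>i<r. (2 * of_real pi * \<i>) ^ ?e i / fact (?e i))"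
      by (rule prod.reindex_bij_witness[where i = "\<lambda>i. r - i" and j = "\<lambda>\<rho>. r - \<rho>"])
         (auto simp: list_exponent_def rev_nth len(1))
    also have "\<dots> = (2 * of_real pi * \<i>) ^ (\<Sum>i<r. ?e i) / (\<Prod>i<r. fact (?e i))"
      by (simp add: prod_dividef power_sum)
    also have "(\<Sum>i<r. ?e i) = 2 * d * N" using sum_list_exponent[of "rev k" r d] len by simp
    finally have "Pcoef r (short_posroots_B r) nus \<phi> (\<lambda>_. 0) (attach r (map (\<lambda>x. 2 * d * x) k)) *
     (\<Prod>\<rho>\<in>{1..r}. (2 * of_real pi * \<i>) ^ (2 * d * k ! (\<rho> - 1)) / fact (2 * d * k ! (\<rho> - 1))) = sc (rev k) * ?C"
      unfolding P by simp
    also have "\<dots> = (-1) ^ r * T (rev k)" by (simp add: T_def mult_ac flip: power_mult_distrib)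
    \<comment> \<open>\<open>attach\<close> reverses the list; the symmetry of \<open>T\<close>
      undoes this.\<close>
    also have "T (rev k) = T k" using Tsym[OF k, of "rev k"] by simp
    finally show ?thesis .
  qed
  have "(\<Sum>J\<in>compositions r. 1 / (\<Prod>j\<leftarrow>J. fact j) *
      (\<Sum>k\<in>Aset N J. Pcoef r (short_posroots_B r) nus \<phi> (\<lambda>_. 0) (attach r (map (\<lambda>x. 2 * d * x) k)) *
         (\<Prod>\<rho>\<in>{1..r}. (2 * of_real pi * \<i>) ^ (2 * d * k ! (\<rho> - 1)) / fact (2 * d * k ! (\<rho> - 1))))) =
     (\<Sum>J\<in>compositions r. 1 / (\<Prod>j\<leftarrow>J. fact j) * (\<Sum>k\<in>Aset N J. (-1) ^ r * T k))"
    by (intro sum.cong refl arg_cong2[where f = "(*)"] P) (use Aset_iff in blast)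
  also have "\<dots> = (-1) ^ r * (\<Sum>J\<in>compositions r. 1 / (\<Prod>j\<leftarrow>J. fact j) * (\<Sum>k\<in>Aset N J. T k))"
    by (simp only: sum_distrib_left sum_distrib_right mult_ac)
  also have "(\<Sum>J\<in>compositions r. 1 / (\<Prod>j\<leftarrow>J. fact j) * (\<Sum>k\<in>Aset N J. T k)) = (\<Sum>a\<in>?L. T a) / fact r"
    using sum_part_lists_symmetric[of r N T, OF Tsym] by (simp add: field_simps)
  finally have rhs: "(\<Sum>J\<in>compositions r. 1 / (\<Prod>j\<leftarrow>J. fact j) *
      (\<Sum>k\<in>Aset N J. Pcoef r (short_posroots_B r) nus \<phi> (\<lambda>_. 0) (attach r (map (\<lambda>x. 2 * d * x) k)) *
         (\<Prod>\<rho>\<in>{1..r}. (2 * of_real pi * \<i>) ^ (2 * d * k ! (\<rho> - 1)) / fact (2 * d * k ! (\<rho> - 1))))) =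
     (-1) ^ r * ((\<Sum>a\<in>?L. T a) / fact r)" .
  have m1: "(-1 :: complex) ^ r * (-1) ^ r = 1" by (simp flip: power_mult_distrib)
  have eq: "(\<Sum>a\<in>?L. W a) = (-1) ^ r / 2 ^ r * ((-1) ^ r * ((\<Sum>a\<in>?L. T a) / fact r))"
  proof -
    have "(-1 :: complex) ^ r / 2 ^ r * ((-1) ^ r * ((\<Sum>a\<in>?L. T a) / fact r)) = ((-1) ^ r * (-1) ^ r) * ((\<Sum>a\<in>?L. T a) / (fact r * 2 ^ r))"
      by (simp add: mult_ac)
    then show ?thesis unfolding LW m1 by simp
  qed
  have "\<exists>q :: real. q \<in> \<rat> \<and> (\<Sum>a\<in>?L. W a) = of_real q * of_real pi ^ (2 * d * N)"
  proof -
    \<comment> \<open>In (2 pi i)^(2dN) the power of i is (-1)^(dN), so splitting off the power of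
      pi leaves a rational factor.\<close>
    define z where "z = (2 :: complex) ^ (2 * d * N) * (-1) ^ (d * N) * (-1) ^ r * (\<Sum>a\<in>?L. sc a) / (fact r * 2 ^ r)"
    have "\<i> ^ (2 * d * N) = (-1 :: complex) ^ (d * N)" by (simp add: power_mult mult.assoc)
    then have C: "?C = 2 ^ (2 * d * N) * (-1) ^ (d * N) * of_real pi ^ (2 * d * N)"
      by (simp only: power_mult_distrib mult_ac)
    have Wz: "(\<Sum>a\<in>?L. W a) = z * of_real pi ^ (2 * d * N)"
    proof -
      have "(\<Sum>a\<in>?L. T a) = ?C * ((-1) ^ r * (\<Sum>a\<in>?L. sc a))" by (simp only: T_def sum_distrib_left)
      then show ?thesis unfolding LW C z_def by (simp add: mult_ac)
    qed
    have scQ: "sc a \<in> \<rat>" if "a \<in> ?L" for a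
      unfolding sc_def by (rule series_coeff_rational[OF nus list_exponent_even[OF that d0]])
    have factQ: "fact r \<in> (\<rat> :: complex set)" using Rats_of_nat[of "fact r"] by simp
    have "z \<in> \<rat>"
      unfolding z_def by (intro Rats_divide Rats_mult Rats_power Rats_sum scQ factQ) auto
    then obtain q :: rat where "z = of_rat q" by (auto elim: Rats_cases)
    then have "z = of_real (of_rat q :: real)" by (cases q) (simp add: of_rat_rat)
    moreover have "(of_rat q :: real) \<in> \<rat>" by simp
    ultimately show ?thesis using Wz by blast
  qed
  then show ?thesis unfolding lhs rhs using eq by blast
qed

end
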